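(* There is a randomized algorithm that, given an undirected graph $G$ on $n$ vertices together with an elimination forest of $G$ of depth $d$, and numbers $k,\ell\in\mathbb{N}$, solves the \textsc{Partial Cycle Cover} problem for $G,k,\ell$ in time $5^{d}\cdot n^{\mathcal{O}(1)}$ and using polynomial space. The algorithm has one-sided error: it may give false negatives with probability at most $\frac{1}{2}$, and never gives false positives.
   Context: A rooted forest is a directed acyclic graph in which every vertex has outdegree at most $1$; $u$ is an ancestor of $v$ if $u$ is reachable from $v$ by a directed path (every vertex is its own ancestor). The depth of a rooted forest is the maximum number of vertices on a directed path. An elimination forest of a graph $G$ is a rooted forest on vertex set $V(G)$ such that for every edge $uv$ of $G$, one of $u,v$ is an ancestor of the other. \textsc{Partial Cycle Cover}: given an undirected graph $G$ and integers $k,\ell$, decide whether there is a family of at most $k$ vertex-disjoint cycles in $G$ that jointly visit exactly $\ell$ vertices. *)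

theory Defs
  imports
    "HOL-Probability.Probability"
    "HOL-Computational_Algebra.Polynomial"
    "HOL-Library.Log_Nat"
    "Graph_Theory.Graph_Theory"
begin

section \<open>Rooted forests, elimination forests and the problem\<close>

text \<open>
  Undirected simple graphs are loop-free symmetric digraphs (locale \<^locale>\<open>pair_graph\<close>).
  The arcs of a rooted forest point from a vertex towards its root.
\<close>

definition rooted_forest :: "'a pair_pre_digraph \<Rightarrow> bool" where
  "rooted_forest F \<longleftrightarrow>
     pair_fin_digraph F \<and> acyclic (parcs F) \<and>
     (\<forall>v \<in> pverts F. out_degree (with_proj F) v \<le> 1)"

definition ancestor :: "'a pair_pre_digraph \<Rightarrow> 'a \<Rightarrow> 'a \<Rightarrow> bool" where
  "ancestor F u v \<longleftrightarrow> reachable (with_proj F) v u"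

text \<open>The supremum makes the depth of the empty forest 0.\<close>

definition forest_depth :: "'a pair_pre_digraph \<Rightarrow> nat" where
  "forest_depth F = Sup {length p |p. vpath p (with_proj F)}"

definition elimination_forest :: "'a pair_pre_digraph \<Rightarrow> 'a pair_pre_digraph \<Rightarrow> bool" where
  "elimination_forest F G \<longleftrightarrow>
     rooted_forest F \<and> pverts F = pverts G \<and>
     (\<forall>(u, v) \<in> parcs G. ancestor F u v \<or> ancestor F v u)"

text \<open>
  In a symmetric digraph every edge yields a directed cycle of length 2, which is not a cycle
  of the undirected graph; hence the length condition. Cycles are lists of arcs.
\<close>

definition undirected_cycle :: "'a pair_pre_digraph \<Rightarrow> ('a \<times> 'a) list \<Rightarrow> bool" where
  "undirected_cycle G c \<longleftrightarrow> pre_digraph.cycle (with_proj G) c \<and> 3 \<le> length c"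

definition cycle_verts :: "('a \<times> 'a) list \<Rightarrow> 'a set" where
  "cycle_verts c = fst ` set c"

definition partial_cycle_cover :: "'a pair_pre_digraph \<Rightarrow> nat \<Rightarrow> nat \<Rightarrow> bool" where
  "partial_cycle_cover G k l \<longleftrightarrow>
     (\<exists>C. finite C \<and> card C \<le> k \<and>
        (\<forall>c \<in> C. undirected_cycle G c) \<and>
        (\<forall>c \<in> C. \<forall>c' \<in> C. c \<noteq> c' \<longrightarrow> cycle_verts c \<inter> cycle_verts c' = {}) \<and>
        card (\<Union>c \<in> C. cycle_verts c) = l)"


section \<open>Randomized algorithms\<close>

text \<open>
  Algorithms are programs of a randomized random-access machine in structured form. The store
  consists of arrays of natural numbers, indexed by natural numbers, of which a program can
  mention only finitely many; scalar variables are arrays used at index 0 only. \<open>Flip\<close> stores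
  a fair random bit. Subtraction is truncated.

  Time is the number of executed steps. Space is measured in bits, so under a polynomial space
  bound all numbers have polynomially many bits and the unit-cost arithmetic (including
  multiplication and division) agrees with bit cost up to polynomial factors.
\<close>

type_synonym state = "string \<Rightarrow> nat \<Rightarrow> nat"

datatype aexp =
    Num nat
  | Read string aexp
  | Plus aexp aexp
  | Minus aexp aexp
  | Times aexp aexp
  | Div aexp aexp
  | Mod aexp aexp

datatype bexp =
    Less aexp aexp
  | Eq aexp aexp
  | Neg bexp
  | And bexp bexp

datatype com =
    SKIP
  | Assign string aexp aexp
  | Flip string aexp
  | Seq com com
  | Cond bexp com com
  | While bexp com

primrec aval :: "aexp \<Rightarrow> state \<Rightarrow> nat" where
  "aval (Num m) s = m"
| "aval (Read x e) s = s x (aval e s)"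
| "aval (Plus e f) s = aval e s + aval f s"
| "aval (Minus e f) s = aval e s - aval f s"
| "aval (Times e f) s = aval e s * aval f s"
| "aval (Div e f) s = aval e s div aval f s"
| "aval (Mod e f) s = aval e s mod aval f s"

primrec bval :: "bexp \<Rightarrow> state \<Rightarrow> bool" where
  "bval (Less e f) s \<longleftrightarrow> aval e s < aval f s"
| "bval (Eq e f) s \<longleftrightarrow> aval e s = aval f s"
| "bval (Neg b) s \<longleftrightarrow> \<not> bval b s"
| "bval (And a b) s \<longleftrightarrow> bval a s \<and> bval b s"

definition store :: "state \<Rightarrow> string \<Rightarrow> nat \<Rightarrow> nat \<Rightarrow> state" where
  "store s x i m = s(x := (s x)(i := m))"

text \<open>A configuration is a remaining program with a store; it is halted if \<open>SKIP\<close> remains.\<close>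

primrec step :: "com \<Rightarrow> state \<Rightarrow> (com \<times> state) pmf" where
  "step SKIP s = return_pmf (SKIP, s)"
| "step (Assign x e f) s = return_pmf (SKIP, store s x (aval e s) (aval f s))"
| "step (Flip x e) s =
     map_pmf (\<lambda>b. (SKIP, store s x (aval e s) (of_bool b))) (bernoulli_pmf (1/2))"
| "step (Seq c d) s =
     (if c = SKIP then return_pmf (d, s)
      else map_pmf (\<lambda>(c', s'). (Seq c' d, s')) (step c s))"
| "step (Cond b c d) s = return_pmf (if bval b s then c else d, s)"
| "step (While b c) s =
     return_pmf (if bval b s then Seq c (While b c) else SKIP, s)"

primrec steps :: "nat \<Rightarrow> com \<Rightarrow> state \<Rightarrow> (com \<times> state) pmf" where
  "steps 0 c s = return_pmf (c, s)"
| "steps (Suc t) c s = bind_pmf (step c s) (\<lambda>(c', s'). steps t c' s')"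

definition halts_within :: "com \<Rightarrow> state \<Rightarrow> nat \<Rightarrow> bool" where
  "halts_within c s t \<longleftrightarrow> (\<forall>(c', s') \<in> set_pmf (steps t c s). c' = SKIP)"

text \<open>
  Cells holding 0 are free, every other cell is charged for the binary lengths of its address
  and of its content.
\<close>

definition bit_size :: "state \<Rightarrow> nat" where
  "bit_size s = (\<Sum>(x, i) | s x i \<noteq> 0. floorlog 2 i + floorlog 2 (s x i))"

definition space_within :: "com \<Rightarrow> state \<Rightarrow> nat \<Rightarrow> bool" where
  "space_within c s b \<longleftrightarrow>
     (\<forall>t. \<forall>(c', s') \<in> set_pmf (steps t c s).
        finite {(x, i). s' x i \<noteq> 0} \<and> bit_size s' \<le> b)"

text \<open>
  Probability that the program has halted after \<open>t\<close> steps with answer \<open>a\<close>, where a nonzero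
  value of \<open>result\<close> stands for yes.
\<close>

definition answer_prob :: "com \<Rightarrow> state \<Rightarrow> nat \<Rightarrow> bool \<Rightarrow> real" where
  "answer_prob c s t a =
     measure_pmf.prob (steps t c s) {(c', s'). c' = SKIP \<and> (s' ''result'' 0 \<noteq> 0) = a}"

text \<open>
  Encoding of an instance with vertex set \<open>{..<n}\<close>: the scalars \<open>n\<close>, \<open>k\<close>, \<open>l\<close>, the
  row-major adjacency matrix of the graph, and the parent pointers of the forest, shifted by
  one so that 0 marks a root. The depth of the forest is not part of the input.
\<close>

definition input_state ::
  "nat \<Rightarrow> nat pair_pre_digraph \<Rightarrow> nat pair_pre_digraph \<Rightarrow> nat \<Rightarrow> nat \<Rightarrow> state" where
  "input_state n G F k l = (\<lambda>_ _. 0)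
     (''n'' := (\<lambda>_. 0)(0 := n),
      ''k'' := (\<lambda>_. 0)(0 := k),
      ''l'' := (\<lambda>_. 0)(0 := l),
      ''adj'' := (\<lambda>i. of_bool (i < n * n \<and> (i div n, i mod n) \<in> parcs G)),
      ''parent'' := (\<lambda>v. if \<exists>u. (v, u) \<in> parcs F
                          then Suc (THE u. (v, u) \<in> parcs F) else 0))"

definition input_size :: "nat \<Rightarrow> nat \<Rightarrow> nat \<Rightarrow> nat" where
  "input_size n k l = n + floorlog 2 k + floorlog 2 l"

end

theory Submission
  imports Defs
begin

text \<open>
  Let every vertex be in one of five states: 0, or a side of a cut together with a sign. An edge
  interacts only between two nonzero states on the same side, with the product of the signs.
  Summing over the signs keeps exactly the edge sets with all degrees even (state 0, with weight
  \<open>2 - 4 y\<close>, subtracts what the signed states contribute to isolated vertices), and summing over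
  the sides counts the cuts that no edge crosses. Such an edge set with as many edges as vertices
  is a disjoint union of cycles; together with its isolated vertices it has \<open>2 ^ (n - l + c)\<close>
  consistent cuts, where \<open>c\<close> is the number of cycles and \<open>l\<close> the number of covered vertices.
  So modulo \<open>2 ^ (k + 1)\<close> (up to a fixed power of two) only the edge sets with at most \<open>k\<close> cycles
  survive, and with random edge weights the isolation lemma makes one of them the unique one of
  minimum weight with probability at least 1/2.

  The weights, the number of edges and the number of vertices are recorded as the exponent of a
  power of two \<open>t\<close> that exceeds all coefficients, so the generating function is one integer. As a
  partition function with five states it is evaluated along the elimination forest: only the
  states of a vertex and its ancestors matter at a time, and these range over the base 5 digits of
  a counter below \<open>5 ^ d\<close>.
\<close>

section \<open>A program logic with time and space\<close>

text \<open>The machine has neither recursion nor signed numbers, and both facts shape the proof.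
  Branching over states along the forest becomes a counter with one accumulator cell per vertex: a
  table over all states would need exponential space, while the partial sums for the current digits
  suffice. Signs are handled by computing modulo \<open>M\<close>, with \<open>M - 1\<close> for -1;
  the final integer is nonnegative and below \<open>M\<close>, hence recovered exactly, although
  intermediate results are known only as residues. The weight \<open>2 - 4 * y\<close> is forced: a
  vertex of degree 0 must contribute 1 for each of the two sides, and each side offers two signed
  states of weight \<open>y\<close>. A covered vertex contributes \<open>2 * y\<close>, so with
  \<open>l\<close> covered vertices and \<open>c\<close> cycles the coefficient is
  \<open>2 ^ l * 2 ^ (n - l + c) = 2 ^ (n + c)\<close>; this is the origin of the test modulo
  \<open>2 ^ (n + k + 1)\<close>. Time, space and the absence of false positives hold for every
  outcome of the coins. Probability enters in one place only: the distribution of the number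
  \<open>R\<close> whose digits are the edge weights.\<close>

primrec avars :: "aexp \<Rightarrow> string set" where
  "avars (Num m) = {}"
| "avars (Read x e) = insert x (avars e)"
| "avars (Plus e f) = avars e \<union> avars f"
| "avars (Minus e f) = avars e \<union> avars f"
| "avars (Times e f) = avars e \<union> avars f"
| "avars (Div e f) = avars e \<union> avars f"
| "avars (Mod e f) = avars e \<union> avars f"

text \<open>An upper bound on the arrays that a program can write. It serves as the frame condition
  of the proof rules and, being finite, bounds the number of arrays that the space measure
  charges.\<close>

primrec mods :: "com \<Rightarrow> string set" where
  "mods SKIP = {}"
| "mods (Assign x e f) = {x}"
| "mods (Flip x e) = {x}"
| "mods (Seq c d) = mods c \<union> mods d"
| "mods (Cond b c d) = mods c \<union> mods d"
| "mods (While b c) = mods c"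

lemma finite_mods [simp]: "finite (mods c)"
  by (induction c) auto

lemma aval_cong: "(\<And>x. x \<in> avars e \<Longrightarrow> s x = s' x) \<Longrightarrow> aval e s = aval e s'"
  by (induction e) auto

lemma store_apply [simp]: "store s x i m y = (if y = x then (s x)(i := m) else s y)"
  by (simp add: store_def)

lemma step_mods:
  "(c', s') \<in> set_pmf (step c s) \<Longrightarrow> mods c' \<subseteq> mods c \<and> (\<forall>x. x \<notin> mods c \<longrightarrow> s' x = s x)"
proof (induction c arbitrary: c' s')
  case (Seq c d)
  show ?case
  proof (cases "c = SKIP")
    case False
    then obtain c1 where "(c1, s') \<in> set_pmf (step c s)" "c' = Seq c1 d"
      using Seq.prems by auto
    with Seq.IH(1)[of c1 s'] show ?thesis by auto
  qed (use Seq.prems in auto)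
qed (auto split: if_splits)

lemma steps_mods:
  "(c', s') \<in> set_pmf (steps t c s) \<Longrightarrow> x \<notin> mods c \<Longrightarrow> s' x = s x"
proof (induction t arbitrary: c s)
  case (Suc t)
  then obtain c1 s1 where "(c1, s1) \<in> set_pmf (step c s)" "(c', s') \<in> set_pmf (steps t c1 s1)"
    by auto
  with step_mods[of c1 s1 c s] Suc show ?case by (metis subsetD)
qed auto

text \<open>
  \<open>run P Q t c s\<close>: every execution of \<open>c\<close> from \<open>s\<close> halts within \<open>t\<close> steps in a state satisfying
  \<open>Q\<close>, and all states on the way satisfy \<open>P\<close>. Random bits are treated demonically.
\<close>

primrec run :: "(state \<Rightarrow> bool) \<Rightarrow> (state \<Rightarrow> bool) \<Rightarrow> nat \<Rightarrow> com \<Rightarrow> state \<Rightarrow> bool" where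
  "run P Q 0 c s \<longleftrightarrow> P s \<and> c = SKIP \<and> Q s"
| "run P Q (Suc t) c s \<longleftrightarrow> P s \<and>
     (if c = SKIP then Q s else \<forall>(c', s') \<in> set_pmf (step c s). run P Q t c' s')"

lemma run_imp_P: "run P Q t c s \<Longrightarrow> P s"
  by (cases t) auto

lemma run_SKIP_iff: "run P Q t SKIP s \<longleftrightarrow> P s \<and> Q s"
  by (cases t) auto

lemma run_mono: "run P Q t c s \<Longrightarrow> t \<le> t' \<Longrightarrow> (\<And>s'. P s' \<Longrightarrow> Q s' \<Longrightarrow> Q' s') \<Longrightarrow> run P Q' t' c s"
proof (induction t arbitrary: c s t')
  case 0
  then show ?case by (auto simp: run_SKIP_iff)
next
  case (Suc t)
  then obtain t'' where [simp]: "t' = Suc t''" and "t \<le> t''" by (cases t') auto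
  show ?case
  proof (cases "c = SKIP")
    case True
    then show ?thesis using Suc.prems by auto
  next
    case False
    have "run P Q' t'' c' s'" if "(c', s') \<in> set_pmf (step c s)" for c' s'
      using Suc.prems that False \<open>t \<le> t''\<close> by (intro Suc.IH[of c' s' t'']) auto
    then show ?thesis using Suc.prems False by auto
  qed
qed

lemma steps_SKIP [simp]: "steps t SKIP s = return_pmf (SKIP, s)"
  by (induction t) (auto simp: bind_return_pmf)

lemma run_steps:
  "run P Q t c s \<Longrightarrow> (c', s') \<in> set_pmf (steps t c s) \<Longrightarrow> c' = SKIP \<and> Q s'"
proof (induction t arbitrary: c s)
  case (Suc t)
  then show ?case
  proof (cases "c = SKIP")
    case True
    then show ?thesis using Suc by (auto simp: run_SKIP_iff)
  next
    case False
    obtain c1 s1 where 1: "(c1, s1) \<in> set_pmf (step c s)" "(c', s') \<in> set_pmf (steps t c1 s1)"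
      using Suc.prems by auto
    then have "run P Q t c1 s1" using False Suc.prems(1) by auto
    then show ?thesis using Suc.IH 1(2) by blast
  qed
qed auto

lemma run_steps_inv:
  "run P Q t c s \<Longrightarrow> (c', s') \<in> set_pmf (steps t' c s) \<Longrightarrow> P s'"
proof (induction t' arbitrary: c s t)
  case 0
  then show ?case by (auto dest: run_imp_P)
next
  case (Suc t')
  obtain c1 s1 where 1: "(c1, s1) \<in> set_pmf (step c s)" "(c', s') \<in> set_pmf (steps t' c1 s1)"
    using Suc.prems by auto
  show ?case
  proof (cases "c = SKIP")
    case True
    then show ?thesis using Suc 1 by auto
  next
    case False
    then obtain t1 where "t = Suc t1" using Suc.prems by (cases t) auto
    then have "run P Q t1 c1 s1" using False 1(1) Suc.prems(1) by auto
    then show ?thesis using Suc.IH 1(2) by blast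
  qed
qed

text \<open>Built into the rules for sequencing and counting loops, so that the specification of a
  command mentions only what the command computes.\<close>

lemma run_frame:
  "run P Q t c s \<Longrightarrow> run P (\<lambda>s'. Q s' \<and> (\<forall>x. x \<notin> mods c \<longrightarrow> s' x = s x)) t c s"
proof (induction t arbitrary: c s)
  case (Suc t)
  show ?case
  proof (cases "c = SKIP")
    case True
    then show ?thesis using Suc.prems by auto
  next
    case False
    have "run P (\<lambda>s'. Q s' \<and> (\<forall>x. x \<notin> mods c \<longrightarrow> s' x = s x)) t c' s'"
      if "(c', s') \<in> set_pmf (step c s)" for c' s'
    proof -
      have "run P Q t c' s'" using Suc.prems that False by auto
      from Suc.IH[OF this] show ?thesis
        by (rule run_mono) (use step_mods[OF that] in auto)
    qed
    then show ?thesis using Suc.prems False by auto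
  qed
qed auto

text \<open>The extra step is the one that discards the \<open>SKIP\<close> left over by
  \<open>c\<close>.\<close>

lemma run_Seq_aux:
  "run P R t c s \<Longrightarrow> (\<And>s'. P s' \<Longrightarrow> R s' \<Longrightarrow> run P Q t' d s') \<Longrightarrow> run P Q (Suc (t + t')) (Seq c d) s"
proof (induction t arbitrary: c s)
  case 0
  then show ?case by auto
next
  case (Suc t)
  show ?case
  proof (cases "c = SKIP")
    case True
    then have "run P Q t' d s" using Suc.prems by auto
    then have "run P Q (Suc t + t') d s" by (rule run_mono) auto
    then show ?thesis using True Suc.prems by auto
  next
    case False
    have "run P Q (Suc t + t') (Seq c' d) s'" if "(c', s') \<in> set_pmf (step c s)" for c' s'
    proof -
      have "run P R t c' s'" using Suc.prems(1) that False by auto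
      from Suc.IH[OF this Suc.prems(2)] show ?thesis by (simp del: run.simps)
    qed
    then show ?thesis using Suc.prems False by auto
  qed
qed

lemma run_Seq:
  assumes "run P R t1 c s"
    and "\<And>s'. P s' \<Longrightarrow> R s' \<Longrightarrow> (\<And>x. x \<notin> mods c \<Longrightarrow> s' x = s x) \<Longrightarrow> run P Q t2 d s'"
    and "t1 + t2 + 1 \<le> t"
  shows "run P Q t (Seq c d) s"
proof (rule run_mono)
  show "run P Q (Suc (t1 + t2)) (Seq c d) s"
    by (rule run_Seq_aux[OF run_frame[OF assms(1)]]) (use assms(2) in auto)
qed (use assms(3) in auto)

text \<open>The index of \<open>I\<close> counts the remaining iterations, so termination and time
  come from the same induction. Besides the \<open>T\<close> steps of the body, an iteration pays
  for the test and for discarding the final \<open>SKIP\<close>; the last 1 is the failing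
  test.\<close>

lemma run_While:
  assumes "\<And>i s. P s \<Longrightarrow> I (Suc i) s \<Longrightarrow> bval b s \<and> run P (I i) T c s"
    and "\<And>s. P s \<Longrightarrow> I 0 s \<Longrightarrow> \<not> bval b s \<and> Q s"
    and "P s" "I m s"
  shows "run P Q (m * (T + 2) + 1) (While b c) s"
  using assms(3,4)
proof (induction m arbitrary: s)
  case 0
  then show ?case using assms(2)[of s] by (auto simp: run_SKIP_iff)
next
  case (Suc m)
  have "run P Q (Suc (T + (m * (T + 2) + 1))) (Seq c (While b c)) s"
    by (rule run_Seq_aux[where R = "I m"]) (use assms(1)[of s m] Suc in auto)
  moreover have "run P Q (Suc t) (While b c) s" if "run P Q t (Seq c (While b c)) s" for t
    using that assms(1)[of s m] Suc.prems by simp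
  ultimately have "run P Q (Suc (Suc (T + (m * (T + 2) + 1)))) (While b c) s" by blast
  also have "Suc (Suc (T + (m * (T + 2) + 1))) = Suc m * (T + 2) + 1" by simp
  finally show ?case .
qed

text \<open>Uniform bounds on addresses and contents can be kept invariant without tracking the
  shape of the store; together with a finite set of arrays they bound
  \<open>bit_size\<close>.\<close>

definition bounded :: "nat \<Rightarrow> nat \<Rightarrow> state \<Rightarrow> bool" where
  "bounded L B s \<longleftrightarrow> (\<forall>x i. s x i \<le> B \<and> (L \<le> i \<longrightarrow> s x i = 0))"

lemma bounded_store: "bounded L B s \<Longrightarrow> i < L \<Longrightarrow> m \<le> B \<Longrightarrow> bounded L B (store s x i m)"
  by (auto simp: bounded_def)

lemma run_Cond:
  assumes "bounded L B s" "1 \<le> t"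
    and "bval b s \<Longrightarrow> run (bounded L B) Q (t - 1) c s"
    and "\<not> bval b s \<Longrightarrow> run (bounded L B) Q (t - 1) d s"
  shows "run (bounded L B) Q t (Cond b c d) s"
  using assms by (cases t) auto

lemma run_SKIP: "bounded L B s \<Longrightarrow> Q s \<Longrightarrow> run (bounded L B) Q t SKIP s"
  by (simp add: run_SKIP_iff)

lemma run_Assign:
  assumes "bounded L B s" "aval e s < L" "aval f s \<le> B" "Q (store s x (aval e s) (aval f s))" "1 \<le> t"
  shows "run (bounded L B) Q t (Assign x e f) s"
  using assms by (cases t) (auto intro!: run_SKIP bounded_store)

lemma run_Seq_Assign:
  assumes "bounded L B s" "aval e s < L" "aval f s \<le> B" "2 \<le> t"
    and "bounded L B (store s x (aval e s) (aval f s)) \<Longrightarrow>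
           run (bounded L B) Q (t - 2) c (store s x (aval e s) (aval f s))"
  shows "run (bounded L B) Q t (Seq (Assign x e f) c) s"
proof -
  have t: "t = Suc (Suc (t - 2))" using assms(4) by simp
  have "bounded L B (store s x (aval e s) (aval f s))" using assms by (intro bounded_store)
  then show ?thesis using assms by (subst t) auto
qed

lemma run_Seq_Flip:
  assumes "bounded L B s" "aval e s < L" "1 \<le> B" "2 \<le> t"
    and "\<And>m. m \<le> 1 \<Longrightarrow> bounded L B (store s x (aval e s) m) \<Longrightarrow>
           run (bounded L B) Q (t - 2) c (store s x (aval e s) m)"
  shows "run (bounded L B) Q t (Seq (Flip x e) c) s"
proof -
  have t: "t = Suc (Suc (t - 2))" using assms(4) by simp
  have "bounded L B (store s x (aval e s) (of_bool b))" for b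
    using assms by (intro bounded_store) auto
  then show ?thesis using assms by (subst t) auto
qed

section \<open>Counting loops\<close>

abbreviation Var :: "string \<Rightarrow> aexp" where
  "Var x \<equiv> Read x (Num 0)"

definition For :: "string \<Rightarrow> aexp \<Rightarrow> com \<Rightarrow> com" where
  "For i e c = Seq (Assign i (Num 0) (Num 0))
     (While (Less (Var i) e) (Seq c (Assign i (Num 0) (Plus (Var i) (Num 1)))))"

lemma mods_For [simp]: "mods (For i e c) = insert i (mods c)"
  by (auto simp: For_def)

text \<open>The counter belongs to the loop, so the invariant \<open>J\<close> has to survive any
  change of it (\<open>indep\<close>). The overhead of 4 per round consists of the test, the
  increment and two discarded \<open>SKIP\<close>s; the constant 3 is the initial assignment with
  its \<open>SKIP\<close> and the failing test.\<close>

lemma run_For: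
  assumes s: "bounded L B s" and L: "0 < L" and m: "aval e s = m" "m \<le> B"
    and i: "i \<notin> mods c" "avars e \<inter> insert i (mods c) = {}"
    and init: "J 0 s"
    and indep: "\<And>k s v. J k s \<Longrightarrow> J k (store s i 0 v)"
    and body: "\<And>k s'. k < m \<Longrightarrow> bounded L B s' \<Longrightarrow> (\<And>x. x \<noteq> i \<Longrightarrow> x \<notin> mods c \<Longrightarrow> s' x = s x) \<Longrightarrow>
                 s' i 0 = k \<Longrightarrow> J k s' \<Longrightarrow> run (bounded L B) (J (Suc k)) T c s'"
    and post: "\<And>s'. bounded L B s' \<Longrightarrow> J m s' \<Longrightarrow> Q s'"
    and t: "m * (T + 4) + 3 \<le> t"
  shows "run (bounded L B) Q t (For i e c) s"
  unfolding For_def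
proof (rule run_Seq_Assign[OF s])
  let ?c = "Seq c (Assign i (Num 0) (Plus (Var i) (Num 1)))"
  define I where "I = (\<lambda>r s'. \<exists>k. k + r = m \<and> J k s' \<and> s' i 0 = k \<and>
                        (\<forall>x. x \<noteq> i \<longrightarrow> x \<notin> mods c \<longrightarrow> s' x = s x))"
  have e: "aval e s' = m" if "\<forall>x. x \<noteq> i \<longrightarrow> x \<notin> mods c \<longrightarrow> s' x = s x" for s'
    using that i(2) unfolding m(1)[symmetric] by (intro aval_cong) auto
  assume b: "bounded L B (store s i (aval (Num 0) s) (aval (Num 0) s))"
  have "run (bounded L B) Q (m * ((T + 2) + 2) + 1) (While (Less (Var i) e) ?c)
          (store s i (aval (Num 0) s) (aval (Num 0) s))"
  proof (rule run_While[where I = I])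
    fix r s' assume s': "bounded L B s'" "I (Suc r) s'"
    then obtain k where k: "k + Suc r = m" "J k s'" "s' i 0 = k"
      and fr: "\<forall>x. x \<noteq> i \<longrightarrow> x \<notin> mods c \<longrightarrow> s' x = s x"
      unfolding I_def by auto
    have "run (bounded L B) (I r) (T + 2) ?c s'"
    proof (rule run_Seq[where R = "J (Suc k)"])
      show "run (bounded L B) (J (Suc k)) T c s'" using k s' fr by (intro body) auto
      fix s1 assume s1: "bounded L B s1" "J (Suc k) s1" "\<And>x. x \<notin> mods c \<Longrightarrow> s1 x = s' x"
      then have "s1 i 0 = k" using i k by auto
      then show "run (bounded L B) (I r) 1 (Assign i (Num 0) (Plus (Var i) (Num 1))) s1"
        using s1 L m k fr by (intro run_Assign) (auto simp: I_def intro!: indep)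
    qed simp
    then show "bval (Less (Var i) e) s' \<and> run (bounded L B) (I r) (T + 2) ?c s'"
      using k e[OF fr] by auto
  next
    fix s' assume "bounded L B s'" "I 0 s'"
    then show "\<not> bval (Less (Var i) e) s' \<and> Q s'"
      using post e[of s'] by (auto simp: I_def)
  next
    show "I m (store s i (aval (Num 0) s) (aval (Num 0) s))"
      using init indep by (auto simp: I_def)
  qed (rule b)
  then show "run (bounded L B) Q (t - 2) (While (Less (Var i) e) ?c)
          (store s i (aval (Num 0) s) (aval (Num 0) s))"
    by (rule run_mono) (use t in \<open>auto simp: algebra_simps\<close>)
qed (use L t in auto)

section \<open>The isolation lemma\<close>

definition digit :: "nat \<Rightarrow> nat \<Rightarrow> nat \<Rightarrow> nat" where
  "digit W R i = R div W ^ i mod W"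

text \<open>Deleting digit \<open>i\<close> is injective on the fibre, since \<open>h\<close>
  reconstructs the deleted digit from the others, and it leaves numbers with \<open>N - 1\<close>
  digits.\<close>

lemma card_digit_fibre:
  fixes h :: "nat \<Rightarrow> nat"
  assumes "i < N" "0 < W"
    and h: "\<And>R R'. (\<And>j. j \<noteq> i \<Longrightarrow> digit W R j = digit W R' j) \<Longrightarrow> h R = h R'"
  shows "card {R. R < W ^ N \<and> digit W R i = h R} \<le> W ^ (N - 1)"
proof -
  \<comment> \<open>Digit \<open>i\<close> is removed and the digits above it move down by one
    place.\<close>
  define f where "f R = R mod W ^ i + W ^ i * (R div W ^ Suc i)" for R
  let ?A = "{R. R < W ^ N \<and> digit W R i = h R}"
  have split: "R = R mod W ^ i + W ^ i * digit W R i + W ^ Suc i * (R div W ^ Suc i)" for R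
  proof -
    have "R div W ^ i = W * (R div W ^ Suc i) + digit W R i"
      unfolding digit_def power_Suc2 div_mult2_eq by simp
    then have "R mod W ^ i + W ^ i * (R div W ^ i)
        = R mod W ^ i + W ^ i * digit W R i + W ^ Suc i * (R div W ^ Suc i)"
      by (simp add: algebra_simps)
    then show ?thesis by (simp only: mod_mult_div_eq)
  qed
  have lo: "f R mod W ^ i = R mod W ^ i" and hi: "f R div W ^ i = R div W ^ Suc i" for R
    using assms(2) unfolding f_def by simp_all
  have "inj_on f ?A"
  proof (rule inj_onI)
    fix R R' assume R: "R \<in> ?A" "R' \<in> ?A" and eq: "f R = f R'"
    have lo': "R mod W ^ i = R' mod W ^ i" using lo[of R] lo[of R'] eq by simp
    have hi': "R div W ^ Suc i = R' div W ^ Suc i" using hi[of R] hi[of R'] eq by simp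
    have "digit W R j = digit W R' j" if "j \<noteq> i" for j
    proof (cases "j < i")
      case True
      then obtain m where m: "i = j + Suc m" using less_iff_Suc_add by auto
      have *: "digit W (r mod W ^ i) j = digit W r j" for r
      proof -
        have "r mod (x * y) div x = r div x mod y" if "0 < x" for x y :: nat
          using that by (simp add: mod_mult2_eq)
        from this[of "W ^ j" "W ^ Suc m"]
        have "r mod W ^ i div W ^ j = r div W ^ j mod W ^ Suc m"
          using assms(2) unfolding m power_add by simp
        then show ?thesis unfolding digit_def by (simp add: mod_mod_cancel)
      qed
      show ?thesis using *[of R] *[of R'] unfolding lo' by simp
    next
      case False
      then have m: "j = Suc i + (j - Suc i)" using that by simp
      show ?thesis using hi' unfolding digit_def by (subst (1 2) m) (simp only: power_add div_mult2_eq)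
    qed
    then have di: "digit W R i = digit W R' i" using h[of R R'] R by auto
    show "R = R'"
      by (rule trans[OF split[of R] trans[OF _ split[of R', symmetric]]]) (simp only: lo' hi' di)
  qed
  moreover have "f ` ?A \<subseteq> {..<W ^ (N - 1)}"
  proof clarsimp
    fix R assume "R < W ^ N"
    moreover have "Suc i + (N - 1 - i) = N" using assms(1) by simp
    then have "W ^ N = W ^ Suc i * W ^ (N - 1 - i)" by (simp only: power_add[symmetric])
    ultimately have q: "R div W ^ Suc i < W ^ (N - 1 - i)"
      by (intro less_mult_imp_div_less) (simp only: mult.commute)
    have "f R < W ^ i + W ^ i * (R div W ^ Suc i)"
      unfolding f_def using assms(2) by simp
    also have "\<dots> = W ^ i * Suc (R div W ^ Suc i)" by simp
    also have "\<dots> \<le> W ^ i * W ^ (N - 1 - i)" using q by (intro mult_left_mono) auto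
    also have "\<dots> = W ^ (N - 1)" using assms(1) by (simp flip: power_add)
    finally show "f R < W ^ (N - Suc 0)" by simp
  qed
  ultimately show ?thesis
    using card_inj_on_le[of f ?A "{..<W ^ (N - 1)}"] by simp
qed

definition min_weight_unique :: "('a \<Rightarrow> nat) \<Rightarrow> 'a set \<Rightarrow> bool" where
  "min_weight_unique w F \<longleftrightarrow> (\<exists>S\<in>F. \<forall>S'\<in>F. S' \<noteq> S \<longrightarrow> w S < w S')"

text \<open>For each element \<open>e\<close> the weights of the other elements fix a threshold: the
  minimum weight over sets avoiding \<open>e\<close> minus the minimum over sets containing
  \<open>e\<close>, the latter taken without the weight of \<open>e\<close>. If two sets attain the
  minimum, any \<open>e\<close> in exactly one of them has a weight equal to its threshold. For each
  \<open>e\<close> this happens for at most a fraction \<open>1 / W\<close> of all \<open>R\<close>,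
  and there are at most \<open>N\<close> elements.\<close>

lemma isolation:
  fixes F :: "'e set set" and idx :: "'e \<Rightarrow> nat"
  assumes F: "F \<noteq> {}" "F \<subseteq> Pow E" and E: "finite E" "inj_on idx E" "idx ` E \<subseteq> {..<N}"
    and W: "2 * N \<le> W" "0 < W"
  defines "w R S \<equiv> \<Sum>e\<in>S. digit W R (idx e)"
  shows "2 * card {R. R < W ^ N \<and> \<not> min_weight_unique (w R) F} \<le> W ^ N"
proof (cases "E = {}")
  case True
  then have "F = {{}}" using F by auto
  then have "{R. R < W ^ N \<and> \<not> min_weight_unique (w R) F} = {}"
    by (auto simp: min_weight_unique_def)
  then show ?thesis by (simp only: card.empty)
next
  case False
  then have N: "0 < N" using E by auto
  have fin: "finite F" using F(2) E(1) by (auto intro: finite_subset)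
  have finS: "finite S" if "S \<in> F" for S using that F(2) E(1) by (auto intro: finite_subset)
  \<comment> \<open>\<open>Min\<close> of an empty set is an unspecified value; the threshold is
    only used for an \<open>e\<close> that lies in one minimiser and outside another, where both
    families are nonempty.\<close>
  define lo where "lo R e = Min (w R ` {S \<in> F. e \<notin> S})" for R e
  define hi where "hi R e = Min ((\<lambda>S. w R (S - {e})) ` {S \<in> F. e \<in> S})" for R e
  have sub: "{R. R < W ^ N \<and> \<not> min_weight_unique (w R) F} \<subseteq>
      (\<Union>e\<in>E. {R. R < W ^ N \<and> digit W R (idx e) = lo R e - hi R e})"
  proof clarsimp
    fix R assume R: "R < W ^ N" "\<not> min_weight_unique (w R) F"
    define S where "S = arg_min_on (w R) F"
    have S: "S \<in> F" "\<And>S'. S' \<in> F \<Longrightarrow> w R S \<le> w R S'"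
      unfolding S_def using arg_min_if_finite(1)[OF fin F(1), of "w R"]
        arg_min_least[OF fin F(1), of _ "w R"] by auto
    then obtain S' where S': "S' \<in> F" "S' \<noteq> S" "w R S' \<le> w R S"
      using R(2) unfolding min_weight_unique_def not_less[symmetric] by blast
    have key: "digit W R (idx e) = lo R e - hi R e"
      if "X \<in> F" "Y \<in> F" "w R X = w R Y" "\<And>S'. S' \<in> F \<Longrightarrow> w R X \<le> w R S'" "e \<in> X" "e \<notin> Y" for X Y e
    proof -
      have dec: "w R S' = w R (S' - {e}) + digit W R (idx e)" if "S' \<in> F" "e \<in> S'" for S'
        unfolding w_def using sum.remove[OF finS[OF that(1)] that(2), of "\<lambda>e. digit W R (idx e)"] by simp
      have "lo R e = w R Y" unfolding lo_def
        by (rule Min_eqI) (use fin that in auto)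
      moreover have "hi R e = w R (X - {e})" unfolding hi_def
      proof (rule Min_eqI)
        fix y assume "y \<in> (\<lambda>S. w R (S - {e})) ` {S \<in> F. e \<in> S}"
        then obtain S' where "y = w R (S' - {e})" "S' \<in> F" "e \<in> S'" by auto
        then show "w R (X - {e}) \<le> y" using that(4)[of S'] dec[of S'] dec[of X] that by auto
      qed (use fin that in auto)
      ultimately show ?thesis using that dec[of X] by simp
    qed
    have eq: "w R S = w R S'" using S S' by (simp add: le_antisym)
    have "(\<exists>e. e \<in> S \<and> e \<notin> S') \<or> (\<exists>e. e \<in> S' \<and> e \<notin> S)" using S'(2) by auto
    then show "\<exists>e\<in>E. digit W R (idx e) = lo R e - hi R e"
    proof (elim disjE exE conjE)
      fix e assume e: "e \<in> S" "e \<notin> S'"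
      then have "e \<in> E" using S(1) F(2) by auto
      then show ?thesis using key[of S S' e] e S S' eq by auto
    next
      fix e assume e: "e \<in> S'" "e \<notin> S"
      then have "e \<in> E" using S'(1) F(2) by auto
      then show ?thesis using key[of S' S e] e S S' eq by auto
    qed
  qed
  have "card {R. R < W ^ N \<and> \<not> min_weight_unique (w R) F}
      \<le> card (\<Union>e\<in>E. {R. R < W ^ N \<and> digit W R (idx e) = lo R e - hi R e})"
    by (rule card_mono[OF _ sub]) (use E in auto)
  also have "\<dots> \<le> (\<Sum>e\<in>E. card {R. R < W ^ N \<and> digit W R (idx e) = lo R e - hi R e})"
    by (rule card_UN_le) (use E in auto)
  also have "\<dots> \<le> (\<Sum>e\<in>E. W ^ (N - 1))"
  proof (intro sum_mono card_digit_fibre)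
    fix e R R' assume e: "e \<in> E" and dig: "\<And>j. j \<noteq> idx e \<Longrightarrow> digit W R j = digit W R' j"
    have wS: "w R S = w R' S" if "S \<subseteq> E" "e \<notin> S" for S
      unfolding w_def by (intro sum.cong refl dig) (use that e E(2) in \<open>auto dest: inj_onD\<close>)
    have "w R ` {S \<in> F. e \<notin> S} = w R' ` {S \<in> F. e \<notin> S}"
      using F(2) by (intro image_cong refl wS) auto
    moreover have "(\<lambda>S. w R (S - {e})) ` {S \<in> F. e \<in> S} = (\<lambda>S. w R' (S - {e})) ` {S \<in> F. e \<in> S}"
      using F(2) by (intro image_cong refl wS) auto
    ultimately have "lo R e = lo R' e" "hi R e = hi R' e"
      unfolding lo_def hi_def by simp_all
    then show "lo R e - hi R e = lo R' e - hi R' e" by simp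
  qed (use E W in auto)
  also have "\<dots> \<le> N * W ^ (N - 1)"
    using card_inj_on_le[OF E(2,3)] by simp
  finally have "2 * card {R. R < W ^ N \<and> \<not> min_weight_unique (w R) F} \<le> (2 * N) * W ^ (N - 1)" by simp
  also have "\<dots> \<le> W * W ^ (N - 1)" using W by (intro mult_right_mono) auto
  also have "\<dots> = W ^ N" using N by (simp add: power_eq_if)
  finally show ?thesis .
qed

section \<open>A five-state partition function counting even subgraphs with cuts\<close>

text \<open>States 1, 2 form one side and states 3, 4 the other; the odd state of each pair carries
  the positive sign, and \<open>(a + 1) div 2\<close> names the side.\<close>

definition sgn5 :: "nat \<Rightarrow> int" where
  "sgn5 a = (if a = 0 then 0 else if odd a then 1 else -1)"

definition inter5 :: "nat \<Rightarrow> nat \<Rightarrow> int" where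
  "inter5 a b = (if (a + 1) div 2 = (b + 1) div 2 then sgn5 a * sgn5 b else 0)"

definition kappa5 :: "int \<Rightarrow> nat \<Rightarrow> int" where
  "kappa5 y a = (if a = 0 then 2 - 4 * y else y)"

text \<open>In this form, where each factor involves one vertex or one edge, the quantity decomposes
  along the elimination forest.\<close>

definition partition5 :: "'v set \<Rightarrow> ('v \<times> 'v) set \<Rightarrow> int \<Rightarrow> ('v \<times> 'v \<Rightarrow> int) \<Rightarrow> int" where
  "partition5 V E y T = (\<Sum>a\<in>PiE V (\<lambda>_. {..<5}).
     (\<Prod>v\<in>V. kappa5 y (a v)) * (\<Prod>(u, v)\<in>E. 1 + inter5 (a u) (a v) * T (u, v)))"

text \<open>Edge ends are counted, a loop twice, so that the handshake identity holds for every
  finite set of pairs.\<close>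

definition edeg :: "('v \<times> 'v) set \<Rightarrow> 'v \<Rightarrow> nat" where
  "edeg S v = card {e \<in> S. fst e = v} + card {e \<in> S. snd e = v}"

definition everts :: "('v \<times> 'v) set \<Rightarrow> 'v set" where
  "everts S = fst ` S \<union> snd ` S"

definition cuts :: "'v set \<Rightarrow> ('v \<times> 'v) set \<Rightarrow> ('v \<Rightarrow> nat) set" where
  "cuts V S = {\<sigma> \<in> PiE V (\<lambda>_. {..<2}). \<forall>(u, v)\<in>S. \<sigma> u = \<sigma> v}"

definition even_sets :: "('v \<times> 'v) set \<Rightarrow> ('v \<times> 'v) set set" where
  "even_sets E = {S \<in> Pow E. \<forall>v. even (edeg S v)}"

text \<open>State 0 lies on both sides of the cut, with half of its weight on each.\<close>

definition kappa_side :: "int \<Rightarrow> nat \<Rightarrow> nat \<Rightarrow> int" where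
  "kappa_side y s a =
     (if a = 0 then 1 - 2 * y else if a = 2 * s + 1 \<or> a = 2 * s + 2 then y else 0)"

lemma lessThan_2: "{..<2} = {0, 1 :: nat}" by auto
lemma lessThan_5: "{..<5} = {0, 1, 2, 3, 4 :: nat}" by auto

lemma kappa5_split: "a < 5 \<Longrightarrow> kappa5 y a = (\<Sum>s<2. kappa_side y s a)"
  by (auto simp: kappa5_def kappa_side_def lessThan_2 eval_nat_numeral less_Suc_eq)

lemma inter5_side:
  assumes "kappa_side y s a \<noteq> 0" "kappa_side y s' b \<noteq> 0"
  shows "inter5 a b = (if s = s' then sgn5 a * sgn5 b else 0)"
  using assms by (auto simp: kappa_side_def inter5_def sgn5_def split: if_splits)

text \<open>Here \<open>k\<close> is the number of chosen edge ends at a vertex. State 0 contributes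
  only for \<open>k = 0\<close>, by \<open>0 ^ 0 = 1\<close>, and adds \<open>1 - 2 * y\<close> to
  the \<open>2 * y\<close> of the signed states; for odd \<open>k\<close> the two signs
  cancel.\<close>

lemma sum_kappa_side:
  assumes "s < 2"
  shows "(\<Sum>a<5. kappa_side y s a * sgn5 a ^ k) =
     (if k = 0 then 1 else if even k then 2 * y else 0)"
proof -
  have "s = 0 \<or> s = 1" using assms by auto
  then show ?thesis
    by (auto simp: lessThan_5 kappa_side_def sgn5_def power_0_left)
qed

lemma prod_endpoints:
  fixes f :: "'v \<Rightarrow> 'a :: comm_monoid_mult"
  assumes "finite V" "S \<subseteq> V \<times> V"
  shows "(\<Prod>(u, v)\<in>S. f u * f v) = (\<Prod>v\<in>V. f v ^ edeg S v)"
proof -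
  have fin: "finite S" using assms by (meson finite_SigmaI finite_subset)
  have *: "(\<Prod>e\<in>S. f (p e)) = (\<Prod>v\<in>V. f v ^ card {e \<in> S. p e = v})" if "p ` S \<subseteq> V" for p :: "'v \<times> 'v \<Rightarrow> 'v"
  proof -
    have "(\<Prod>e\<in>S. f (p e)) = (\<Prod>v\<in>V. \<Prod>e\<in>{e \<in> S. p e = v}. f (p e))"
      by (rule prod.group[symmetric]) (use fin assms that in auto)
    also have "\<dots> = (\<Prod>v\<in>V. f v ^ card {e \<in> S. p e = v})"
      by (intro prod.cong refl) simp
    finally show ?thesis .
  qed
  have "(\<Prod>(u, v)\<in>S. f u * f v) = (\<Prod>e\<in>S. f (fst e)) * (\<Prod>e\<in>S. f (snd e))"
    by (simp add: prod.distrib case_prod_beta)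
  also have "\<dots> = (\<Prod>v\<in>V. f v ^ card {e \<in> S. fst e = v}) * (\<Prod>v\<in>V. f v ^ card {e \<in> S. snd e = v})"
    using assms(2) by (subst (1 2) *) auto
  also have "\<dots> = (\<Prod>v\<in>V. f v ^ edeg S v)"
    by (simp add: prod.distrib power_add edeg_def)
  finally show ?thesis .
qed

lemma edeg_eq_0_iff: "finite S \<Longrightarrow> edeg S v = 0 \<longleftrightarrow> v \<notin> everts S"
  by (force simp: edeg_def everts_def)

text \<open>Expanding the edge factors chooses a set \<open>S\<close>, expanding the vertex weights
  chooses a side for every vertex. For fixed \<open>S\<close> and sides the sum over states is a
  product over vertices, given by \<open>sum_kappa_side\<close>: odd degrees give 0 and each covered
  vertex gives \<open>2 * y\<close>. The choices of sides that are consistent with \<open>S\<close>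
  are what \<open>cuts\<close> counts.\<close>

theorem partition5_eq:
  fixes V :: "'v set"
  assumes V: "finite V" and E: "E \<subseteq> V \<times> V"
  shows "partition5 V E y T =
     (\<Sum>S\<in>even_sets E. int (card (cuts V S)) * (2 * y) ^ card (everts S) * (\<Prod>e\<in>S. T e))"
proof -
  have finE: "finite E" using V E by (meson finite_SigmaI finite_subset)
  let ?P5 = "PiE V (\<lambda>_. {..<5 :: nat})" and ?P2 = "PiE V (\<lambda>_. {..<2 :: nat})"
  define con where "con S \<sigma> \<longleftrightarrow> (\<forall>(u, v)\<in>S. \<sigma> u = \<sigma> v)" for S :: "('v \<times> 'v) set" and \<sigma> :: "'v \<Rightarrow> nat"
  have exp: "(\<Prod>(u, v)\<in>E. 1 + inter5 (a u) (a v) * T (u, v)) =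
      (\<Sum>S\<in>Pow E. (\<Prod>(u, v)\<in>S. inter5 (a u) (a v)) * (\<Prod>e\<in>S. T e))" for a
  proof -
    have "(\<Prod>(u, v)\<in>E. 1 + inter5 (a u) (a v) * T (u, v)) =
        (\<Prod>e\<in>E. inter5 (a (fst e)) (a (snd e)) * T e + 1)"
      by (simp add: case_prod_beta add.commute)
    also have "\<dots> = (\<Sum>S\<in>Pow E. (\<Prod>e\<in>S. inter5 (a (fst e)) (a (snd e)) * T e))"
      by (subst prod_add[OF finE]) simp
    finally show ?thesis by (simp add: prod.distrib case_prod_beta)
  qed
  have kap: "(\<Prod>v\<in>V. kappa5 y (a v)) = (\<Sum>\<sigma>\<in>?P2. \<Prod>v\<in>V. kappa_side y (\<sigma> v) (a v))" if "a \<in> ?P5" for a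
  proof -
    have "(\<Prod>v\<in>V. kappa5 y (a v)) = (\<Prod>v\<in>V. \<Sum>s<2. kappa_side y s (a v))"
      using that by (intro prod.cong refl kappa5_split) auto
    also have "\<dots> = (\<Sum>\<sigma>\<in>?P2. \<Prod>v\<in>V. kappa_side y (\<sigma> v) (a v))"
      by (rule prod_sum_PiE) (use V in auto)
    finally show ?thesis .
  qed
  \<comment> \<open>Where the weights do not vanish, a nonzero state determines its side, and state
    0 makes both the interaction and the product of signs 0.\<close>
  have summand: "(\<Prod>v\<in>V. kappa_side y (\<sigma> v) (a v)) * (\<Prod>(u, v)\<in>S. inter5 (a u) (a v)) =
      (if con S \<sigma> then \<Prod>v\<in>V. kappa_side y (\<sigma> v) (a v) * sgn5 (a v) ^ edeg S v else 0)"
    if S: "S \<subseteq> E" for S \<sigma> a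
  proof (cases "(\<Prod>v\<in>V. kappa_side y (\<sigma> v) (a v)) = 0")
    case True
    then show ?thesis by (simp add: prod.distrib)
  next
    case False
    then have nz: "kappa_side y (\<sigma> v) (a v) \<noteq> 0" if "v \<in> V" for v using V that by (auto simp: prod_zero_iff)
    have finS: "finite S" using S finE finite_subset by blast
    have SV: "S \<subseteq> V \<times> V" using S E by blast
    have "(\<Prod>(u, v)\<in>S. inter5 (a u) (a v)) =
        (\<Prod>(u, v)\<in>S. if \<sigma> u = \<sigma> v then sgn5 (a u) * sgn5 (a v) else 0)"
      using SV nz by (intro prod.cong refl) (auto intro!: inter5_side[of y])
    also have "\<dots> = (if con S \<sigma> then \<Prod>(u, v)\<in>S. sgn5 (a u) * sgn5 (a v) else 0)"
    proof (cases "con S \<sigma>")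
      case True
      then show ?thesis by (auto simp: con_def intro!: prod.cong)
    next
      case False
      then obtain u v where "(u, v) \<in> S" "\<sigma> u \<noteq> \<sigma> v" by (auto simp: con_def)
      then show ?thesis using False finS by (auto intro!: prod_zero bexI[of _ "(u, v)"])
    qed
    also have "\<dots> = (if con S \<sigma> then \<Prod>v\<in>V. sgn5 (a v) ^ edeg S v else 0)"
      using prod_endpoints[OF V SV, of "\<lambda>v. sgn5 (a v)"] by simp
    finally show ?thesis by (simp add: prod.distrib)
  qed
  have inner: "(\<Sum>a\<in>?P5. \<Prod>v\<in>V. kappa_side y (\<sigma> v) (a v) * sgn5 (a v) ^ edeg S v) =
      (if \<forall>v. even (edeg S v) then (2 * y) ^ card (everts S) else 0)"
    if S: "S \<subseteq> E" and \<sigma>: "\<sigma> \<in> ?P2" for S \<sigma>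
  proof -
    have finS: "finite S" using S finE finite_subset by blast
    have SV: "everts S \<subseteq> V" using S E by (auto simp: everts_def)
    have "(\<Sum>a\<in>?P5. \<Prod>v\<in>V. kappa_side y (\<sigma> v) (a v) * sgn5 (a v) ^ edeg S v) =
        (\<Prod>v\<in>V. \<Sum>a<5. kappa_side y (\<sigma> v) a * sgn5 a ^ edeg S v)"
      by (rule prod_sum_PiE[symmetric]) (use V in auto)
    also have "\<dots> = (\<Prod>v\<in>V. if v \<notin> everts S then 1 else if even (edeg S v) then 2 * y else 0)"
      using \<sigma> finS by (intro prod.cong refl, subst sum_kappa_side) (auto simp: edeg_eq_0_iff)
    also have "\<dots> = (\<Prod>v\<in>everts S. if even (edeg S v) then 2 * y else 0)"
      by (rule prod.mono_neutral_cong_right) (use V SV in auto)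
    also have "\<dots> = (if \<forall>v. even (edeg S v) then (2 * y) ^ card (everts S) else 0)"
    proof (cases "\<forall>v. even (edeg S v)")
      case False
      then obtain v where v: "odd (edeg S v)" by auto
      then have "v \<in> everts S" using edeg_eq_0_iff[OF finS, of v] by auto
      then show ?thesis using v SV V False finite_subset[OF SV V]
        by (auto intro!: prod_zero bexI[of _ v])
    qed auto
    finally show ?thesis .
  qed
  have "partition5 V E y T = (\<Sum>a\<in>?P5. \<Sum>S\<in>Pow E. \<Sum>\<sigma>\<in>?P2.
      (\<Prod>v\<in>V. kappa_side y (\<sigma> v) (a v)) * (\<Prod>(u, v)\<in>S. inter5 (a u) (a v)) * (\<Prod>e\<in>S. T e))"
    unfolding partition5_def exp
    by (intro sum.cong refl) (simp add: kap sum_distrib_left sum_distrib_right mult.assoc)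
  also have "\<dots> = (\<Sum>S\<in>Pow E. \<Sum>\<sigma>\<in>?P2. \<Sum>a\<in>?P5.
      (\<Prod>v\<in>V. kappa_side y (\<sigma> v) (a v)) * (\<Prod>(u, v)\<in>S. inter5 (a u) (a v)) * (\<Prod>e\<in>S. T e))"
    by (rule trans[OF sum.swap]) (intro sum.cong refl sum.swap)
  also have "\<dots> = (\<Sum>S\<in>Pow E. \<Sum>\<sigma>\<in>?P2. (if con S \<sigma> then
      (if \<forall>v. even (edeg S v) then (2 * y) ^ card (everts S) else 0) else 0) * (\<Prod>e\<in>S. T e))"
    by (intro sum.cong refl) (simp add: summand inner flip: sum_distrib_right)
  also have "\<dots> = (\<Sum>S\<in>Pow E. if \<forall>v. even (edeg S v) then
      int (card (cuts V S)) * (2 * y) ^ card (everts S) * (\<Prod>e\<in>S. T e) else 0)"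
  proof (intro sum.cong refl)
    fix S
    have "(\<Sum>\<sigma>\<in>?P2. (if con S \<sigma> then c else 0) * d) = int (card (cuts V S)) * c * d" for c d
    proof -
      have "(\<Sum>\<sigma>\<in>?P2. (if con S \<sigma> then c else 0) * d) = (\<Sum>\<sigma>\<in>?P2. if con S \<sigma> then c * d else 0)"
        by (intro sum.cong) auto
      also have "\<dots> = (\<Sum>\<sigma>\<in>{\<sigma> \<in> ?P2. con S \<sigma>}. c * d)"
        by (subst sum.inter_filter) (use V in \<open>auto intro: finite_PiE\<close>)
      finally show ?thesis by (simp add: cuts_def con_def)
    qed
    then show "(\<Sum>\<sigma>\<in>?P2. (if con S \<sigma> then
      (if \<forall>v. even (edeg S v) then (2 * y) ^ card (everts S) else 0) else 0) * (\<Prod>e\<in>S. T e)) =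
      (if \<forall>v. even (edeg S v) then
      int (card (cuts V S)) * (2 * y) ^ card (everts S) * (\<Prod>e\<in>S. T e) else 0)" by simp
  qed
  also have "\<dots> = (\<Sum>S\<in>even_sets E. int (card (cuts V S)) * (2 * y) ^ card (everts S) * (\<Prod>e\<in>S. T e))"
    unfolding even_sets_def by (rule sum.inter_filter[symmetric]) (use finE in auto)
  finally show ?thesis .
qed

section \<open>Reading off coefficients\<close>

text \<open>All coefficients together stay below the base \<open>t\<close>, so no carries
  occur.\<close>

lemma kronecker_digit:
  fixes c x :: "'a \<Rightarrow> nat" and t :: nat
  assumes fin: "finite I" and small: "(\<Sum>i\<in>I. c i) < t"
  shows "(\<Sum>i\<in>I. c i * t ^ x i) div t ^ p mod t = (\<Sum>i\<in>{i \<in> I. x i = p}. c i)"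
proof -
  let ?lo = "\<Sum>i\<in>{i \<in> I. x i < p}. c i * t ^ x i"
  let ?c = "\<Sum>i\<in>{i \<in> I. x i = p}. c i"
  define h where "h = (\<Sum>i\<in>{i \<in> I. x i > p}. c i * t ^ (x i - Suc p))"
  have t: "0 < t" using small by simp
  have "(\<Sum>i\<in>I. c i * t ^ x i) = (\<Sum>i\<in>{i \<in> I. x i < p} \<union> {i \<in> I. x i = p} \<union> {i \<in> I. x i > p}. c i * t ^ x i)"
    by (rule sum.cong) auto
  also have "\<dots> = ?lo + (\<Sum>i\<in>{i \<in> I. x i = p}. c i * t ^ x i) + (\<Sum>i\<in>{i \<in> I. x i > p}. c i * t ^ x i)"
    using fin by (subst sum.union_disjoint; auto)+
  also have "(\<Sum>i\<in>{i \<in> I. x i = p}. c i * t ^ x i) = ?c * t ^ p"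
    by (simp add: sum_distrib_right)
  also have "(\<Sum>i\<in>{i \<in> I. x i > p}. c i * t ^ x i) = h * t ^ Suc p"
    unfolding h_def sum_distrib_right mult.assoc
    by (intro sum.cong refl) (simp only: power_add[symmetric] mem_Collect_eq, simp)
  finally have eq: "(\<Sum>i\<in>I. c i * t ^ x i) = ?lo + t ^ p * (?c + t * h)"
    by (simp add: algebra_simps)
  have "?lo < t ^ p"
  proof (cases p)
    case (Suc p')
    have "?lo \<le> (\<Sum>i\<in>{i \<in> I. x i < p}. c i * t ^ p')"
      using t Suc by (intro sum_mono mult_left_mono power_increasing) auto
    also have "\<dots> \<le> (\<Sum>i\<in>I. c i) * t ^ p'"
      unfolding sum_distrib_right by (rule sum_mono2) (use fin in auto)
    also have "\<dots> < t * t ^ p'" using small t by simp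
    finally show ?thesis using Suc by simp
  qed simp
  then have "(\<Sum>i\<in>I. c i * t ^ x i) div t ^ p = ?c + t * h"
    unfolding eq using t by simp
  moreover have "?c \<le> (\<Sum>i\<in>I. c i)" by (rule sum_mono2) (use fin in auto)
  ultimately show ?thesis using small by simp
qed

lemma kronecker_less:
  fixes c x :: "'a \<Rightarrow> nat" and t :: nat
  assumes fin: "finite I" and small: "(\<Sum>i\<in>I. c i) < t" and D: "0 < D" "\<And>i. i \<in> I \<Longrightarrow> x i < D"
  shows "(\<Sum>i\<in>I. c i * t ^ x i) < t ^ D"
proof -
  obtain D' where D': "D = Suc D'" using D by (cases D) auto
  have "(\<Sum>i\<in>I. c i * t ^ x i) \<le> (\<Sum>i\<in>I. c i * t ^ D')"
    using small D D' by (intro sum_mono mult_left_mono power_increasing) (fastforce simp: less_Suc_eq_le)+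
  also have "\<dots> = (\<Sum>i\<in>I. c i) * t ^ D'" by (simp add: sum_distrib_right)
  also have "\<dots> < t * t ^ D'" using small by (intro mult_strict_right_mono) auto
  finally show ?thesis using D' by simp
qed

lemma card_cuts_le: "card (cuts {..<n} S) \<le> 2 ^ n"
proof -
  have "card (cuts {..<n} S) \<le> card (PiE {..<n} (\<lambda>_. {..<2 :: nat}))"
    by (rule card_mono) (auto simp: cuts_def intro: finite_PiE)
  also have "\<dots> = 2 ^ n" by (simp add: card_PiE)
  finally show ?thesis .
qed

text \<open>For edge sets of a simple graph that satisfy the other conditions, the tested number is
  \<open>2 ^ (n + c)\<close> with \<open>c\<close> the number of cycles. Divisibility thus expresses
  \<open>c \<le> k\<close> through a quantity that the partition function provides.\<close>

definition cover_sets :: "nat \<Rightarrow> (nat \<times> nat) set \<Rightarrow> nat \<Rightarrow> nat \<Rightarrow> (nat \<times> nat) set set" where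
  "cover_sets n E k l = {S \<in> even_sets E. card S = l \<and> card (everts S) = l \<and>
     \<not> 2 ^ (n + k + 1) dvd 2 ^ l * card (cuts {..<n} S)}"

text \<open>
  \<open>A\<close> exceeds every total weight and \<open>A'\<close> every total weight plus \<open>A\<close> times a number of edges, so
  the exponent of a term determines its weight, its number of edges and its number of vertices.
\<close>

locale isolating =
  fixes n k l W N A A' t M :: nat and E :: "(nat \<times> nat) set" and w :: "nat \<times> nat \<Rightarrow> nat"
  assumes E: "E \<subseteq> {..<n} \<times> {..<n}" and N: "N = n * n"
    and w: "\<And>e. w e < W"
    and A: "A = N * W + 1" and A': "A' = A * (N + 1)"
    and t: "t = 2 ^ (n + 1)\<^sup>2" and M: "M = t ^ (A' * (n + 1))" and l: "l \<le> n"
begin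

definition "Z = partition5 {..<n} E (int t ^ A') (\<lambda>e. int t ^ (w e + A))"

text \<open>The inspected exponents are those of \<open>l\<close> edges and \<open>l\<close>
  vertices with total weight \<open>i\<close>.\<close>

definition accept :: "nat \<Rightarrow> bool" where
  "accept z \<longleftrightarrow> (\<exists>i<A. z div t ^ ((A + A') * l + i) mod t mod 2 ^ (n + k + 1) \<noteq> 0)"

definition coef :: "(nat \<times> nat) set \<Rightarrow> nat" where
  "coef S = 2 ^ card (everts S) * card (cuts {..<n} S)"

definition expo :: "(nat \<times> nat) set \<Rightarrow> nat" where
  "expo S = (\<Sum>e\<in>S. w e) + A * card S + A' * card (everts S)"

lemma finE: "finite E"
  using E by (rule finite_subset) auto

lemma fin_even: "finite (even_sets E)"
  using finE by (auto simp: even_sets_def)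

lemma card_edges: "S \<in> even_sets E \<Longrightarrow> card S \<le> N"
proof -
  assume "S \<in> even_sets E"
  then have "S \<subseteq> {..<n} \<times> {..<n}" using E by (auto simp: even_sets_def)
  from card_mono[OF _ this] show ?thesis by (simp add: N)
qed

lemma card_everts: "S \<in> even_sets E \<Longrightarrow> card (everts S) \<le> n"
proof -
  assume "S \<in> even_sets E"
  then have "everts S \<subseteq> {..<n}" using E by (auto simp: even_sets_def everts_def)
  from card_mono[OF _ this] show ?thesis by simp
qed

lemma weight_less: "S \<in> even_sets E \<Longrightarrow> (\<Sum>e\<in>S. w e) < A"
proof -
  assume S: "S \<in> even_sets E"
  have "(\<Sum>e\<in>S. w e) \<le> (\<Sum>e\<in>S. W)" by (intro sum_mono less_imp_le w)
  also have "\<dots> \<le> N * W" using card_edges[OF S] by simp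
  finally show ?thesis by (simp add: A)
qed

lemma weight_edges_less: "i < A \<Longrightarrow> m \<le> N \<Longrightarrow> i + A * m < A'"
proof -
  assume "i < A" "m \<le> N"
  then have "i + A * m < A + A * N" by (intro add_less_le_mono mult_left_mono) auto
  then show ?thesis by (simp add: A')
qed

lemma l_le_N: "l \<le> N"
  using l by (cases n) (auto simp: N)

text \<open>The exponent is a number in mixed radix: the weight is below \<open>A\<close>, weight
  and edges together are below \<open>A'\<close>, and the vertices come last. Division by
  \<open>A'\<close> and then by \<open>A\<close> recovers the parts.\<close>

lemma expo_eq_iff:
  assumes S: "S \<in> even_sets E" and i: "i < A"
  shows "expo S = (A + A') * l + i \<longleftrightarrow> (\<Sum>e\<in>S. w e) = i \<and> card S = l \<and> card (everts S) = l"
proof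
  let ?w = "\<Sum>e\<in>S. w e"
  assume "expo S = (A + A') * l + i"
  then have eq: "A' * card (everts S) + (?w + A * card S) = A' * l + (i + A * l)"
    by (simp add: expo_def algebra_simps)
  have lt: "?w + A * card S < A'" "i + A * l < A'"
    using weight_edges_less weight_less card_edges S i l_le_N by blast+
  have "(A' * card (everts S) + (?w + A * card S)) div A' = card (everts S)"
    "(A' * l + (i + A * l)) div A' = l"
    using lt by auto
  then have 1: "card (everts S) = l" using eq by simp
  then have eq2: "A * card S + ?w = A * l + i" using eq by simp
  have "(A * card S + ?w) div A = card S" "(A * l + i) div A = l"
    using weight_less[OF S] i by auto
  then have "card S = l" using eq2 by simp
  with 1 eq2 show "?w = i \<and> card S = l \<and> card (everts S) = l" by simp
qed (auto simp: expo_def algebra_simps)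

lemma expo_less: "S \<in> even_sets E \<Longrightarrow> expo S < A' * (n + 1)"
proof -
  assume S: "S \<in> even_sets E"
  have "(\<Sum>e\<in>S. w e) + A * card S < A'" using weight_edges_less weight_less card_edges S by blast
  moreover have "A' * card (everts S) \<le> A' * n" using card_everts[OF S] by (rule mult_le_mono2)
  ultimately have "expo S < A' + A' * n" unfolding expo_def by (rule add_less_le_mono)
  then show ?thesis by simp
qed

text \<open>There are at most \<open>2 ^ (n * n)\<close> edge sets, each with a coefficient of at
  most \<open>2 ^ n * 2 ^ n\<close>; the exponent \<open>(n + 1)\<^sup>2\<close> of \<open>t\<close>
  exceeds \<open>n * n + n + n\<close> by one.\<close>

lemma sum_coef_less: "(\<Sum>S\<in>even_sets E. coef S) < t"
proof -
  have c: "coef S \<le> 2 ^ n * 2 ^ n" if "S \<in> even_sets E" for S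
    unfolding coef_def using card_everts[OF that] card_cuts_le by (intro mult_mono power_increasing) auto
  have "(\<Sum>S\<in>even_sets E. coef S) \<le> (\<Sum>S\<in>even_sets E. 2 ^ n * 2 ^ n)" by (rule sum_mono[OF c])
  also have "\<dots> \<le> (\<Sum>S\<in>Pow E. 2 ^ n * 2 ^ n)"
    by (rule sum_mono2) (use finE in \<open>auto simp: even_sets_def\<close>)
  also have "\<dots> = 2 ^ card E * (2 ^ n * 2 ^ n)" by (simp add: card_Pow finE)
  also have "\<dots> \<le> 2 ^ (n * n) * (2 ^ n * 2 ^ n)"
    using card_mono[OF _ E] by (intro mult_right_mono power_increasing) auto
  also have "\<dots> = 2 ^ (n * n + n + n)" by (simp add: power_add)
  also have "\<dots> < t" unfolding t by (intro power_strict_increasing) (auto simp: power2_eq_square)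
  finally show ?thesis .
qed

lemma Z_eq: "Z = int (\<Sum>S\<in>even_sets E. coef S * t ^ expo S)"
proof -
  have "(\<Prod>e\<in>S. int t ^ (w e + A)) = int t ^ ((\<Sum>e\<in>S. w e) + A * card S)" for S
    by (simp add: power_add power_mult prod.distrib power_sum flip: power_mult_distrib)
  then show ?thesis
    unfolding Z_def partition5_eq[OF finite_lessThan E] of_nat_sum
    by (intro sum.cong refl) (simp add: coef_def expo_def power_mult_distrib power_add power_mult)
qed

text \<open>Despite the negative weight of state 0, \<open>Z\<close> is a sum of nonnegative terms
  and lies below \<open>M\<close>, so computing modulo \<open>M\<close> loses nothing.\<close>

lemma Z_mod: "Z mod int M = Z"
proof -
  have "0 < A' * (n + 1)" by (simp add: A A')
  from kronecker_less[OF fin_even sum_coef_less this expo_less]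
  have "(\<Sum>S\<in>even_sets E. coef S * t ^ expo S) < M" by (simp add: M)
  then show ?thesis unfolding Z_eq of_nat_mod[symmetric] by (simp only: mod_less)
qed

lemma digit_Z:
  assumes "int z = Z mod int M" "i < A"
  shows "z div t ^ ((A + A') * l + i) mod t =
    (\<Sum>S\<in>{S \<in> even_sets E. (\<Sum>e\<in>S. w e) = i \<and> card S = l \<and> card (everts S) = l}. coef S)"
proof -
  have "z = (\<Sum>S\<in>even_sets E. coef S * t ^ expo S)"
    using assms(1) Z_mod unfolding Z_eq by linarith
  then have "z div t ^ ((A + A') * l + i) mod t = (\<Sum>S\<in>{S \<in> even_sets E. expo S = (A + A') * l + i}. coef S)"
    using kronecker_digit[OF fin_even sum_coef_less] by simp
  then show ?thesis using expo_eq_iff[OF _ assms(2)] by (simp cong: conj_cong)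
qed

lemma coef_cover:
  "S \<in> even_sets E \<Longrightarrow> card S = l \<Longrightarrow> card (everts S) = l \<Longrightarrow>
     S \<in> cover_sets n E k l \<longleftrightarrow> \<not> 2 ^ (n + k + 1) dvd coef S"
  by (auto simp: cover_sets_def coef_def)

text \<open>Whatever the weights are, a set outside \<open>cover_sets\<close> adds a multiple of the
  modulus to its digit; hence no choice of weights leads to a false positive.\<close>

lemma accept_sound:
  assumes z: "int z = Z mod int M" and "accept z"
  shows "cover_sets n E k l \<noteq> {}"
proof
  assume none: "cover_sets n E k l = {}"
  obtain i where i: "i < A" "z div t ^ ((A + A') * l + i) mod t mod 2 ^ (n + k + 1) \<noteq> 0"
    using assms(2) by (auto simp: accept_def)
  have "2 ^ (n + k + 1) dvd
    (\<Sum>S\<in>{S \<in> even_sets E. (\<Sum>e\<in>S. w e) = i \<and> card S = l \<and> card (everts S) = l}. coef S)"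
    using coef_cover none by (intro dvd_sum) auto
  with i show False unfolding digit_Z[OF z i(1)] by (simp add: dvd_eq_mod_eq_0)
qed

text \<open>At the minimum weight a single set of the family occurs. All other sets with the same
  exponent add multiples of the modulus and cannot cancel its coefficient.\<close>

lemma accept_complete:
  assumes z: "int z = Z mod int M" and u: "min_weight_unique (\<lambda>S. \<Sum>e\<in>S. w e) (cover_sets n E k l)"
  shows "accept z"
proof -
  obtain S where S: "S \<in> cover_sets n E k l"
    "\<And>S'. S' \<in> cover_sets n E k l \<Longrightarrow> S' \<noteq> S \<Longrightarrow> (\<Sum>e\<in>S. w e) < (\<Sum>e\<in>S'. w e)"
    using u by (auto simp: min_weight_unique_def)
  then have SE: "S \<in> even_sets E" "card S = l" "card (everts S) = l" by (auto simp: cover_sets_def)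
  define i where "i = (\<Sum>e\<in>S. w e)"
  have i: "i < A" unfolding i_def by (rule weight_less[OF SE(1)])
  let ?F = "{S \<in> even_sets E. (\<Sum>e\<in>S. w e) = i \<and> card S = l \<and> card (everts S) = l}"
  have "(\<Sum>S\<in>?F. coef S) = coef S + (\<Sum>S\<in>?F - {S}. coef S)"
    by (rule sum.remove) (use fin_even SE i_def in auto)
  moreover have "2 ^ (n + k + 1) dvd (\<Sum>S\<in>?F - {S}. coef S)"
  proof (rule dvd_sum)
    fix S' assume S': "S' \<in> ?F - {S}"
    then have "(\<Sum>e\<in>S'. w e) = i" "S' \<noteq> S" by auto
    then have "S' \<notin> cover_sets n E k l" using S(2)[of S'] unfolding i_def by linarith
    then show "2 ^ (n + k + 1) dvd coef S'" using S' coef_cover by auto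
  qed
  moreover have "\<not> 2 ^ (n + k + 1) dvd coef S" using coef_cover S SE by blast
  ultimately have "\<not> 2 ^ (n + k + 1) dvd (\<Sum>S\<in>?F. coef S)" by (simp only: dvd_add_left_iff not_False_eq_True)
  then have "z div t ^ ((A + A') * l + i) mod t mod 2 ^ (n + k + 1) \<noteq> 0"
    unfolding digit_Z[OF z i] by (simp only: dvd_eq_mod_eq_0 not_False_eq_True)
  with i show ?thesis unfolding accept_def by blast
qed

end

section \<open>Two-regular edge sets and cycle covers\<close>

definition cyc :: "'v list \<Rightarrow> ('v \<times> 'v) list" where
  "cyc p = zip p (rotate1 p)"

definition nbrs :: "('v \<times> 'v) set \<Rightarrow> 'v \<Rightarrow> 'v set" where
  "nbrs S v = {u. (u, v) \<in> S \<or> (v, u) \<in> S}"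

definition oriented :: "('v \<times> 'v) set \<Rightarrow> bool" where
  "oriented S \<longleftrightarrow> (\<forall>(u, v)\<in>S. (v, u) \<notin> S)"

lemma orientedD: "oriented S \<Longrightarrow> (u, v) \<in> S \<Longrightarrow> (v, u) \<notin> S"
  by (auto simp: oriented_def)

text \<open>Without antiparallel pairs, the heads of edges leaving \<open>v\<close> and the tails of
  edges entering \<open>v\<close> are disjoint. A loop is its own reverse and thus excluded as
  well.\<close>

lemma edeg_nbrs:
  assumes "oriented S" "finite S"
  shows "edeg S v = card (nbrs S v)"
proof -
  have "nbrs S v = snd ` {e \<in> S. fst e = v} \<union> fst ` {e \<in> S. snd e = v}"
    by (force simp: nbrs_def)
  moreover have "card (snd ` {e \<in> S. fst e = v} \<union> fst ` {e \<in> S. snd e = v}) =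
      card (snd ` {e \<in> S. fst e = v}) + card (fst ` {e \<in> S. snd e = v})"
    by (rule card_Un_disjoint) (use assms in \<open>auto simp: oriented_def\<close>)
  moreover have "card (snd ` {e \<in> S. fst e = v}) = card {e \<in> S. fst e = v}"
    by (rule card_image) (auto simp: inj_on_def)
  moreover have "card (fst ` {e \<in> S. snd e = v}) = card {e \<in> S. snd e = v}"
    by (rule card_image) (auto simp: inj_on_def)
  ultimately show ?thesis by (simp add: edeg_def)
qed

lemma everts_nbrs: "v \<in> everts S \<longleftrightarrow> nbrs S v \<noteq> {}"
  by (force simp: everts_def nbrs_def)

lemma finite_everts: "finite S \<Longrightarrow> finite (everts S)"
  by (simp add: everts_def)

lemma finite_nbrs: "finite S \<Longrightarrow> finite (nbrs S v)"
  by (rule finite_subset[of _ "everts S"]) (force simp: everts_def nbrs_def finite_everts)+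

lemma sum_edeg:
  assumes "finite S"
  shows "(\<Sum>v\<in>everts S. edeg S v) = 2 * card S"
proof -
  have "(\<Sum>v\<in>everts S. card {e \<in> S. p e = v}) = card S" if "p ` S \<subseteq> everts S" for p
    using sum.group[OF assms finite_everts[OF assms] that, of "\<lambda>_. 1 :: nat"] by simp
  then show ?thesis by (simp add: edeg_def sum.distrib everts_def)
qed

text \<open>A covered vertex has positive even degree, so at least 2, while the degrees add up to
  twice the number of edges, hence to 2 per covered vertex on average.\<close>

lemma even_card_eq_regular:
  assumes S: "finite S" "\<And>v. even (edeg S v)" "card S = card (everts S)" and v: "v \<in> everts S"
  shows "edeg S v = 2"
proof -
  have ge: "2 \<le> edeg S v" if "v \<in> everts S" for v
    using S(2)[of v] edeg_eq_0_iff[OF S(1), of v] that by (cases "edeg S v = 1") auto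
  have "(\<Sum>v\<in>everts S. edeg S v) = (\<Sum>v\<in>everts S. 2)"
    using sum_edeg[OF S(1)] S(3) by simp
  from sum_mono_inv[OF this[symmetric] ge] show ?thesis
    using v finite_everts[OF S(1)] by auto
qed

lemma set_cyc: "set (cyc p) = {(p ! i, p ! (Suc i mod length p)) |i. i < length p}"
  by (auto simp: cyc_def set_zip nth_rotate1)

lemma fst_set_cyc: "fst ` set (cyc p) = set p"
proof -
  have "map fst (cyc p) = p" by (simp add: cyc_def)
  then show ?thesis by (metis set_map)
qed

lemma mod_Suc_cases: "i < m \<Longrightarrow> Suc i mod m = (if Suc i = m then 0 else Suc i)" for i m :: nat
  by (auto simp: Suc_lessI)

text \<open>Length at least 3 makes predecessor and successor distinct. The summand
  \<open>length p\<close> in the index of the predecessor prevents truncated subtraction at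
  \<open>i = 0\<close>.\<close>

lemma cyc_nbr_unique:
  assumes p: "distinct p" "3 \<le> length p" "i < length p"
  shows "nbrs (set (cyc p)) (p ! i) =
     {p ! (Suc i mod length p), p ! ((i + length p - 1) mod length p)}" (is "?L = ?R")
    and "p ! (Suc i mod length p) \<noteq> p ! ((i + length p - 1) mod length p)"
proof -
  let ?m = "length p"
  have pr: "(i + ?m - 1) mod ?m = (if i = 0 then ?m - 1 else i - 1)"
    using p by (cases i) auto
  have nx: "Suc i mod ?m = (if Suc i = ?m then 0 else Suc i)" using p(3) by (rule mod_Suc_cases)
  show "p ! (Suc i mod ?m) \<noteq> p ! ((i + ?m - 1) mod ?m)"
  proof -
    have "Suc i mod ?m < ?m" "(i + ?m - 1) mod ?m < ?m" "Suc i mod ?m \<noteq> (i + ?m - 1) mod ?m"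
      unfolding pr nx using p by auto
    then show ?thesis using nth_eq_iff_index_eq[OF p(1)] by blast
  qed
  show "?L = ?R"
  proof (intro equalityI subsetI)
    fix x assume "x \<in> ?L"
    then consider j where "j < ?m" "x = p ! j" "p ! i = p ! (Suc j mod ?m)"
      | j where "j < ?m" "p ! i = p ! j" "x = p ! (Suc j mod ?m)"
      by (auto simp: nbrs_def set_cyc)
    then show "x \<in> ?R"
    proof cases
      case 1
      moreover have "Suc j mod ?m < ?m" using 1(1) by (intro mod_less_divisor) linarith
      ultimately have "i = Suc j mod ?m" using p nth_eq_iff_index_eq[OF p(1)] by blast
      then have "(i + ?m - 1) mod ?m = j"
        unfolding pr using 1(1) mod_Suc_cases[OF 1(1)] by (auto split: if_splits)
      then show ?thesis using 1 by simp
    next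
      case 2
      then have "i = j" using p by (simp add: nth_eq_iff_index_eq)
      then show ?thesis using 2 by simp
    qed
  next
    fix x assume "x \<in> ?R"
    then consider "x = p ! (Suc i mod ?m)" | "x = p ! ((i + ?m - 1) mod ?m)" by blast
    then show "x \<in> ?L"
    proof cases
      case 1
      then have "(p ! i, x) \<in> set (cyc p)" using p by (auto simp: set_cyc)
      then show ?thesis by (simp add: nbrs_def)
    next
      case 2
      define j where "j = (i + ?m - 1) mod ?m"
      have "j < ?m" using p unfolding j_def by (intro mod_less_divisor) linarith
      moreover have "Suc j mod ?m = i"
        unfolding mod_Suc_cases[OF \<open>j < ?m\<close>] j_def pr using p by auto
      ultimately have "(x, p ! i) \<in> set (cyc p)" using 2 unfolding set_cyc j_def[symmetric] by auto
      then show ?thesis by (simp add: nbrs_def)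
    qed
  qed
qed

lemma card_nbrs_cyc:
  assumes "distinct p" "3 \<le> length p" "v \<in> set p"
  shows "card (nbrs (set (cyc p)) v) = 2"
  using cyc_nbr_unique[OF assms(1,2)] assms(3) by (metis card_2_iff in_set_conv_nth)

section \<open>Cycles of the graph as vertex lists\<close>

lemma pcas_conv: "pcas u c v \<longleftrightarrow> u # map snd c = map fst c @ [v]"
  by (induction c arbitrary: u) auto

lemma pawalk_verts_conv: "tl (pawalk_verts u c) = (if c = [] then [] else tl (map fst c) @ [snd (last c)])"
proof -
  have "pawalk_verts u c = (if c = [] then [u] else map fst c @ [snd (last c)])" for u
    by (induction c arbitrary: u) auto
  then show ?thesis by (cases c) auto
qed

text \<open>In a closed walk given by its arcs, the list of heads is the list \<open>p\<close> of
  tails rotated by one. The starting point is kept, so \<open>c = cyc p\<close> is an equality of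
  lists and not only up to rotation.\<close>

lemma undirected_cycle_iff:
  assumes "pair_wf_digraph G"
  shows "undirected_cycle G c \<longleftrightarrow>
     (\<exists>p. distinct p \<and> 3 \<le> length p \<and> c = cyc p \<and> set c \<subseteq> parcs G)" (is "?L \<longleftrightarrow> ?R")
proof -
  interpret pair_wf_digraph G by fact
  have cyc_iff: "undirected_cycle G c \<longleftrightarrow> 3 \<le> length c \<and>
      (\<exists>u. u \<in> pverts G \<and> set c \<subseteq> parcs G \<and> pcas u c u \<and> distinct (tl (pawalk_verts u c)))"
    unfolding undirected_cycle_def cycle_def awalk_def by auto
  show ?thesis
  proof
    assume ?L
    then obtain u where c: "3 \<le> length c" "set c \<subseteq> parcs G" "u # map snd c = map fst c @ [u]"
      "distinct (tl (pawalk_verts u c))"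
      unfolding cyc_iff pcas_conv by blast
    from c(1,3) obtain xs where xs: "map fst c = u # xs" "map snd c = xs @ [u]"
      by (cases c) auto
    then have "map snd c = rotate1 (map fst c)" by simp
    then have "c = cyc (map fst c)" by (metis cyc_def zip_map_fst_snd)
    moreover have "distinct (map fst c)"
    proof -
      have "snd (last c) = u" using xs(2) c(1) by (metis last_map last_snoc list.size(3) not_numeral_le_zero)
      then show ?thesis using c(1,4) xs(1) by (auto simp: pawalk_verts_conv)
    qed
    ultimately show ?R using c by (intro exI[of _ "map fst c"]) auto
  next
    assume ?R
    then obtain p where p: "distinct p" "3 \<le> length p" "c = cyc p" "set c \<subseteq> parcs G" by blast
    then obtain u xs where px: "p = u # xs" by (cases p) auto
    have l: "length c = length p" using p(3) by (simp add: cyc_def)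
    have ms: "map fst c = u # xs" "map snd c = xs @ [u]" using p(3) px by (simp_all add: cyc_def)
    then have "pcas u c u" by (simp add: pcas_conv)
    moreover have "distinct (tl (pawalk_verts u c))"
    proof -
      have "c \<noteq> []" using l p by auto
      moreover from this have "snd (last c) = u" using ms(2) by (metis last_map last_snoc)
      ultimately show ?thesis using ms(1) p(1) px by (auto simp: pawalk_verts_conv)
    qed
    moreover have "u \<in> pverts G"
    proof -
      obtain e where "e \<in> set c" "fst e = u" using ms(1) by (cases c) auto
      then show ?thesis using p(4) arc_fst_in_verts by blast
    qed
    ultimately show ?L unfolding cyc_iff using p l by auto
  qed
qed

section \<open>Counting cuts that are constant on given classes\<close>

lemma card_constant_functions:
  assumes V: "finite V" and r: "\<And>x. x \<in> V \<Longrightarrow> r x \<in> V" "\<And>x. x \<in> V \<Longrightarrow> r (r x) = r x"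
  shows "card {\<sigma> \<in> PiE V (\<lambda>_. B). \<forall>x\<in>V. \<sigma> (r x) = \<sigma> x} = card B ^ card (r ` V)"
proof -
  have "bij_betw (\<lambda>\<sigma>. restrict \<sigma> (r ` V)) {\<sigma> \<in> PiE V (\<lambda>_. B). \<forall>x\<in>V. \<sigma> (r x) = \<sigma> x} (PiE (r ` V) (\<lambda>_. B))"
  proof (rule bij_betw_byWitness[where f' = "\<lambda>\<tau>. restrict (\<lambda>x. \<tau> (r x)) V"])
    show "\<forall>\<sigma>\<in>{\<sigma> \<in> PiE V (\<lambda>_. B). \<forall>x\<in>V. \<sigma> (r x) = \<sigma> x}.
        restrict (\<lambda>x. restrict \<sigma> (r ` V) (r x)) V = \<sigma>"
      by (auto simp: fun_eq_iff restrict_def PiE_def extensional_def)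
    show "\<forall>\<tau>\<in>PiE (r ` V) (\<lambda>_. B). restrict (restrict (\<lambda>x. \<tau> (r x)) V) (r ` V) = \<tau>"
      using r by (auto simp: fun_eq_iff restrict_def PiE_def extensional_def)
    show "(\<lambda>\<sigma>. restrict \<sigma> (r ` V)) ` {\<sigma> \<in> PiE V (\<lambda>_. B). \<forall>x\<in>V. \<sigma> (r x) = \<sigma> x} \<subseteq> PiE (r ` V) (\<lambda>_. B)"
      using r by auto
    show "(\<lambda>\<tau>. restrict (\<lambda>x. \<tau> (r x)) V) ` PiE (r ` V) (\<lambda>_. B) \<subseteq>
        {\<sigma> \<in> PiE V (\<lambda>_. B). \<forall>x\<in>V. \<sigma> (r x) = \<sigma> x}"
      using r by auto
  qed
  from bij_betw_same_card[OF this] show ?thesis using V by (simp add: card_PiE)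
qed

text \<open>A retraction \<open>r\<close> sends each class \<open>f c\<close> to one representative
  and fixes all vertices outside the classes, so a cut is a free choice of sides on the image of
  \<open>r\<close>.\<close>

lemma card_cuts_classes:
  fixes f :: "'c \<Rightarrow> 'v set"
  assumes V: "finite V" and C: "finite C" "\<And>c. c \<in> C \<Longrightarrow> f c \<noteq> {}" "\<And>c. c \<in> C \<Longrightarrow> f c \<subseteq> V"
    and dj: "\<And>c c'. c \<in> C \<Longrightarrow> c' \<in> C \<Longrightarrow> c \<noteq> c' \<Longrightarrow> f c \<inter> f c' = {}"
    and S: "\<And>\<sigma> :: 'v \<Rightarrow> nat. (\<forall>(u, v)\<in>S. \<sigma> u = \<sigma> v) \<longleftrightarrow> (\<forall>c\<in>C. \<forall>x\<in>f c. \<forall>y\<in>f c. \<sigma> x = \<sigma> y)"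
  shows "card (cuts V S) = 2 ^ (card V - card (\<Union>c\<in>C. f c) + card C)"
proof -
  let ?U = "\<Union>c\<in>C. f c"
  define g where "g c = (SOME x. x \<in> f c)" for c
  have g: "g c \<in> f c" if "c \<in> C" for c unfolding g_def using C(2)[OF that] by (auto intro: someI_ex)
  define r where "r x = (if x \<in> ?U then g (THE c. c \<in> C \<and> x \<in> f c) else x)" for x
  have r1: "r x = g c" if "c \<in> C" "x \<in> f c" for x c
  proof -
    have "(THE c. c \<in> C \<and> x \<in> f c) = c" using that dj by (intro the_equality) blast+
    then show ?thesis using that by (auto simp: r_def)
  qed
  have r2: "r x = x" if "x \<notin> ?U" for x unfolding r_def using that by argo
  have const: "(\<forall>c\<in>C. \<forall>x\<in>f c. \<forall>y\<in>f c. \<sigma> x = \<sigma> y) \<longleftrightarrow> (\<forall>x\<in>V. \<sigma> (r x) = \<sigma> x)" for \<sigma> :: "'v \<Rightarrow> nat"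
  proof
    assume *: "\<forall>c\<in>C. \<forall>x\<in>f c. \<forall>y\<in>f c. \<sigma> x = \<sigma> y"
    show "\<forall>x\<in>V. \<sigma> (r x) = \<sigma> x"
    proof
      fix x assume "x \<in> V"
      show "\<sigma> (r x) = \<sigma> x"
      proof (cases "x \<in> ?U")
        case True
        then obtain c where "c \<in> C" "x \<in> f c" by auto
        then show ?thesis using * g r1 by metis
      qed (simp add: r2)
    qed
  next
    assume *: "\<forall>x\<in>V. \<sigma> (r x) = \<sigma> x"
    show "\<forall>c\<in>C. \<forall>x\<in>f c. \<forall>y\<in>f c. \<sigma> x = \<sigma> y"
    proof (intro ballI)
      fix c x y assume "c \<in> C" "x \<in> f c" "y \<in> f c"
      then have "x \<in> V" "y \<in> V" "r x = r y" using C(3) r1 by auto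
      then show "\<sigma> x = \<sigma> y" using * by metis
    qed
  qed
  have UV: "?U \<subseteq> V" using C(3) by blast
  have rV: "r x \<in> V" "r (r x) = r x" if "x \<in> V" for x
  proof -
    consider c where "c \<in> C" "x \<in> f c" | "x \<notin> ?U" by auto
    then have "r x \<in> V \<and> r (r x) = r x"
    proof cases
      case (1 c)
      then have "g c \<in> f c" "r x = g c" using g r1 by auto
      then show ?thesis using r1[of c "g c"] 1 C(3) by auto
    qed (use r2 that in simp)
    then show "r x \<in> V" "r (r x) = r x" by auto
  qed
  have "cuts V S = {\<sigma> \<in> PiE V (\<lambda>_. {..<2}). \<forall>x\<in>V. \<sigma> (r x) = \<sigma> x}"
    unfolding cuts_def by (simp only: S const)
  then have "card (cuts V S) = 2 ^ card (r ` V)"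
    using card_constant_functions[of V r "{..<2 :: nat}"] V rV by simp
  also have "r ` V = (V - ?U) \<union> g ` C"
  proof (intro equalityI subsetI)
    fix y assume "y \<in> r ` V"
    then obtain x where x: "x \<in> V" "y = r x" by auto
    then show "y \<in> (V - ?U) \<union> g ` C" by (cases "x \<in> ?U") (use r1 r2 in auto)
  next
    fix y assume "y \<in> (V - ?U) \<union> g ` C"
    then show "y \<in> r ` V"
    proof
      assume "y \<in> V - ?U"
      then show ?thesis using r2[of y] by (metis DiffD1 DiffD2 image_eqI)
    next
      assume "y \<in> g ` C"
      then obtain c where "c \<in> C" "y = g c" by auto
      then show ?thesis using g[of c] r1[of c "g c"] C(3)[of c] by (metis image_eqI subsetD)
    qed
  qed
  also have "card ((V - ?U) \<union> g ` C) = card (V - ?U) + card (g ` C)"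
    by (rule card_Un_disjoint) (use V C g in auto)
  also have "card (V - ?U) = card V - card ?U" by (rule card_Diff_subset[OF finite_subset[OF UV V] UV])
  also have "card (g ` C) = card C"
    by (rule card_image) (use g dj in \<open>fastforce simp: inj_on_def\<close>)
  finally show ?thesis .
qed


text \<open>A path of maximum length cannot be extended, so every \<open>Q\<close>-successor of its
  end already lies on it.\<close>

lemma long_path:
  assumes "finite U" "U \<noteq> {}"
  obtains p where "p \<noteq> []" "distinct p" "set p \<subseteq> U" "\<And>i. Suc i < length p \<Longrightarrow> Q (p ! i) (p ! Suc i)"
    "\<And>x. x \<in> U \<Longrightarrow> Q (last p) x \<Longrightarrow> x \<in> set p"
proof -
  define X where "X = {p. p \<noteq> [] \<and> distinct p \<and> set p \<subseteq> U \<and> (\<forall>i. Suc i < length p \<longrightarrow> Q (p ! i) (p ! Suc i))}"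
  obtain u where "u \<in> U" using assms by auto
  then have "[u] \<in> X" by (auto simp: X_def)
  moreover have "finite X"
    by (rule finite_subset[OF _ finite_subset_distinct[OF assms(1)]]) (auto simp: X_def)
  ultimately have "Max (length ` X) \<in> length ` X" "\<And>q. q \<in> X \<Longrightarrow> length q \<le> Max (length ` X)"
    by (auto intro!: Max_in)
  then obtain p where p: "p \<in> X" "\<And>q. q \<in> X \<Longrightarrow> length q \<le> length p" by auto
  show thesis
  proof (rule that[of p])
    fix x assume x: "x \<in> U" "Q (last p) x"
    show "x \<in> set p"
    proof (rule ccontr)
      assume "x \<notin> set p"
      moreover have "Q ((p @ [x]) ! i) ((p @ [x]) ! Suc i)" if "Suc i < length (p @ [x])" for i
      proof (cases "Suc i < length p")
        case True
        then show ?thesis using p(1) by (auto simp: X_def nth_append)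
      next
        case False
        then have "i = length p - 1" "p \<noteq> []" "Suc i = length p" using that p(1) by (auto simp: X_def)
        then show ?thesis using x(2) by (simp add: nth_append last_conv_nth)
      qed
      ultimately have "p @ [x] \<in> X" using p(1) x by (auto simp: X_def)
      from p(2)[OF this] show False by simp
    qed
  qed (use p(1) in \<open>auto simp: X_def\<close>)
qed

lemma card_2_third: "card A = 2 \<Longrightarrow> x \<in> A \<Longrightarrow> y \<in> A \<Longrightarrow> x \<noteq> y \<Longrightarrow> z \<in> A \<Longrightarrow> z = x \<or> z = y"
  by (auto simp: card_2_iff)

text \<open>The end of a longest path has both neighbours on the path. An inner vertex already has
  its two neighbours along the path, so besides the predecessor only the first vertex can be
  adjacent to the end, and it closes the cycle. Degree 2 leaves no further edges at the vertices of
  the cycle.\<close>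

lemma exists_cycle:
  assumes S: "finite S" "S \<noteq> {}" "\<And>v. v \<in> everts S \<Longrightarrow> card (nbrs S v) = 2"
    and irr: "\<And>v. (v, v) \<notin> S"
  obtains p where "distinct p" "3 \<le> length p" "set p \<subseteq> everts S"
    "\<And>v. v \<in> set p \<Longrightarrow> nbrs S v = nbrs (set (cyc p)) v"
proof -
  have sym: "x \<in> nbrs S y \<longleftrightarrow> y \<in> nbrs S x" for x y by (auto simp: nbrs_def)
  have nb: "x \<in> everts S" if "x \<in> nbrs S y" for x y using that by (force simp: nbrs_def everts_def)
  have ne: "x \<noteq> y" if "x \<in> nbrs S y" for x y using that irr by (auto simp: nbrs_def)
  obtain p where p: "p \<noteq> []" "distinct p" "set p \<subseteq> everts S"
    "\<And>i. Suc i < length p \<Longrightarrow> p ! Suc i \<in> nbrs S (p ! i)"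
    "\<And>x. x \<in> everts S \<Longrightarrow> x \<in> nbrs S (last p) \<Longrightarrow> x \<in> set p"
    by (rule long_path[of "everts S" "\<lambda>x y. y \<in> nbrs S x"])
      (use S finite_everts in \<open>auto simp: everts_def\<close>)
  let ?m = "length p"
  have idx: "p ! i = p ! j \<longleftrightarrow> i = j" if "i < ?m" "j < ?m" for i j
    using nth_eq_iff_index_eq[OF p(2) that] .
  have deg: "card (nbrs S (p ! i)) = 2" if "i < ?m" for i
    using S(3) p(3) that by (meson nth_mem subsetD)
  have lst: "last p = p ! (?m - 1)" using p(1) by (simp add: last_conv_nth)
  have only: "j = 0 \<or> j = ?m - 2" if j: "j < ?m" "p ! j \<in> nbrs S (last p)" for j
  proof (rule ccontr)
    assume *: "\<not> (j = 0 \<or> j = ?m - 2)"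
    have "j \<noteq> ?m - 1" using ne[OF j(2)] lst by auto
    then have j': "0 < j" "Suc j < ?m - 1" using * j by auto
    have "p ! (j - 1) \<in> nbrs S (p ! j)" using p(4)[of "j - 1"] j' j sym by simp
    moreover have "p ! Suc j \<in> nbrs S (p ! j)" using p(4)[of j] j' by simp
    moreover have "p ! (?m - 1) \<in> nbrs S (p ! j)" using j(2) lst sym by simp
    moreover have "p ! (j - 1) \<noteq> p ! Suc j" using idx[of "j - 1" "Suc j"] j' by simp
    ultimately have "p ! (?m - 1) = p ! (j - 1) \<or> p ! (?m - 1) = p ! Suc j"
      using card_2_third deg[OF j(1)] by metis
    then show False using idx[of "?m - 1" "j - 1"] idx[of "?m - 1" "Suc j"] j' by auto
  qed
  have sub: "nbrs S (last p) \<subseteq> {p ! 0, p ! (?m - 2)}"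
  proof
    fix x assume x: "x \<in> nbrs S (last p)"
    then have "x \<in> set p" using p(5) nb by blast
    then obtain j where "j < ?m" "x = p ! j" by (auto simp: in_set_conv_nth)
    with only[of j] x show "x \<in> {p ! 0, p ! (?m - 2)}" by auto
  qed
  have c2: "card (nbrs S (last p)) = 2" using deg[of "?m - 1"] p(1) lst by simp
  have "p ! 0 \<noteq> p ! (?m - 2)"
  proof
    assume "p ! 0 = p ! (?m - 2)"
    then have "card (nbrs S (last p)) \<le> card {p ! 0}" using sub by (intro card_mono) auto
    then show False using c2 by simp
  qed
  then have m3: "3 \<le> ?m" by (cases "?m \<le> 2") auto
  have "nbrs S (last p) = {p ! 0, p ! (?m - 2)}"
    using c2 sub \<open>p ! 0 \<noteq> p ! (?m - 2)\<close> by (intro card_subset_eq) auto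
  then have wrap: "p ! 0 \<in> nbrs S (p ! (?m - 1))" using lst by simp
  have nxt: "p ! (Suc i mod ?m) \<in> nbrs S (p ! i)" if "i < ?m" for i
  proof (cases "Suc i = ?m")
    case True
    then have "i = ?m - 1" by simp
    then show ?thesis using True wrap by simp
  qed (use mod_Suc_cases[OF that] p(4)[of i] that in auto)
  show thesis
  proof (rule that[OF p(2) m3 p(3)])
    fix v assume "v \<in> set p"
    then obtain i where i: "i < ?m" "v = p ! i" by (auto simp: in_set_conv_nth)
    have "nbrs (set (cyc p)) v \<subseteq> nbrs S v"
    proof
      fix x assume "x \<in> nbrs (set (cyc p)) v"
      then have "(x, v) \<in> set (cyc p) \<or> (v, x) \<in> set (cyc p)" by (simp add: nbrs_def)
      moreover have "b \<in> nbrs S a" if "(a, b) \<in> set (cyc p)" for a b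
        using that nxt unfolding set_cyc by blast
      ultimately show "x \<in> nbrs S v" using sym by blast
    qed
    moreover have "card (nbrs (set (cyc p)) v) = 2"
      using card_nbrs_cyc[OF p(2) m3] \<open>v \<in> set p\<close> by blast
    ultimately show "nbrs S v = nbrs (set (cyc p)) v"
      using deg[OF i(1)] i(2) finite_nbrs[OF S(1)] by (intro card_subset_eq[symmetric]) auto
  qed
qed

section \<open>Disjoint cycles and the decomposition of two-regular edge sets\<close>

definition disjoint_cycles :: "'v list set \<Rightarrow> bool" where
  "disjoint_cycles C \<longleftrightarrow> finite C \<and> (\<forall>p\<in>C. distinct p \<and> 3 \<le> length p) \<and>
     (\<forall>p\<in>C. \<forall>q\<in>C. p \<noteq> q \<longrightarrow> set p \<inter> set q = {})"

definition cyc_arcs :: "'v list set \<Rightarrow> ('v \<times> 'v) set" where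
  "cyc_arcs C = (\<Union>p\<in>C. set (cyc p))"

lemma cyc_subset: "(x, y) \<in> set (cyc p) \<Longrightarrow> x \<in> set p \<and> y \<in> set p"
  unfolding cyc_def by (metis set_rotate1 set_zip_leftD set_zip_rightD)

lemma nbrs_cyc_subset: "nbrs (set (cyc p)) v \<subseteq> set p"
  using cyc_subset by (fastforce simp: nbrs_def)

lemma nbrs_cyc_outside: "v \<notin> set p \<Longrightarrow> nbrs (set (cyc p)) v = {}"
  using cyc_subset by (fastforce simp: nbrs_def)

lemma nbrs_cyc_arcs: "nbrs (cyc_arcs C) v = (\<Union>p\<in>C. nbrs (set (cyc p)) v)"
  by (auto simp: nbrs_def cyc_arcs_def)

lemma nbrs_cyc_arcs_in:
  assumes "disjoint_cycles C" "p \<in> C" "v \<in> set p"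
  shows "nbrs (cyc_arcs C) v = nbrs (set (cyc p)) v"
proof -
  have "nbrs (set (cyc q)) v = {}" if "q \<in> C" "q \<noteq> p" for q
    using assms that by (intro nbrs_cyc_outside) (auto simp: disjoint_cycles_def)
  then show ?thesis using assms(2) unfolding nbrs_cyc_arcs by blast
qed

text \<open>The induction removes one cycle; by degree 2 no edge leaves it. Neighbourhoods are
  compared rather than sets of pairs, because \<open>S\<close> fixes an orientation of each edge
  whereas \<open>cyc\<close> follows the direction of the cycle.\<close>

lemma regular_decompose:
  fixes S :: "('v \<times> 'v) set"
  assumes "finite S" "\<And>v. v \<in> everts S \<Longrightarrow> card (nbrs S v) = 2" "\<And>v. (v, v) \<notin> S"
  shows "\<exists>C. disjoint_cycles C \<and> (\<forall>v. nbrs S v = nbrs (cyc_arcs C) v)"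
  using assms
proof (induction "card S" arbitrary: S rule: less_induct)
  case less
  show ?case
  proof (cases "S = {}")
    case True
    then show ?thesis
      by (intro exI[of _ "{}"]) (auto simp: disjoint_cycles_def cyc_arcs_def nbrs_def)
  next
    case False
    obtain p where p: "distinct p" "3 \<le> length p" "set p \<subseteq> everts S"
      "\<And>v. v \<in> set p \<Longrightarrow> nbrs S v = nbrs (set (cyc p)) v"
      using exists_cycle[OF less.prems(1) False less.prems(2,3)] by blast
    \<comment> \<open>Testing the tail is enough: by \<open>closed\<close>, either both ends of an
      edge lie on \<open>p\<close> or neither does.\<close>
    define S' where "S' = {e \<in> S. fst e \<notin> set p}"
    have closed: "u \<in> set p \<longleftrightarrow> v \<in> set p" if "(u, v) \<in> S" for u v
    proof -
      have "u \<in> nbrs S v" "v \<in> nbrs S u" using that by (auto simp: nbrs_def)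
      then show ?thesis using p(4) nbrs_cyc_subset by fast
    qed
    have nb': "nbrs S' v = (if v \<in> set p then {} else nbrs S v)" for v
      using closed by (auto simp: nbrs_def S'_def)
    have "p \<noteq> []" using p(2) by auto
    then obtain x where "x \<in> set p" using hd_in_set by blast
    then have "nbrs S x \<noteq> nbrs S' x" using nb'[of x] p(3) everts_nbrs[of x S] by auto
    then have "S' \<subset> S" unfolding S'_def by auto
    then have "card S' < card S" using less.prems(1) psubset_card_mono by blast
    moreover have "finite S'" using less.prems(1) by (auto simp: S'_def)
    moreover have "card (nbrs S' v) = 2" if "v \<in> everts S'" for v
      using that nb'[of v] less.prems(2)[of v] everts_nbrs[of v S'] everts_nbrs[of v S] by auto
    moreover have "(v, v) \<notin> S'" for v using less.prems(3) by (auto simp: S'_def)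
    ultimately obtain C where C: "disjoint_cycles C" "\<And>v. nbrs S' v = nbrs (cyc_arcs C) v"
      using less.hyps[of S'] by blast
    have dj: "set p \<inter> set q = {}" if "q \<in> C" for q
    proof (rule ccontr)
      assume "set p \<inter> set q \<noteq> {}"
      then obtain v where v: "v \<in> set p" "v \<in> set q" by auto
      have "card (nbrs (set (cyc q)) v) = 2"
        using C(1) that v(2) by (intro card_nbrs_cyc) (auto simp: disjoint_cycles_def)
      then have "nbrs S' v \<noteq> {}" using C(2)[of v] nbrs_cyc_arcs_in[OF C(1) that v(2)] by auto
      then show False using nb'[of v] v(1) by simp
    qed
    have "disjoint_cycles (insert p C)" using C(1) p(1,2) dj unfolding disjoint_cycles_def by blast
    moreover have "nbrs S v = nbrs (cyc_arcs (insert p C)) v" for v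
    proof -
      have "nbrs (cyc_arcs (insert p C)) v = nbrs (set (cyc p)) v \<union> nbrs S' v"
        using C(2)[of v] by (simp add: nbrs_cyc_arcs)
      then show ?thesis using nb'[of v] p(4)[of v] nbrs_cyc_outside[of v p] by (cases "v \<in> set p") auto
    qed
    ultimately show ?thesis by blast
  qed
qed

lemma constant_on_cyc:
  assumes "\<And>u v. (u, v) \<in> set (cyc p) \<Longrightarrow> \<sigma> u = \<sigma> v" and "x \<in> set p" "y \<in> set p"
  shows "\<sigma> x = \<sigma> y"
proof -
  have "\<sigma> (p ! i) = \<sigma> (p ! 0)" if "i < length p" for i
    using that
  proof (induction i)
    case (Suc i)
    have "(p ! i, p ! Suc i) \<in> set (cyc p)"
      unfolding set_cyc using Suc.prems by (auto intro!: exI[of _ i])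
    then show ?case using assms(1) Suc by fastforce
  qed simp
  then show ?thesis using assms(2,3) by (metis in_set_conv_nth)
qed

lemma everts_cycles:
  assumes C: "disjoint_cycles C" and S: "\<And>v. nbrs S v = nbrs (cyc_arcs C) v"
  shows "everts S = (\<Union>p\<in>C. set p)"
proof -
  have "v \<in> everts S \<longleftrightarrow> v \<in> (\<Union>p\<in>C. set p)" for v
  proof
    assume "v \<in> everts S"
    then show "v \<in> (\<Union>p\<in>C. set p)"
      unfolding everts_nbrs S nbrs_cyc_arcs using nbrs_cyc_outside by fast
  next
    assume "v \<in> (\<Union>p\<in>C. set p)"
    then obtain p where p: "p \<in> C" "v \<in> set p" by auto
    then have "card (nbrs (set (cyc p)) v) = 2"
      using C by (intro card_nbrs_cyc) (auto simp: disjoint_cycles_def)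
    then show "v \<in> everts S" unfolding everts_nbrs S nbrs_cyc_arcs_in[OF C p] by auto
  qed
  then show ?thesis by blast
qed

lemma card_cuts_cycles:
  assumes V: "finite V" "everts S \<subseteq> V" and C: "disjoint_cycles C"
    and S: "\<And>v. nbrs S v = nbrs (cyc_arcs C) v"
  shows "card (cuts V S) = 2 ^ (card V - card (everts S) + card C)"
proof -
  have ev: "everts S = (\<Union>p\<in>C. set p)" by (rule everts_cycles[OF C S])
  show ?thesis unfolding ev
  proof (rule card_cuts_classes)
    fix \<sigma> :: "'a \<Rightarrow> nat"
    show "(\<forall>(u, v)\<in>S. \<sigma> u = \<sigma> v) \<longleftrightarrow> (\<forall>p\<in>C. \<forall>x\<in>set p. \<forall>y\<in>set p. \<sigma> x = \<sigma> y)"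
    proof
      assume *: "\<forall>(u, v)\<in>S. \<sigma> u = \<sigma> v"
      have "\<sigma> u = \<sigma> v" if "p \<in> C" "(u, v) \<in> set (cyc p)" for p u v
      proof -
        have "u \<in> nbrs S v" using that unfolding S by (auto simp: nbrs_def cyc_arcs_def)
        then show ?thesis using * by (auto simp: nbrs_def)
      qed
      then show "\<forall>p\<in>C. \<forall>x\<in>set p. \<forall>y\<in>set p. \<sigma> x = \<sigma> y"
        using constant_on_cyc[where \<sigma> = \<sigma>] by blast
    next
      assume *: "\<forall>p\<in>C. \<forall>x\<in>set p. \<forall>y\<in>set p. \<sigma> x = \<sigma> y"
      show "\<forall>(u, v)\<in>S. \<sigma> u = \<sigma> v"
      proof clarify
        fix u v assume "(u, v) \<in> S"
        then have "u \<in> nbrs (cyc_arcs C) v" unfolding S[symmetric] by (auto simp: nbrs_def)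
        then obtain p where "p \<in> C" "u \<in> set p" "v \<in> set p"
          using cyc_subset by (fastforce simp: nbrs_def cyc_arcs_def)
        then show "\<sigma> u = \<sigma> v" using * by blast
      qed
    qed
  next
    fix p assume "p \<in> C"
    then show "set p \<noteq> {}" using C by (auto simp: disjoint_cycles_def)
    show "set p \<subseteq> V" using V(2) \<open>p \<in> C\<close> unfolding ev by blast
  qed (use V C in \<open>auto simp: disjoint_cycles_def\<close>)
qed

text \<open>The number \<open>k\<close> may be arbitrarily large, but there are never more than
  \<open>n\<close> disjoint cycles; with \<open>min k n\<close> the modulus of the program keeps
  polynomially many bits in \<open>n\<close>.\<close>

theorem partial_cycle_cover_iff:
  assumes G: "pair_graph G" "pverts G = {..<n}" and E: "E \<subseteq> parcs G" "oriented E"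
    and cov: "\<And>u v. (u, v) \<in> parcs G \<Longrightarrow> (u, v) \<in> E \<or> (v, u) \<in> E"
  shows "partial_cycle_cover G k l \<longleftrightarrow> cover_sets n E (min k n) l \<noteq> {}"
proof -
  interpret pair_graph G by (rule G(1))
  have symG: "(v, u) \<in> parcs G" if "(u, v) \<in> parcs G" for u v
    using that sym_arcs by (auto simp: symmetric_def sym_def)
  have wf: "pair_wf_digraph G" by (rule pair_wf_digraph)
  have finE: "finite E" using E(1) pair_finite_arcs finite_subset by blast
  have irr: "(v, v) \<notin> E" for v using orientedD[OF E(2), of v v] by blast
  have evG: "everts S \<subseteq> {..<n}" if "S \<subseteq> E" for S
    using that E(1) arc_fst_in_verts arc_snd_in_verts G(2) unfolding everts_def by blast
  show ?thesis
  proof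
    assume "cover_sets n E (min k n) l \<noteq> {}"
    then obtain S where S: "S \<subseteq> E" "\<And>v. even (edeg S v)" "card S = l" "card (everts S) = l"
      "\<not> 2 ^ (n + min k n + 1) dvd 2 ^ l * card (cuts {..<n} S)"
      by (auto simp: cover_sets_def even_sets_def)
    have finS: "finite S" using S(1) finE finite_subset by blast
    have oS: "oriented S" using S(1) E(2) unfolding oriented_def by blast
    have deg: "card (nbrs S v) = 2" if "v \<in> everts S" for v
      using even_card_eq_regular[OF finS S(2) _ that] S(3,4) edeg_nbrs[OF oS finS] by simp
    obtain C where C: "disjoint_cycles C" "\<And>v. nbrs S v = nbrs (cyc_arcs C) v"
      using regular_decompose[OF finS deg] irr S(1) by blast
    have ev: "everts S = (\<Union>p\<in>C. set p)" by (rule everts_cycles[OF C])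
    have ln: "l \<le> n" using card_mono[OF _ evG[OF S(1)]] S(4) by simp
    have "card (cuts {..<n} S) = 2 ^ (n - l + card C)"
      using card_cuts_cycles[OF _ evG[OF S(1)] C] S(4) by simp
    then have "2 ^ l * card (cuts {..<n} S) = 2 ^ (n + card C)"
      using ln by (simp flip: power_add)
    then have "\<not> n + min k n + 1 \<le> n + card C"
      using S(5) le_imp_power_dvd[of "n + min k n + 1" "n + card C" "2 :: nat"] by argo
    then have Ck: "card C \<le> k" by simp
    have arcs: "set (cyc p) \<subseteq> parcs G" if "p \<in> C" for p
    proof clarify
      fix x y assume "(x, y) \<in> set (cyc p)"
      then have "x \<in> nbrs S y" using that unfolding C(2) by (auto simp: nbrs_def cyc_arcs_def)
      then show "(x, y) \<in> parcs G" using S(1) E(1) symG by (auto simp: nbrs_def)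
    qed
    have cv: "cycle_verts (cyc p) = set p" for p :: "nat list"
      by (simp add: cycle_verts_def fst_set_cyc)
    show "partial_cycle_cover G k l"
      unfolding partial_cycle_cover_def
    proof (intro exI[of _ "cyc ` C"] conjI ballI impI)
      show "finite (cyc ` C)" using C(1) by (simp add: disjoint_cycles_def)
      show "card (cyc ` C) \<le> k" using C(1) Ck card_image_le[of C cyc] by (auto simp: disjoint_cycles_def)
      show "card (\<Union>c\<in>cyc ` C. cycle_verts c) = l" using S(4) ev cv by simp
    next
      fix c assume "c \<in> cyc ` C"
      then show "undirected_cycle G c"
        unfolding undirected_cycle_iff[OF wf] using arcs C(1) by (auto simp: disjoint_cycles_def)
    next
      fix c c' assume "c \<in> cyc ` C" "c' \<in> cyc ` C" "c \<noteq> c'"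
      then obtain p q where "c = cyc p" "c' = cyc q" "p \<in> C" "q \<in> C" "p \<noteq> q" by auto
      then show "cycle_verts c \<inter> cycle_verts c' = {}"
        using C(1) by (simp add: cv disjoint_cycles_def)
    qed
  next
    assume "partial_cycle_cover G k l"
    then obtain Cs where Cs: "finite Cs" "card Cs \<le> k" "\<And>c. c \<in> Cs \<Longrightarrow> undirected_cycle G c"
      "\<And>c c'. c \<in> Cs \<Longrightarrow> c' \<in> Cs \<Longrightarrow> c \<noteq> c' \<Longrightarrow> cycle_verts c \<inter> cycle_verts c' = {}"
      "card (\<Union>c\<in>Cs. cycle_verts c) = l"
      unfolding partial_cycle_cover_def by (elim exE conjE) (rule that; assumption?; simp)
    define C where "C = map fst ` Cs"
    have c: "distinct (map fst c)" "3 \<le> length (map fst c)" "set (cyc (map fst c)) \<subseteq> parcs G"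
      if c: "c \<in> Cs" for c
    proof -
      obtain p where p: "distinct p" "3 \<le> length p" "c = cyc p" "set c \<subseteq> parcs G"
        using Cs(3)[OF c] unfolding undirected_cycle_iff[OF wf] by blast
      moreover have "map fst c = p" using p(3) by (simp add: cyc_def)
      ultimately show "distinct (map fst c)" "3 \<le> length (map fst c)" "set (cyc (map fst c)) \<subseteq> parcs G"
        by auto
    qed
    have sv: "set (map fst c) = cycle_verts c" for c :: "(nat \<times> nat) list"
      by (simp add: cycle_verts_def)
    have C: "disjoint_cycles C"
      unfolding disjoint_cycles_def
    proof (intro conjI ballI impI)
      fix p q assume "p \<in> C" "q \<in> C" "p \<noteq> q"
      then obtain a b where "p = map fst a" "q = map fst b" "a \<in> Cs" "b \<in> Cs" "a \<noteq> b"
        unfolding C_def by blast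
      then show "set p \<inter> set q = {}" using Cs(4)[of a b] unfolding sv[symmetric] by blast
    qed (use Cs(1) c in \<open>auto simp: C_def\<close>)
    have arcs: "cyc_arcs C \<subseteq> parcs G" using c(3) unfolding cyc_arcs_def C_def by blast
    \<comment> \<open>Each edge of a cycle is represented by the orientation that \<open>E\<close>
      contains.\<close>
    define S where "S = {(u, v) \<in> E. (u, v) \<in> cyc_arcs C \<or> (v, u) \<in> cyc_arcs C}"
    have SE: "S \<subseteq> E" by (auto simp: S_def)
    have finS: "finite S" using SE finE finite_subset by blast
    have oS: "oriented S" using SE E(2) unfolding oriented_def by blast
    have nb: "nbrs S v = nbrs (cyc_arcs C) v" for v
      using arcs cov unfolding nbrs_def S_def by blast
    have ev: "everts S = (\<Union>p\<in>C. set p)" by (rule everts_cycles[OF C nb])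
    then have "everts S = (\<Union>c\<in>Cs. cycle_verts c)" by (simp add: C_def cycle_verts_def)
    then have cev: "card (everts S) = l" using Cs(5) by simp
    have deg: "edeg S v = (if v \<in> everts S then 2 else 0)" for v
    proof (cases "v \<in> everts S")
      case True
      then obtain p where p: "p \<in> C" "v \<in> set p" unfolding ev by blast
      have "card (nbrs (set (cyc p)) v) = 2"
        using C p by (intro card_nbrs_cyc) (auto simp: disjoint_cycles_def)
      then show ?thesis using True edeg_nbrs[OF oS finS] nb nbrs_cyc_arcs_in[OF C p] by simp
    qed (simp add: edeg_eq_0_iff[OF finS])
    have "2 * card S = (\<Sum>v\<in>everts S. edeg S v)" by (rule sum_edeg[OF finS, symmetric])
    also have "\<dots> = 2 * l" using cev by (simp add: deg)
    finally have cS: "card S = l" by simp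
    have ln: "l \<le> n" using card_mono[OF _ evG[OF SE]] cev by simp
    have cu: "card (cuts {..<n} S) = 2 ^ (n - l + card C)"
      using card_cuts_cycles[OF _ evG[OF SE] C nb] cev by simp
    \<comment> \<open>That there are at most \<open>n\<close> cycles follows from the count of
      consistent cuts, which is at most the number of all cuts.\<close>
    then have "(2 :: nat) ^ (n - l + card C) \<le> 2 ^ n" using card_cuts_le[of n S] by simp
    then have "n - l + card C \<le> n" by simp
    moreover have "card C \<le> k" using Cs(1,2) card_image_le[of Cs "map fst"] by (auto simp: C_def)
    ultimately have "card C \<le> min k n" using ln by simp
    moreover have "2 ^ l * card (cuts {..<n} S) = 2 ^ (n + card C)"
      using ln cu by (simp flip: power_add)
    ultimately have "\<not> 2 ^ (n + min k n + 1) dvd 2 ^ l * card (cuts {..<n} S)"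
      using power_dvd_imp_le[of "2 :: nat" "n + min k n + 1" "n + card C"] by auto
    then have "S \<in> cover_sets n E (min k n) l"
      using SE cS cev deg by (auto simp: cover_sets_def even_sets_def)
    then show "cover_sets n E (min k n) l \<noteq> {}" by blast
  qed
qed

section \<open>Evaluating the partition function along an elimination forest\<close>

lemma sum_PiE_insert:
  assumes "v \<notin> U"
  shows "(\<Sum>a\<in>PiE (insert v U) (\<lambda>_. B). f a) = (\<Sum>a\<in>PiE U (\<lambda>_. B). \<Sum>s\<in>B. f (a(v := s)))"
proof -
  have "(\<Sum>a\<in>PiE (insert v U) (\<lambda>_. B). f a) = (\<Sum>(s, a)\<in>B \<times> PiE U (\<lambda>_. B). f (a(v := s)))"
    unfolding PiE_insert_eq by (subst sum.reindex[OF inj_combinator[OF assms]]) (simp add: case_prod_unfold)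
  also have "\<dots> = (\<Sum>s\<in>B. \<Sum>a\<in>PiE U (\<lambda>_. B). f (a(v := s)))"
    by (simp add: sum.cartesian_product)
  finally show ?thesis by (simp add: sum.swap[of _ _ B])
qed

text \<open>
  \<open>par v\<close> is 0 for a root and the successor of the parent otherwise. \<open>E\<close> holds the edges of the
  graph, directed from the ancestor to the descendant.
\<close>

locale elim_forest =
  fixes n d :: nat and par dep :: "nat \<Rightarrow> nat" and E :: "(nat \<times> nat) set"
    and Y :: int and T :: "nat \<times> nat \<Rightarrow> int" and M :: nat
  assumes par_le: "v < n \<Longrightarrow> par v \<le> n"
    and dep_rec: "v < n \<Longrightarrow> dep v = (if par v = 0 then 1 else Suc (dep (par v - 1)))"
    and dep_le: "v < n \<Longrightarrow> dep v \<le> d"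
    and E_anc: "(u, v) \<in> E \<Longrightarrow> u < n \<and> v < n \<and> (v, u) \<in> {(v, u). v < n \<and> par v = Suc u}\<^sup>+"
begin

abbreviation R :: "(nat \<times> nat) set" where
  "R \<equiv> {(v, u). v < n \<and> par v = Suc u}"

text \<open>Descendants get less significant digits, so counting upwards varies their states fastest
  and keeps the ancestors fixed while a subtree is being summed.\<close>

definition pos :: "nat \<Rightarrow> nat" where
  "pos v = d - dep v"

definition children :: "nat \<Rightarrow> nat set" where
  "children v = {c. c < n \<and> par c = Suc v}"

lemma finite_children [simp]: "finite (children v)"
  by (simp add: children_def)

lemma par_Suc: "v < n \<Longrightarrow> par v = Suc u \<Longrightarrow> u < n \<and> dep v = Suc (dep u)"
  using par_le[of v] dep_rec[of v] by auto

lemma dep_pos: "v < n \<Longrightarrow> 0 < dep v"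
  using dep_rec[of v] by auto

lemma pos_less: "v < n \<Longrightarrow> pos v < d"
  using dep_pos[of v] dep_le[of v] by (auto simp: pos_def)

lemma pos_child: "c \<in> children v \<Longrightarrow> c < n \<and> v < n \<and> pos v = Suc (pos c) \<and> dep c = Suc (dep v)"
  using par_Suc[of c v] dep_le[of c] by (auto simp: children_def pos_def)

lemma pos_root: "v < n \<Longrightarrow> par v = 0 \<Longrightarrow> Suc (pos v) = d"
  using dep_rec[of v] dep_le[of v] by (auto simp: pos_def)

lemma anc_dep: "(v, u) \<in> R\<^sup>+ \<Longrightarrow> dep u < dep v"
  by (induction rule: trancl_induct) (auto dest: par_Suc)

text \<open>Every edge is charged to its lower end \<open>v\<close>; the other end is an ancestor of
  \<open>v\<close>.\<close>

definition local_weight :: "nat \<Rightarrow> (nat \<Rightarrow> nat) \<Rightarrow> int" where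
  "local_weight v a = kappa5 Y (a v) * (\<Prod>u\<in>{u. u < n \<and> (u, v) \<in> E}. 1 + inter5 (a u) (a v) * T (u, v))"

text \<open>
  The states of \<open>v\<close> and its proper ancestors are the base 5 digits of a number \<open>y\<close>, that of \<open>v\<close>
  being the least significant one.
\<close>

definition node :: "nat \<Rightarrow> nat \<Rightarrow> int" where
  "node v y = local_weight v (\<lambda>u. y div 5 ^ (dep v - dep u) mod 5)"

text \<open>The number \<open>z\<close> encodes the states of the proper ancestors of
  \<open>v\<close>. The first argument is fuel for a primitive recursion; \<open>Suc (pos v)\<close>
  is enough, since \<open>pos\<close> drops by one at each child.\<close>

primrec vals :: "nat \<Rightarrow> nat \<Rightarrow> nat \<Rightarrow> int" where
  "vals 0 v z = 0"
| "vals (Suc j) v z = (\<Sum>a<5. node v (5 * z + a) * (\<Prod>c\<in>children v. vals j c (5 * z + a)))"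

definition val :: "nat \<Rightarrow> nat \<Rightarrow> int" where
  "val v = vals (Suc (pos v)) v"

definition summand :: "nat \<Rightarrow> nat \<Rightarrow> int" where
  "summand v y = node v y * (\<Prod>c\<in>children v. val c y)"

lemma val_eq: "val v z = (\<Sum>a<5. summand v (5 * z + a))"
  unfolding val_def summand_def vals.simps using pos_child by (intro sum.cong refl) (simp add: val_def)

text \<open>Packs the states of the proper ancestors into one number, the parent in the last digit.
  The numeric argument is again fuel, set to the depth in \<open>path_code\<close>.\<close>

primrec path_codes :: "(nat \<Rightarrow> nat) \<Rightarrow> nat \<Rightarrow> nat \<Rightarrow> nat" where
  "path_codes a 0 v = 0"
| "path_codes a (Suc k) v = (if par v = 0 then 0 else 5 * path_codes a k (par v - 1) + a (par v - 1))"

definition path_code :: "(nat \<Rightarrow> nat) \<Rightarrow> nat \<Rightarrow> nat" where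
  "path_code a v = path_codes a (dep v) v"

lemma path_code_root: "par v = 0 \<Longrightarrow> path_code a v = 0"
  by (cases "dep v") (auto simp: path_code_def)

lemma path_code_child: "v < n \<Longrightarrow> par v = Suc p \<Longrightarrow> path_code a v = 5 * path_code a p + a p"
  using par_Suc[of v p] by (auto simp: path_code_def)

lemma path_code_cong: "v < n \<Longrightarrow> (\<And>u. dep u < dep v \<Longrightarrow> a u = b u) \<Longrightarrow> path_code a v = path_code b v"
proof (induction "dep v" arbitrary: v rule: less_induct)
  case less
  show ?case
  proof (cases "par v")
    case 0
    then show ?thesis by (simp add: path_code_root)
  next
    case (Suc p)
    then have p: "p < n" "dep v = Suc (dep p)" using par_Suc less.prems(1) by auto
    then have "path_code a p = path_code b p" using less.hyps[of p] less.prems(2) by auto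
    then show ?thesis using path_code_child[OF less.prems(1) Suc] less.prems(2)[of p] p by simp
  qed
qed

lemma path_code_digit:
  assumes "(v, u) \<in> R\<^sup>+" "\<And>w. (v, w) \<in> R\<^sup>+ \<Longrightarrow> a w < 5"
  shows "path_code a v div 5 ^ (dep v - dep u - 1) mod 5 = a u"
  using assms
proof (induction rule: converse_trancl_induct)
  case (base v)
  then have "a u < 5" "path_code a v = 5 * path_code a u + a u" "dep v = Suc (dep u)"
    using path_code_child[of v u] par_Suc[of v u] by auto
  then show ?case by simp
next
  case (step v p)
  then have vp: "v < n" "par v = Suc p" by auto
  have "a w < 5" if "(p, w) \<in> R\<^sup>+" for w
    using step.prems[of w] step.hyps(1) that by (meson trancl_into_trancl2)
  from step.IH[OF this] have IH: "path_code a p div 5 ^ (dep p - dep u - 1) mod 5 = a u" .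
  have "a p < 5" using step.prems[of p] step.hyps(1) by blast
  then have "path_code a v div 5 = path_code a p" using path_code_child[OF vp] by simp
  moreover have "dep v - dep u - 1 = Suc (dep p - dep u - 1)"
    using par_Suc[OF vp] anc_dep[OF step.hyps(2)] by simp
  ultimately show ?case using IH by (simp add: div_mult2_eq)
qed

text \<open>All edges charged to \<open>v\<close> come from proper ancestors, so the code together
  with the state of \<open>v\<close> contains everything that the weight depends on.\<close>

lemma local_weight_node:
  assumes v: "v < n" and a: "\<And>w. (v, w) \<in> R\<^sup>+ \<Longrightarrow> a w < 5" and s: "s < 5"
  shows "local_weight v (a(v := s)) = node v (5 * path_code a v + s)"
proof -
  have d: "(5 * path_code a v + s) div 5 ^ (dep v - dep u) mod 5 = a u" "u \<noteq> v" if "(u, v) \<in> E" for u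
  proof -
    have anc: "(v, u) \<in> R\<^sup>+" using E_anc[OF that] by blast
    then have "dep v - dep u = Suc (dep v - dep u - 1)" using anc_dep by fastforce
    then have "(5 * path_code a v + s) div 5 ^ (dep v - dep u) = path_code a v div 5 ^ (dep v - dep u - 1)"
      using s by (simp add: div_mult2_eq)
    then show "(5 * path_code a v + s) div 5 ^ (dep v - dep u) mod 5 = a u"
      using path_code_digit[OF anc a] by simp
    show "u \<noteq> v" using anc anc_dep by blast
  qed
  show ?thesis
    unfolding node_def local_weight_def using s d by (auto intro!: arg_cong2[where f = "(*)"] prod.cong)
qed

text \<open>For an ancestor-closed \<open>U\<close> these are the roots of the subtrees that remain
  outside \<open>U\<close>.\<close>

definition frontier :: "nat set \<Rightarrow> nat set" where
  "frontier U = {c. c < n \<and> c \<notin> U \<and> (par c = 0 \<or> par c - 1 \<in> U)}"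

text \<open>Interpolates between the partition function, when \<open>U\<close> contains all
  vertices, and the product of the values of the roots, when \<open>U\<close> is empty: states are
  summed explicitly on \<open>U\<close>, and every subtree outside is already condensed into its
  \<open>val\<close>.\<close>

definition partial_sum :: "nat set \<Rightarrow> int" where
  "partial_sum U = (\<Sum>a\<in>PiE U (\<lambda>_. {..<5}).
     (\<Prod>w\<in>U. local_weight w a) * (\<Prod>c\<in>frontier U. val c (path_code a c)))"

text \<open>All children of a deepest vertex \<open>v\<close> of \<open>U\<close> are in the
  frontier. Summing over the state of \<open>v\<close> merges its local weight and the values of its
  children into \<open>val v\<close>; no other factor depends on that state, so \<open>v\<close>
  moves from \<open>U\<close> to the frontier.\<close>

lemma partial_sum_remove:
  assumes U: "U \<subseteq> {..<n}" "\<And>w p. w \<in> U \<Longrightarrow> par w = Suc p \<Longrightarrow> p \<in> U"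
    and v: "v \<in> U" "\<And>w. w \<in> U \<Longrightarrow> dep w \<le> dep v"
  shows "partial_sum U = partial_sum (U - {v})"
proof -
  define U' where "U' = U - {v}"
  have Ueq: "U = insert v U'" "v \<notin> U'" using v by (auto simp: U'_def)
  have vn: "v < n" using U v by auto
  have fin: "finite U'" using U(1) finite_subset unfolding U'_def by (metis finite_Diff finite_lessThan)
  have anc_in: "w \<in> U" if "(x, w) \<in> R\<^sup>+" "x \<in> U" for x w
    using that by (induction rule: trancl_induct) (use U(2) in auto)
  have anc_in': "w \<in> U'" if "(v, w) \<in> R\<^sup>+" for w
    using anc_in[OF that v(1)] anc_dep[OF that] by (auto simp: U'_def)
  define A where "A = {c. c < n \<and> c \<notin> U \<and> (par c = 0 \<or> par c - 1 \<in> U')}"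
  have ch: "children v \<inter> U = {}"
    using pos_child v(2) by fastforce
  have fr: "frontier U = A \<union> children v" "A \<inter> children v = {}"
    using ch Ueq by (auto simp: frontier_def A_def children_def)
  have fr': "frontier U' = insert v A" "v \<notin> A"
  proof -
    have "par v = 0 \<or> par v - 1 \<in> U'"
    proof (cases "par v")
      case (Suc p)
      then show ?thesis using U(2)[OF v(1) Suc] par_Suc[OF vn Suc] by (auto simp: U'_def)
    qed simp
    then show "frontier U' = insert v A" "v \<notin> A" using vn v(1) by (auto simp: frontier_def A_def U'_def)
  qed
  have finA: "finite A" by (simp add: A_def)
  have codeA: "path_code (a(v := s)) c = path_code a c" if "c \<in> A" for a s c
  proof (cases "par c")
    case (Suc p)
    then have p: "p \<in> U'" "c < n" using that by (auto simp: A_def)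
    then have "p \<noteq> v" "dep p \<le> dep v" "p < n" using Ueq v(2) U(1) by auto
    moreover from this have "path_code (a(v := s)) p = path_code a p" by (intro path_code_cong) auto
    ultimately show ?thesis using path_code_child[OF p(2) Suc] by simp
  qed (simp add: path_code_root)
  have codev: "path_code (a(v := s)) v = path_code a v" for a s
    by (rule path_code_cong[OF vn]) auto
  have loc: "local_weight w (a(v := s)) = local_weight w a" if "w \<in> U'" for w a s
  proof -
    have "u \<noteq> v" if "(u, w) \<in> E" for u
      using E_anc[OF that] anc_dep v(2)[of w] \<open>w \<in> U'\<close> Ueq by fastforce
    then show ?thesis unfolding local_weight_def using that Ueq
      by (auto intro!: arg_cong2[where f = "(*)"] prod.cong)
  qed
  have "partial_sum U = (\<Sum>a\<in>PiE U' (\<lambda>_. {..<5}). \<Sum>s<5. (\<Prod>w\<in>U. local_weight w (a(v := s))) *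
      (\<Prod>c\<in>frontier U. val c (path_code (a(v := s)) c)))"
    unfolding partial_sum_def by (subst (1) Ueq(1), subst sum_PiE_insert[OF Ueq(2)]) simp
  also have "\<dots> = (\<Sum>a\<in>PiE U' (\<lambda>_. {..<5}). (\<Prod>w\<in>U'. local_weight w a) * (\<Prod>c\<in>frontier U'. val c (path_code a c)))"
  proof (rule sum.cong[OF refl])
    fix a assume a: "a \<in> PiE U' (\<lambda>_. {..<5 :: nat})"
    have a5: "a w < 5" if "(v, w) \<in> R\<^sup>+" for w using anc_in'[OF that] a by auto
    have "(\<Sum>s<5. (\<Prod>w\<in>U. local_weight w (a(v := s))) * (\<Prod>c\<in>frontier U. val c (path_code (a(v := s)) c))) =
        (\<Sum>s<5. summand v (5 * path_code a v + s) * ((\<Prod>w\<in>U'. local_weight w a) * (\<Prod>c\<in>A. val c (path_code a c))))"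
    proof (rule sum.cong[OF refl])
      fix s assume s: "s \<in> {..<5 :: nat}"
      have "(\<Prod>w\<in>U. local_weight w (a(v := s))) = node v (5 * path_code a v + s) * (\<Prod>w\<in>U'. local_weight w a)"
        unfolding Ueq(1) using fin Ueq(2) s local_weight_node[OF vn a5] by (simp add: loc)
      moreover have "(\<Prod>c\<in>frontier U. val c (path_code (a(v := s)) c)) =
          (\<Prod>c\<in>A. val c (path_code a c)) * (\<Prod>c\<in>children v. val c (5 * path_code a v + s))"
        unfolding fr(1) using finA fr(2)
        by (simp add: prod.union_disjoint codeA children_def path_code_child codev)
      ultimately show "(\<Prod>w\<in>U. local_weight w (a(v := s))) * (\<Prod>c\<in>frontier U. val c (path_code (a(v := s)) c)) =
        summand v (5 * path_code a v + s) * ((\<Prod>w\<in>U'. local_weight w a) * (\<Prod>c\<in>A. val c (path_code a c)))"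
        by (simp add: summand_def algebra_simps)
    qed
    also have "\<dots> = val v (path_code a v) * ((\<Prod>w\<in>U'. local_weight w a) * (\<Prod>c\<in>A. val c (path_code a c)))"
      by (simp add: val_eq sum_distrib_right)
    also have "\<dots> = (\<Prod>w\<in>U'. local_weight w a) * (\<Prod>c\<in>frontier U'. val c (path_code a c))"
      unfolding fr'(1) using finA fr'(2) by simp
    finally show "(\<Sum>s<5. (\<Prod>w\<in>U. local_weight w (a(v := s))) * (\<Prod>c\<in>frontier U. val c (path_code (a(v := s)) c))) =
      (\<Prod>w\<in>U'. local_weight w a) * (\<Prod>c\<in>frontier U'. val c (path_code a c))" .
  qed
  finally show ?thesis by (simp add: partial_sum_def U'_def)
qed

lemma partial_sum_empty: "U \<subseteq> {..<n} \<Longrightarrow> (\<And>w p. w \<in> U \<Longrightarrow> par w = Suc p \<Longrightarrow> p \<in> U) \<Longrightarrow>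
  partial_sum U = partial_sum {}"
proof (induction "card U" arbitrary: U)
  case 0
  then have "U = {}" using finite_subset[of U "{..<n}"] by auto
  then show ?case by simp
next
  case (Suc m)
  have fin: "finite U" using Suc.prems(1) finite_subset by blast
  have "U \<noteq> {}" using Suc.hyps(2) by auto
  then have "Max (dep ` U) \<in> dep ` U" "\<And>w. w \<in> U \<Longrightarrow> dep w \<le> Max (dep ` U)" using fin by auto
  then obtain v where v: "v \<in> U" "\<And>w. w \<in> U \<Longrightarrow> dep w \<le> dep v" by auto
  have "partial_sum U = partial_sum (U - {v})" using Suc.prems v by (rule partial_sum_remove)
  also have "\<dots> = partial_sum {}"
  proof (rule Suc.hyps(1))
    show "m = card (U - {v})" using Suc.hyps(2) v(1) fin by simp
    fix w p assume w: "w \<in> U - {v}" "par w = Suc p"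
    then have "p \<in> U" "dep w = Suc (dep p)" using Suc.prems par_Suc[of w p] by auto
    then show "p \<in> U - {v}" using v(2)[of w] w by auto
  qed (use Suc.prems in auto)
  finally show ?case .
qed

theorem partition5_forest: "partition5 {..<n} E Y T = (\<Prod>v\<in>{v. v < n \<and> par v = 0}. val v 0)"
proof -
  have finE: "finite E" by (rule finite_subset[of _ "{..<n} \<times> {..<n}"]) (use E_anc in auto)
  have E_split: "(\<Prod>(u, v)\<in>E. f u v) = (\<Prod>v<n. \<Prod>u\<in>{u. u < n \<and> (u, v) \<in> E}. f u v)"
    for f :: "nat \<Rightarrow> nat \<Rightarrow> int"
  proof -
    have "(\<Prod>v<n. \<Prod>u\<in>{u. u < n \<and> (u, v) \<in> E}. f u v) =
        (\<Prod>(v, u)\<in>(SIGMA v:{..<n}. {u. u < n \<and> (u, v) \<in> E}). f u v)"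
      by (rule prod.Sigma) auto
    also have "\<dots> = (\<Prod>(u, v)\<in>E. f u v)"
      by (rule prod.reindex_bij_witness[of _ prod.swap prod.swap]) (auto dest: E_anc)
    finally show ?thesis by simp
  qed
  have "frontier {..<n} = {}" using par_le by (force simp: frontier_def)
  then have "partition5 {..<n} E Y T = partial_sum {..<n}"
    unfolding partition5_def partial_sum_def local_weight_def E_split by (simp add: prod.distrib)
  also have "\<dots> = partial_sum {}"
    by (rule partial_sum_empty) (auto dest: par_Suc)
  also have "\<dots> = (\<Prod>v\<in>{v. v < n \<and> par v = 0}. val v 0)"
    unfolding partial_sum_def by (simp add: frontier_def path_code_root)
  finally show ?thesis .
qed

text \<open>
  The state of the evaluation in round \<open>x\<close>, when exactly the vertices in \<open>D\<close> have been processed: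
  cell \<open>w\<close> holds the sum over those values of the digit of \<open>w\<close> that are completed, for the current
  values of the more significant digits.
\<close>

definition lower :: "nat \<Rightarrow> nat set \<Rightarrow> nat \<Rightarrow> nat" where
  "lower x D w = (if par w = 0 then 0
     else 5 * ((if par w - 1 \<in> D then Suc x else x) div 5 ^ Suc (pos w)))"

definition upper :: "nat \<Rightarrow> nat set \<Rightarrow> nat \<Rightarrow> nat" where
  "upper x D w = (if w \<in> D then Suc x else x) div 5 ^ pos w"

definition dp_inv :: "nat \<Rightarrow> nat set \<Rightarrow> (nat \<Rightarrow> nat) \<Rightarrow> bool" where
  "dp_inv x D S \<longleftrightarrow> (\<forall>w<n. int (S w) = (\<Sum>y\<in>{lower x D w..<upper x D w}. summand w y) mod int M)"

lemma dp_inv_final: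
  assumes "dp_inv (5 ^ d) {} S" "v < n" "par v = 0"
  shows "int (S v) = val v 0 mod int M"
proof -
  have "(5 :: nat) ^ d div 5 ^ pos v = 5"
    using pos_root[OF assms(2,3)] by (metis nonzero_mult_div_cancel_right power_Suc power_not_zero zero_neq_numeral)
  then show ?thesis using assms by (simp add: dp_inv_def lower_def upper_def val_eq lessThan_atLeast0)
qed

lemma dp_inv_round:
  assumes "dp_inv x {w. pos w < d} S"
  shows "dp_inv (Suc x) {} S"
proof -
  have "lower x {w. pos w < d} w = lower (Suc x) {} w" "upper x {w. pos w < d} w = upper (Suc x) {} w"
    if "w < n" for w
    using that pos_less par_Suc[OF that] by (cases "par w"; auto simp: lower_def upper_def)+
  then show ?thesis using assms by (simp add: dp_inv_def)
qed

text \<open>If \<open>5 ^ j\<close> does not divide \<open>Suc x\<close>, some digit of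
  \<open>x\<close> below position \<open>j\<close> is not 4. The digits from position
  \<open>j\<close> upwards then survive the increment of \<open>x\<close>, and no sum at level
  \<open>j\<close> becomes due.\<close>

lemma dp_inv_skip:
  assumes "dp_inv x {w. pos w < j} S" "\<not> 5 ^ j dvd Suc x"
  shows "dp_inv x {w. pos w < Suc j} S"
proof -
  have dv: "Suc x div 5 ^ j = x div 5 ^ j" using assms(2) by (auto simp: div_Suc dvd_eq_mod_eq_0)
  have "upper x {w. pos w < Suc j} w = upper x {w. pos w < j} w" for w
    using dv by (auto simp: upper_def less_Suc_eq)
  moreover have "lower x {w. pos w < Suc j} w = lower x {w. pos w < j} w" if "w < n" for w
  proof (cases "par w")
    case (Suc p)
    then have "pos p = Suc (pos w)" using pos_child[of w p] that by (auto simp: children_def)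
    then show ?thesis using Suc dv by (auto simp: lower_def less_Suc_eq simp del: power_Suc)
  qed (simp add: lower_def)
  ultimately show ?thesis using assms(1) by (simp add: dp_inv_def)
qed

text \<open>When all digits below position \<open>pos v\<close> are 4, the cells of the children
  have run through all five states and hold their values for the current state of \<open>v\<close>.
  They are multiplied into the summand of \<open>v\<close> and cleared for the next state. This
  forces the order: children before \<open>v\<close>, the parent after it.\<close>

lemma dp_inv_node:
  assumes inv: "dp_inv x D S" and v: "v < n" "v \<notin> D" "children v \<subseteq> D"
    and p: "\<And>p. par v = Suc p \<Longrightarrow> p \<notin> D"
    and dvd: "5 ^ pos v dvd Suc x"
    and S': "\<And>w. w < n \<Longrightarrow> S' w = (if w \<in> children v then 0 else if w = v then (S v + acc) mod M else S w)"
    and acc: "int acc = (node v (x div 5 ^ pos v) * (\<Prod>c\<in>children v. int (S c))) mod int M"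
    and x: "x < 5 ^ d"
  shows "dp_inv x (insert v D) S'"
  unfolding dp_inv_def
proof (intro allI impI)
  fix w assume w: "w < n"
  let ?X = "x div 5 ^ pos v"
  have dv: "Suc x div 5 ^ pos v = Suc ?X" using dvd by (auto simp: div_Suc dvd_eq_mod_eq_0)
  have vv: "v \<notin> children v" using pos_child[of v v] by auto
  consider "w \<in> children v" | "w = v" | "w \<notin> children v" "w \<noteq> v" by blast
  then show "int (S' w) = (\<Sum>y\<in>{lower x (insert v D) w..<upper x (insert v D) w}. summand w y) mod int M"
  proof cases
    case 1
    then have pw: "par w = Suc v" "w \<in> D" "pos v = Suc (pos w)" using v(3) pos_child[OF 1] by (auto simp: children_def)
    then have "lower x (insert v D) w = 5 * (Suc x div 5 ^ Suc (pos w))" by (simp add: lower_def)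
    moreover have "upper x (insert v D) w = Suc x div 5 ^ pos w" using pw by (simp add: upper_def)
    moreover have "Suc x div 5 ^ pos w = 5 * (Suc x div 5 ^ Suc (pos w))"
    proof -
      have "5 ^ pos w * 5 dvd Suc x" using dvd pw(3) by (simp add: mult.commute)
      then obtain q where "Suc x = 5 ^ pos w * 5 * q" by blast
      then show ?thesis by (simp del: power_Suc add: power_Suc2 mult.assoc)
    qed
    ultimately show ?thesis using 1 S'[OF w] by simp
  next
    case 2
    \<comment> \<open>The interval of the cell of \<open>c\<close> is the block of the five codes
      that extend \<open>?X\<close> by a state of \<open>c\<close>.\<close>
    have vc: "int (S c) mod int M = val c ?X mod int M" if "c \<in> children v" for c
    proof -
      have c: "c < n" "par c = Suc v" "c \<in> D" "pos v = Suc (pos c)" using that v(3) pos_child[OF that] by (auto simp: children_def)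
      have "lower x D c = 5 * ?X" using c v(2) by (simp add: lower_def)
      moreover have "upper x D c = 5 * Suc ?X"
      proof -
        have "upper x D c = Suc x div 5 ^ pos c" using c by (simp add: upper_def)
        moreover have "Suc x div 5 ^ pos c = 5 * (Suc x div 5 ^ pos v)"
        proof -
          have "5 ^ pos c * 5 dvd Suc x" using dvd c(4) by (simp add: mult.commute)
          then obtain q where "Suc x = 5 ^ pos c * 5 * q" by blast
          then show ?thesis using c(4) by (simp del: power_Suc add: power_Suc2 mult.assoc)
        qed
        ultimately show ?thesis using dv by simp
      qed
      ultimately have "int (S c) = (\<Sum>y\<in>{5 * ?X..<5 * Suc ?X}. summand c y) mod int M"
        using inv c(1) by (simp add: dp_inv_def)
      also have "(\<Sum>y\<in>{5 * ?X..<5 * Suc ?X}. summand c y) = val c ?X"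
        unfolding val_eq using sum.shift_bounds_nat_ivl[of "summand c" 0 "5 * ?X" 5]
        by (simp add: lessThan_atLeast0 add.commute)
      finally show ?thesis by simp
    qed
    have "(\<Prod>c\<in>children v. int (S c)) mod int M = (\<Prod>c\<in>children v. int (S c) mod int M) mod int M"
      by (rule mod_prod_eq[symmetric])
    also have "\<dots> = (\<Prod>c\<in>children v. val c ?X mod int M) mod int M"
      by (intro arg_cong2[where f = "(mod)"] prod.cong refl vc)
    also have "\<dots> = (\<Prod>c\<in>children v. val c ?X) mod int M" by (rule mod_prod_eq)
    finally have acc': "int acc = summand v ?X mod int M"
      unfolding acc summand_def by (rule mod_mult_cong[OF refl])
    have lo: "lower x (insert v D) v = lower x D v"
      using p v by (cases "par v") (auto simp: lower_def dest: par_Suc)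
    \<comment> \<open>This ensures that raising the upper end from \<open>?X\<close> to
      \<open>Suc ?X\<close> adds exactly one summand.\<close>
    have le: "lower x D v \<le> ?X"
    proof (cases "par v")
      case (Suc p')
      then have "lower x D v = 5 * (x div 5 ^ Suc (pos v))" using p by (simp add: lower_def)
      also have "\<dots> = 5 * (?X div 5)" by (simp add: div_mult2_eq[symmetric] mult.commute)
      finally show ?thesis by simp
    qed (simp add: lower_def)
    have "upper x (insert v D) v = Suc ?X" "upper x D v = ?X" using v(2) dv by (auto simp: upper_def)
    then have "(\<Sum>y\<in>{lower x (insert v D) v..<upper x (insert v D) v}. summand v y) =
        (\<Sum>y\<in>{lower x D v..<upper x D v}. summand v y) + summand v ?X"
      using lo le by (simp add: sum.atLeastLessThan_Suc)
    moreover have "int (S v) = (\<Sum>y\<in>{lower x D v..<upper x D v}. summand v y) mod int M"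
      using inv v(1) by (simp add: dp_inv_def)
    ultimately show ?thesis using S'[OF w] 2 vv acc' by (simp add: of_nat_mod mod_add_eq)
  next
    case 3
    have "par w \<noteq> Suc v" using 3 w by (auto simp: children_def)
    then have "lower x (insert v D) w = lower x D w" by (auto simp: lower_def)
    moreover have "upper x (insert v D) w = upper x D w" using 3 by (simp add: upper_def)
    ultimately show ?thesis using S'[OF w] 3 inv w by (simp add: dp_inv_def)
  qed
qed

text \<open>Allows the program to read the states of \<open>v\<close> and its ancestors directly
  from the digits of the counter, at positions that do not depend on \<open>v\<close>.\<close>

lemma node_digits:
  assumes "v < n"
  shows "node v (x div 5 ^ pos v) = local_weight v (\<lambda>u. x div 5 ^ pos u mod 5)"
proof -
  have "x div 5 ^ pos v div 5 ^ (dep v - dep u) = x div 5 ^ pos u" if "dep u \<le> dep v" for u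
    using that dep_le[OF assms] by (simp add: pos_def flip: div_mult2_eq power_add)
  moreover have "dep u \<le> dep v" if "(u, v) \<in> E" for u
    using E_anc[OF that] anc_dep by (meson less_imp_le)
  ultimately show ?thesis
    unfolding node_def local_weight_def by (intro arg_cong2[where f = "(*)"] prod.cong refl) auto
qed

end

section \<open>The main loop of the program\<close>

text \<open>
  In round \<open>x\<close>, \<open>dg\<close> holds the base 5 digits of \<open>x\<close> and \<open>p\<close> the power \<open>5 ^ j\<close> of the current level
  \<open>j\<close>; \<open>c\<close> accumulates the summand of vertex \<open>v\<close>, which is then added to \<open>S[v]\<close>. The cells \<open>z\<close>
  and \<open>y\<close> hold the weight of state 0 and that of the other states, \<open>T\<close> the weights of the edges.
\<close>

definition edge_step :: com where
  "edge_step =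
     (let ix = Plus (Times (Var ''u'') (Var ''n'')) (Var ''v'') in
      Cond (And (Less (Num 0) (Read ''adj'' ix)) (Less (Read ''dep'' (Var ''u'')) (Read ''dep'' (Var ''v''))))
       (Seq (Assign ''e'' (Num 0) (Read ''dg'' (Minus (Var ''d'') (Read ''dep'' (Var ''u'')))))
         (Cond (And (Neg (Eq (Var ''a'') (Num 0)))
                 (Eq (Div (Plus (Var ''a'') (Num 1)) (Num 2)) (Div (Plus (Var ''e'') (Num 1)) (Num 2))))
           (Cond (Eq (Var ''a'') (Var ''e''))
             (Assign ''c'' (Num 0) (Mod (Times (Var ''c'') (Plus (Num 1) (Read ''T'' ix))) (Var ''M'')))
             (Assign ''c'' (Num 0) (Mod (Times (Var ''c'')
                (Plus (Num 1) (Times (Minus (Var ''M'') (Num 1)) (Read ''T'' ix)))) (Var ''M''))))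
           SKIP))
       SKIP)"

definition child_step :: com where
  "child_step =
     Cond (Eq (Read ''parent'' (Var ''w'')) (Plus (Var ''v'') (Num 1)))
       (Seq (Assign ''c'' (Num 0) (Mod (Times (Var ''c'') (Read ''S'' (Var ''w''))) (Var ''M'')))
         (Assign ''S'' (Var ''w'') (Num 0)))
       SKIP"

definition node_step :: com where
  "node_step =
     Seq (Assign ''a'' (Num 0) (Read ''dg'' (Var ''j'')))
      (Seq (Cond (Eq (Var ''a'') (Num 0))
              (Assign ''c'' (Num 0) (Var ''z'')) (Assign ''c'' (Num 0) (Var ''y'')))
        (Seq (For ''u'' (Var ''n'') edge_step)
          (Seq (For ''w'' (Var ''n'') child_step)
            (Assign ''S'' (Var ''v'') (Mod (Plus (Read ''S'' (Var ''v'')) (Var ''c'')) (Var ''M''))))))"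

definition level_step :: com where
  "level_step = For ''v'' (Var ''n'')
     (Cond (Eq (Minus (Var ''d'') (Read ''dep'' (Var ''v''))) (Var ''j'')) node_step SKIP)"

text \<open>\<open>Suc x\<close> is divisible by \<open>5 ^ j\<close> exactly when all digits of
  \<open>x\<close> below \<open>j\<close> are 4. Increasing \<open>j\<close> handles the deepest
  vertices before their parents.\<close>

definition round_step :: com where
  "round_step =
     Seq (Assign ''q'' (Num 0) (Var ''x''))
      (Seq (For ''j'' (Var ''d'')
             (Seq (Assign ''dg'' (Var ''j'') (Mod (Var ''q'') (Num 5)))
                  (Assign ''q'' (Num 0) (Div (Var ''q'') (Num 5)))))
        (Seq (Assign ''p'' (Num 0) (Num 1))
          (For ''j'' (Var ''d'')
            (Seq (Cond (Eq (Mod (Plus (Var ''x'') (Num 1)) (Var ''p'')) (Num 0)) level_step SKIP)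
                 (Assign ''p'' (Num 0) (Times (Var ''p'') (Num 5)))))))"

definition main_loop :: com where
  "main_loop = For ''x'' (Var ''X'') round_step"

definition root_product :: com where
  "root_product = Seq (Assign ''Z'' (Num 0) (Num 1))
     (For ''v'' (Var ''n'')
       (Cond (Eq (Read ''parent'' (Var ''v'')) (Num 0))
         (Assign ''Z'' (Num 0) (Mod (Times (Var ''Z'') (Read ''S'' (Var ''v''))) (Var ''M'')))
         SKIP))"

lemma mods_edge_step [simp]: "mods edge_step = {''e'', ''c''}"
  by (auto simp: edge_step_def Let_def)
lemma mods_child_step [simp]: "mods child_step = {''c'', ''S''}"
  by (auto simp: child_step_def)
lemma mods_node_step [simp]: "mods node_step = {''a'', ''c'', ''u'', ''e'', ''w'', ''S''}"
  by (auto simp: node_step_def)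
lemma mods_level_step [simp]: "mods level_step = {''v'', ''a'', ''c'', ''u'', ''e'', ''w'', ''S''}"
  by (auto simp: level_step_def)
lemma mods_round_step [simp]:
  "mods round_step = {''q'', ''dg'', ''j'', ''p'', ''v'', ''a'', ''c'', ''u'', ''e'', ''w'', ''S''}"
  by (auto simp: round_step_def)
lemma mods_main_loop [simp]:
  "mods main_loop = {''x'', ''q'', ''dg'', ''j'', ''p'', ''v'', ''a'', ''c'', ''u'', ''e'', ''w'', ''S''}"
  by (auto simp: main_loop_def)
lemma mods_root_product [simp]: "mods root_product = {''Z'', ''v''}"
  by (auto simp: root_product_def)

locale machine = elim_forest +
  fixes L B :: nat
  assumes L: "n * n + n < L" and dn: "d \<le> n" and B: "n \<le> B" "M \<le> B" "5 ^ d \<le> B" and M: "1 < M"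
begin

abbreviation "RUN \<equiv> run (bounded L B)"

text \<open>The data that the main loop only reads. Adjacency is symmetric, so the comparison of
  depths selects the orientation kept in \<open>E\<close>. The bound on \<open>y\<close> is
  conditional because for \<open>n = 0\<close> the powers stored in \<open>y\<close> and
  \<open>M\<close> coincide.\<close>

definition env :: "state \<Rightarrow> bool" where
  "env s \<longleftrightarrow> s ''n'' 0 = n \<and> s ''d'' 0 = d \<and> s ''M'' 0 = M \<and>
     (\<forall>v<n. s ''dep'' v = dep v \<and> s ''parent'' v = par v) \<and>
     (\<forall>u<n. \<forall>v<n. (0 < s ''adj'' (u * n + v) \<and> dep u < dep v) \<longleftrightarrow> (u, v) \<in> E) \<and>
     (\<forall>u v. (u, v) \<in> E \<longrightarrow> int (s ''T'' (u * n + v)) = T (u, v)) \<and>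
     int (s ''y'' 0) = Y \<and> (0 < n \<longrightarrow> s ''y'' 0 < M) \<and> int (s ''z'' 0) = (2 - 4 * Y) mod int M"

lemma env_cong:
  assumes "env s" "\<And>x. x \<in> {''n'', ''d'', ''M'', ''dep'', ''parent'', ''adj'', ''T'', ''y'', ''z''} \<Longrightarrow> s' x = s x"
  shows "env s'"
  using assms(1) unfolding env_def by (simp add: assms(2))

lemma bounded_leB: "bounded L B s \<Longrightarrow> s x i \<le> B"
  by (simp add: bounded_def)

lemma n_less_L: "n < L"
  using L by simp

lemma d_less_L: "d < L"
  using L dn by simp

lemma L_pos: "0 < L"
  using L by simp

lemma mod_le_B: "a mod M \<le> B"
  using mod_less_divisor[of M a] M B(2) by linarith

lemma run_edge_step:
  assumes s: "bounded L B s" "env s" "s ''v'' 0 = v" "v < n" "s ''u'' 0 = u" "u < n"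
    and a: "s ''a'' 0 = \<alpha> v" and dg: "\<And>i. i < d \<Longrightarrow> s ''dg'' i = x div 5 ^ i mod 5"
    and \<alpha>: "\<And>w. \<alpha> w = x div 5 ^ pos w mod 5"
    and c: "int (s ''c'' 0) = C mod int M"
  shows "RUN (\<lambda>s'. int (s' ''c'' 0) =
      (if (u, v) \<in> E then C * (1 + inter5 (\<alpha> u) (\<alpha> v) * T (u, v)) else C) mod int M) 6 edge_step s"
proof -
  have env: "s ''n'' 0 = n" "s ''d'' 0 = d" "s ''M'' 0 = M" "s ''dep'' u = dep u" "s ''dep'' v = dep v"
    "(0 < s ''adj'' (u * n + v) \<and> dep u < dep v) \<longleftrightarrow> (u, v) \<in> E"
    using s(2,4,6) by (auto simp: env_def)
  have T: "int (s ''T'' (u * n + v)) = T (u, v)" if "(u, v) \<in> E"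
    using s(2) that by (auto simp: env_def)
  have dgu: "s ''dg'' (d - dep u) = \<alpha> u"
    using dg[of "pos u"] pos_less[OF s(6)] by (simp add: \<alpha> pos_def)
  have lt5: "\<alpha> w < 5" for w by (simp add: \<alpha>)
  have \<alpha>B: "\<alpha> u \<le> B" using bounded_leB[OF s(1), of "''dg''" "d - dep u"] dgu by simp
  have i0: "inter5 (\<alpha> u) (\<alpha> v) = 0" if "\<alpha> v = 0 \<or> Suc (\<alpha> v) div 2 \<noteq> Suc (\<alpha> u) div 2"
    using that by (auto simp: inter5_def sgn5_def)
  have i1: "inter5 (\<alpha> u) (\<alpha> u) = 1" if "0 < \<alpha> u"
    using that by (auto simp: inter5_def sgn5_def)
  have i2: "inter5 (\<alpha> u) (\<alpha> v) = -1" if "0 < \<alpha> v \<and> Suc (\<alpha> v) div 2 = Suc (\<alpha> u) div 2" "\<alpha> v \<noteq> \<alpha> u"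
  proof -
    have "\<alpha> u \<in> {0, 1, 2, 3, 4}" "\<alpha> v \<in> {0, 1, 2, 3, 4}" using lt5[of u] lt5[of v] by auto
    then show ?thesis using that by (auto simp: inter5_def sgn5_def)
  qed
  have plus: "int ((s ''c'' 0 + s ''c'' 0 * t) mod M) = (C * (1 + int t)) mod int M" for t
  proof -
    have "int (s ''c'' 0 + s ''c'' 0 * t) = int (s ''c'' 0) * (1 + int t)" by (simp add: algebra_simps)
    then show ?thesis by (simp only: of_nat_mod c mod_mult_left_eq)
  qed
  \<comment> \<open>The factor \<open>M - 1\<close> acts as -1: the result is off by
    \<open>s ''c'' 0 * t * M\<close>, which the reduction removes.\<close>
  have minus: "int ((s ''c'' 0 + s ''c'' 0 * ((M - Suc 0) * t)) mod M) = (C * (1 - int t)) mod int M" for t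
  proof -
    have "s ''c'' 0 * ((M - Suc 0) * t) + s ''c'' 0 * t = s ''c'' 0 * t * M"
      using M by (cases M) (auto simp: algebra_simps)
    then have "int (s ''c'' 0 * ((M - Suc 0) * t)) + int (s ''c'' 0 * t) = int (s ''c'' 0 * t * M)"
      by (metis of_nat_add)
    then have "int (s ''c'' 0 + s ''c'' 0 * ((M - Suc 0) * t)) =
        int (s ''c'' 0) * (1 - int t) + int (s ''c'' 0) * int t * int M"
      by (simp add: algebra_simps)
    then have "int ((s ''c'' 0 + s ''c'' 0 * ((M - Suc 0) * t)) mod M) = (int (s ''c'' 0) * (1 - int t)) mod int M"
      by (simp only: of_nat_mod mod_mult_self1)
    then show ?thesis by (simp only: c mod_mult_left_eq)
  qed
  show ?thesis
    unfolding edge_step_def Let_def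
    by (intro run_Cond run_Seq_Assign run_Assign run_SKIP)
      (simp_all add: s env a dgu \<alpha>B T i0 i1 i2 plus[of "s ''T'' (u * n + v)"] minus L_pos bounded_leB mod_le_B c)
qed

lemma run_edges:
  assumes s: "bounded L B s" "env s" "s ''v'' 0 = v" "v < n"
    and a: "s ''a'' 0 = \<alpha> v" and dg: "\<And>i. i < d \<Longrightarrow> s ''dg'' i = x div 5 ^ i mod 5"
    and \<alpha>: "\<And>w. \<alpha> w = x div 5 ^ pos w mod 5"
    and c: "int (s ''c'' 0) = kappa5 Y (\<alpha> v) mod int M"
  shows "RUN (\<lambda>s'. int (s' ''c'' 0) = local_weight v \<alpha> mod int M) (n * 10 + 3) (For ''u'' (Var ''n'') edge_step) s"
proof (rule run_For[where m = n and T = 6 and J = "\<lambda>k s'. int (s' ''c'' 0) =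
    (kappa5 Y (\<alpha> v) * (\<Prod>u\<in>{u. u < k \<and> (u, v) \<in> E}. 1 + inter5 (\<alpha> u) (\<alpha> v) * T (u, v))) mod int M"])
  show "aval (Var ''n'') s = n" using s(2) by (simp add: env_def)
next
  fix k s' assume k: "k < n" and b: "bounded L B s'"
    and fr: "\<And>x. x \<noteq> ''u'' \<Longrightarrow> x \<notin> mods edge_step \<Longrightarrow> s' x = s x" and u: "s' ''u'' 0 = k"
    and J: "int (s' ''c'' 0) = (kappa5 Y (\<alpha> v) *
      (\<Prod>u\<in>{u. u < k \<and> (u, v) \<in> E}. 1 + inter5 (\<alpha> u) (\<alpha> v) * T (u, v))) mod int M"
  let ?f = "\<lambda>u. 1 + inter5 (\<alpha> u) (\<alpha> v) * T (u, v)"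
  have st: "{u. u < Suc k \<and> (u, v) \<in> E} =
      (if (k, v) \<in> E then insert k {u. u < k \<and> (u, v) \<in> E} else {u. u < k \<and> (u, v) \<in> E})"
    by (auto simp: less_Suc_eq)
  have env': "env s'" by (rule env_cong[OF s(2)]) (auto simp: fr)
  show "RUN (\<lambda>s'. int (s' ''c'' 0) = (kappa5 Y (\<alpha> v) *
      (\<Prod>u\<in>{u. u < Suc k \<and> (u, v) \<in> E}. ?f u)) mod int M) 6 edge_step s'"
  proof (rule run_mono[OF run_edge_step[where \<alpha> = \<alpha> and x = x, OF b env' _ s(4) u k _ _ \<alpha> J]])
    fix s1 assume "int (s1 ''c'' 0) =
      (if (k, v) \<in> E then kappa5 Y (\<alpha> v) * (\<Prod>u\<in>{u. u < k \<and> (u, v) \<in> E}. ?f u) * ?f k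
       else kappa5 Y (\<alpha> v) * (\<Prod>u\<in>{u. u < k \<and> (u, v) \<in> E}. ?f u)) mod int M"
    then show "int (s1 ''c'' 0) = (kappa5 Y (\<alpha> v) * (\<Prod>u\<in>{u. u < Suc k \<and> (u, v) \<in> E}. ?f u)) mod int M"
      unfolding st by (simp add: mult.assoc mult.commute[of "?f k"])
  qed (use s a dg in \<open>simp_all add: fr\<close>)
next
  fix s' :: state
  assume "int (s' ''c'' 0) = (kappa5 Y (\<alpha> v) *
      (\<Prod>u\<in>{u. u < n \<and> (u, v) \<in> E}. 1 + inter5 (\<alpha> u) (\<alpha> v) * T (u, v))) mod int M"
  then show "int (s' ''c'' 0) = local_weight v \<alpha> mod int M" by (simp add: local_weight_def)
qed (use s B L_pos c in simp_all)

lemma run_children: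
  assumes s: "bounded L B s" "env s" "s ''v'' 0 = v" "v < n"
    and c: "int (s ''c'' 0) = C mod int M"
  shows "RUN (\<lambda>s'. int (s' ''c'' 0) = (C * (\<Prod>c\<in>children v. int (s ''S'' c))) mod int M \<and>
           (\<forall>w<n. s' ''S'' w = (if w \<in> children v then 0 else s ''S'' w)))
         (n * 8 + 3) (For ''w'' (Var ''n'') child_step) s"
proof (rule run_For[where m = n and T = 4 and J = "\<lambda>k s'.
    int (s' ''c'' 0) = (C * (\<Prod>c\<in>{c \<in> children v. c < k}. int (s ''S'' c))) mod int M \<and>
    (\<forall>w<n. s' ''S'' w = (if w \<in> children v \<and> w < k then 0 else s ''S'' w))"])
  show "aval (Var ''n'') s = n" using s(2) by (simp add: env_def)
next
  fix k s' assume k: "k < n" and b: "bounded L B s'"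
    and fr: "\<And>x. x \<noteq> ''w'' \<Longrightarrow> x \<notin> mods child_step \<Longrightarrow> s' x = s x" and w: "s' ''w'' 0 = k"
    and J: "int (s' ''c'' 0) = (C * (\<Prod>c\<in>{c \<in> children v. c < k}. int (s ''S'' c))) mod int M \<and>
      (\<forall>w<n. s' ''S'' w = (if w \<in> children v \<and> w < k then 0 else s ''S'' w))"
  have st: "{c \<in> children v. c < Suc k} =
      (if k \<in> children v then insert k {c \<in> children v. c < k} else {c \<in> children v. c < k})"
    by (auto simp: less_Suc_eq)
  have p: "s' ''parent'' k = par k" "s' ''M'' 0 = M" "s' ''v'' 0 = v"
    using s k by (auto simp: fr env_def)
  have ch: "k \<in> children v \<longleftrightarrow> par k = Suc v" using k by (auto simp: children_def)
  have "int (s' ''c'' 0 * s' ''S'' k mod M) =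
      (C * (int (s ''S'' k) * (\<Prod>c\<in>{c \<in> children v. c < k}. int (s ''S'' c)))) mod int M"
  proof -
    have "int (s' ''c'' 0 * s' ''S'' k mod M) =
        (C * (\<Prod>c\<in>{c \<in> children v. c < k}. int (s ''S'' c)) * int (s ''S'' k)) mod int M"
      using J k by (simp add: of_nat_mod mod_mult_left_eq)
    then show ?thesis by (simp only: ac_simps)
  qed
  then show "RUN (\<lambda>s'. int (s' ''c'' 0) = (C * (\<Prod>c\<in>{c \<in> children v. c < Suc k}. int (s ''S'' c))) mod int M \<and>
      (\<forall>w<n. s' ''S'' w = (if w \<in> children v \<and> w < Suc k then 0 else s ''S'' w))) 4 child_step s'"
    unfolding child_step_def st
    by (intro run_Cond run_Seq_Assign run_Assign run_SKIP)
      (use J k n_less_L in \<open>auto simp: b w p ch L_pos mod_le_B less_Suc_eq\<close>)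
next
  fix s' :: state
  have "{c \<in> children v. c < n} = children v" by (auto simp: children_def)
  moreover assume "int (s' ''c'' 0) = (C * (\<Prod>c\<in>{c \<in> children v. c < n}. int (s ''S'' c))) mod int M \<and>
    (\<forall>w<n. s' ''S'' w = (if w \<in> children v \<and> w < n then 0 else s ''S'' w))"
  ultimately show "int (s' ''c'' 0) = (C * (\<Prod>c\<in>children v. int (s ''S'' c))) mod int M \<and>
    (\<forall>w<n. s' ''S'' w = (if w \<in> children v then 0 else s ''S'' w))" by simp
qed (use s B L_pos c in simp_all)

lemma run_node_step:
  assumes s: "bounded L B s" "env s" "s ''v'' 0 = v" "v < n" "s ''j'' 0 = pos v"
    and dg: "\<And>i. i < d \<Longrightarrow> s ''dg'' i = x div 5 ^ i mod 5" and x: "x < 5 ^ d"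
    and inv: "dp_inv x D (s ''S'')" "v \<notin> D" "children v \<subseteq> D" "\<And>p. par v = Suc p \<Longrightarrow> p \<notin> D"
    and dvd: "5 ^ pos v dvd Suc x"
  shows "RUN (\<lambda>s'. dp_inv x (insert v D) (s' ''S'')) (n * 18 + 20) node_step s"
proof -
  define \<alpha> where "\<alpha> w = x div 5 ^ pos w mod 5" for w
  have \<alpha>v: "s ''dg'' (pos v) = \<alpha> v" using dg[of "pos v"] pos_less[OF s(4)] by (simp add: \<alpha>_def)
  have z: "int (s ''z'' 0) = kappa5 Y 0 mod int M" and y: "int (s ''y'' 0) = Y" "s ''y'' 0 < M"
    using s(2,4) by (auto simp: env_def kappa5_def)
  define C1 where "C1 = Cond (Eq (Var ''a'') (Num 0))
      (Assign ''c'' (Num 0) (Var ''z'')) (Assign ''c'' (Num 0) (Var ''y''))"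
  show ?thesis
    unfolding node_step_def C1_def[symmetric]
  proof (rule run_Seq_Assign[OF s(1)])
    let ?s = "store s ''a'' (aval (Num 0) s) (aval (Read ''dg'' (Var ''j'')) s)"
    assume b: "bounded L B ?s"
    have b': "bounded L B (store s ''a'' 0 (\<alpha> v))" using b s \<alpha>v by simp
    have cond: "RUN (\<lambda>s'. s' ''c'' 0 = (if \<alpha> v = 0 then s ''z'' 0 else s ''y'' 0)) 2 C1 ?s"
      unfolding C1_def by (intro run_Cond run_Assign) (use b' in \<open>simp_all add: s \<alpha>v L_pos bounded_leB\<close>)
    show "RUN (\<lambda>s'. dp_inv x (insert v D) (s' ''S'')) (n * 18 + 20 - 2)
       (Seq C1 (Seq (For ''u'' (Var ''n'') edge_step) (Seq (For ''w'' (Var ''n'') child_step)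
         (Assign ''S'' (Var ''v'') (Mod (Plus (Read ''S'' (Var ''v'')) (Var ''c'')) (Var ''M'')))))) ?s"
    proof (rule run_Seq[OF cond])
      fix s1 assume b1: "bounded L B s1" and c1: "s1 ''c'' 0 = (if \<alpha> v = 0 then s ''z'' 0 else s ''y'' 0)"
        and fr1: "\<And>x. x \<notin> mods C1 \<Longrightarrow> s1 x = ?s x"
      have m1: "mods C1 = {''c''}" by (simp add: C1_def)
      have env1: "env s1" by (rule env_cong[OF s(2)]) (auto simp: fr1 m1)
      have kap: "int (s1 ''c'' 0) = kappa5 Y (\<alpha> v) mod int M"
        unfolding c1 using z y by (simp add: kappa5_def)
      have s1: "s1 ''v'' 0 = v" "s1 ''a'' 0 = \<alpha> v" "s1 ''S'' = s ''S''" "s1 ''dg'' = s ''dg''"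
        using s \<alpha>v by (simp_all add: fr1 m1)
      show "RUN (\<lambda>s'. dp_inv x (insert v D) (s' ''S'')) (n * 18 + 14)
        (Seq (For ''u'' (Var ''n'') edge_step) (Seq (For ''w'' (Var ''n'') child_step)
         (Assign ''S'' (Var ''v'') (Mod (Plus (Read ''S'' (Var ''v'')) (Var ''c'')) (Var ''M''))))) s1"
      proof (rule run_Seq[OF run_edges[where \<alpha> = \<alpha> and x = x, OF b1 env1 s1(1) s(4) s1(2) _ \<alpha>_def kap]])
        fix s2 assume b2: "bounded L B s2" and c2: "int (s2 ''c'' 0) = local_weight v \<alpha> mod int M"
          and fr2: "\<And>x. x \<notin> mods (For ''u'' (Var ''n'') edge_step) \<Longrightarrow> s2 x = s1 x"
        have env2: "env s2" by (rule env_cong[OF env1]) (auto simp: fr2)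
        have s2: "s2 ''v'' 0 = v" "s2 ''S'' = s ''S''" using s1 by (simp_all add: fr2)
        show "RUN (\<lambda>s'. dp_inv x (insert v D) (s' ''S'')) (n * 8 + 9)
          (Seq (For ''w'' (Var ''n'') child_step)
           (Assign ''S'' (Var ''v'') (Mod (Plus (Read ''S'' (Var ''v'')) (Var ''c'')) (Var ''M'')))) s2"
        proof (rule run_Seq[OF run_children[OF b2 env2 s2(1) s(4) c2]])
          fix s3 assume b3: "bounded L B s3"
            and c3: "int (s3 ''c'' 0) = (local_weight v \<alpha> * (\<Prod>c\<in>children v. int (s2 ''S'' c))) mod int M \<and>
              (\<forall>w<n. s3 ''S'' w = (if w \<in> children v then 0 else s2 ''S'' w))"
            and fr3: "\<And>x. x \<notin> mods (For ''w'' (Var ''n'') child_step) \<Longrightarrow> s3 x = s2 x"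
          have s3: "s3 ''v'' 0 = v" "s3 ''M'' 0 = M"
            using s2 env2 by (simp_all add: fr3 env_def)
          have vv: "v \<notin> children v" using pos_child[of v v] by auto
          have "dp_inv x (insert v D) ((s3 ''S'')(v := (s3 ''S'' v + s3 ''c'' 0) mod M))"
          proof (rule dp_inv_node[OF inv(1) s(4) inv(2-4) dvd])
            show "int (s3 ''c'' 0) =
                (node v (x div 5 ^ pos v) * (\<Prod>c\<in>children v. int (s ''S'' c))) mod int M"
              using c3 unfolding node_digits[OF s(4)] s2(2) \<alpha>_def by simp
          qed (use c3 vv x s(4) in \<open>auto simp: s2(2)\<close>)
          then show "RUN (\<lambda>s'. dp_inv x (insert v D) (s' ''S'')) 1
           (Assign ''S'' (Var ''v'') (Mod (Plus (Read ''S'' (Var ''v'')) (Var ''c'')) (Var ''M''))) s3"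
            using s(4) n_less_L by (intro run_Assign) (simp_all add: b3 s3 mod_le_B)
        qed simp
      qed (use dg s1 in simp_all)
    qed simp
  qed (use L_pos bounded_leB[OF s(1)] in simp_all)
qed

lemma dp_inv_cong:
  assumes "\<And>w. w < n \<Longrightarrow> w \<in> D \<longleftrightarrow> w \<in> D'" "dp_inv x D S"
  shows "dp_inv x D' S"
proof -
  have "lower x D w = lower x D' w" if "w < n" for w
    using assms(1)[of "par w - 1"] par_Suc[OF that] by (cases "par w") (auto simp: lower_def)
  moreover have "upper x D w = upper x D' w" if "w < n" for w
    using assms(1)[OF that] by (simp add: upper_def)
  ultimately show ?thesis using assms(2) by (simp add: dp_inv_def)
qed

text \<open>Vertices of the same level are never parent and child, so they may be taken in the order
  of their indices.\<close>

lemma run_level_step: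
  assumes s: "bounded L B s" "env s" "s ''j'' 0 = j"
    and dg: "\<And>i. i < d \<Longrightarrow> s ''dg'' i = x div 5 ^ i mod 5" and x: "x < 5 ^ d"
    and inv: "dp_inv x {w. pos w < j} (s ''S'')" and dvd: "5 ^ j dvd Suc x"
  shows "RUN (\<lambda>s'. dp_inv x {w. pos w < Suc j} (s' ''S'')) (n * (n * 18 + 25) + 3) level_step s"
  unfolding level_step_def
proof (rule run_For[where m = n and T = "n * 18 + 21"
      and J = "\<lambda>k s'. dp_inv x {w. pos w < j \<or> pos w = j \<and> w < k} (s' ''S'')"])
  show "aval (Var ''n'') s = n" using s(2) by (simp add: env_def)
next
  fix k s' assume k: "k < n" and b: "bounded L B s'"
    and fr: "\<And>x. x \<noteq> ''v'' \<Longrightarrow> x \<notin> mods (Cond (Eq (Minus (Var ''d'') (Read ''dep'' (Var ''v''))) (Var ''j''))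
       node_step SKIP) \<Longrightarrow> s' x = s x" and v: "s' ''v'' 0 = k"
    and J: "dp_inv x {w. pos w < j \<or> pos w = j \<and> w < k} (s' ''S'')"
  have env': "env s'" by (rule env_cong[OF s(2)]) (auto simp: fr)
  have j: "s' ''j'' 0 = j" "\<And>i. i < d \<Longrightarrow> s' ''dg'' i = x div 5 ^ i mod 5" using s dg by (simp_all add: fr)
  have c: "bval (Eq (Minus (Var ''d'') (Read ''dep'' (Var ''v''))) (Var ''j'')) s' \<longleftrightarrow> pos k = j"
    using env' k v j by (simp add: env_def pos_def)
  show "RUN (\<lambda>s'. dp_inv x {w. pos w < j \<or> pos w = j \<and> w < Suc k} (s' ''S'')) (n * 18 + 21)
     (Cond (Eq (Minus (Var ''d'') (Read ''dep'' (Var ''v''))) (Var ''j'')) node_step SKIP) s'"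
  proof (rule run_Cond[OF b])
    assume "bval (Eq (Minus (Var ''d'') (Read ''dep'' (Var ''v''))) (Var ''j'')) s'"
    then have pk: "pos k = j" using c by simp
    have eq: "insert k {w. pos w < j \<or> pos w = j \<and> w < k} = {w. pos w < j \<or> pos w = j \<and> w < Suc k}"
      using pk by auto
    have "RUN (\<lambda>s'. dp_inv x (insert k {w. pos w < j \<or> pos w = j \<and> w < k}) (s' ''S''))
        (n * 18 + 20) node_step s'"
    proof (rule run_node_step[OF b env' v k _ j(2) x J])
      show "children k \<subseteq> {w. pos w < j \<or> pos w = j \<and> w < k}" using pos_child[of _ k] pk by auto
      fix p assume "par k = Suc p"
      then have "pos p = Suc (pos k)" using pos_child[of k p] k by (auto simp: children_def)
      then show "p \<notin> {w. pos w < j \<or> pos w = j \<and> w < k}" using pk by auto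
    qed (use j pk dvd in auto)
    then show "RUN (\<lambda>s'. dp_inv x {w. pos w < j \<or> pos w = j \<and> w < Suc k} (s' ''S''))
        (n * 18 + 21 - 1) node_step s'" unfolding eq by (rule run_mono) auto
  next
    assume "\<not> bval (Eq (Minus (Var ''d'') (Read ''dep'' (Var ''v''))) (Var ''j'')) s'"
    then have "pos k \<noteq> j" using c by simp
    then have "dp_inv x {w. pos w < j \<or> pos w = j \<and> w < Suc k} (s' ''S'')"
      using J by (elim dp_inv_cong[rotated]) (auto simp: less_Suc_eq)
    then show "RUN (\<lambda>s'. dp_inv x {w. pos w < j \<or> pos w = j \<and> w < Suc k} (s' ''S''))
        (n * 18 + 21 - 1) SKIP s'" using b by (intro run_SKIP)
  qed simp
next
  fix s' assume "dp_inv x {w. pos w < j \<or> pos w = j \<and> w < n} (s' ''S'')"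
  then show "dp_inv x {w. pos w < Suc j} (s' ''S'')"
    by (elim dp_inv_cong[rotated]) auto
qed (use s B L_pos inv in simp_all)

definition round_time :: nat where
  "round_time = n * (n * (n * 18 + 25) + 17) + 11"

lemma run_round_step:
  assumes s: "bounded L B s" "env s" "s ''x'' 0 = x" and x: "x < 5 ^ d"
    and inv: "dp_inv x {} (s ''S'')"
  shows "RUN (\<lambda>s'. dp_inv (Suc x) {} (s' ''S'')) round_time round_step s"
  unfolding round_step_def
proof (rule run_Seq_Assign[OF s(1)])
  let ?s = "store s ''q'' (aval (Num 0) s) (aval (Var ''x'') s)"
  let ?dg = "Seq (Assign ''dg'' (Var ''j'') (Mod (Var ''q'') (Num 5)))
                 (Assign ''q'' (Num 0) (Div (Var ''q'') (Num 5)))"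
  let ?lv = "Seq (Cond (Eq (Mod (Plus (Var ''x'') (Num 1)) (Var ''p'')) (Num 0)) level_step SKIP)
                 (Assign ''p'' (Num 0) (Times (Var ''p'') (Num 5)))"
  assume b: "bounded L B ?s"
  have d: "s ''d'' 0 = d" using s(2) by (simp add: env_def)
  have tm: "d * 7 \<le> n * 7" using dn by simp
  have digits: "RUN (\<lambda>s'. \<forall>i<d. s' ''dg'' i = x div 5 ^ i mod 5) (d * 7 + 3) (For ''j'' (Var ''d'') ?dg) ?s"
  proof (rule run_For[where m = d and T = 3 and
        J = "\<lambda>k s'. (\<forall>i<k. s' ''dg'' i = x div 5 ^ i mod 5) \<and> s' ''q'' 0 = x div 5 ^ k"])
    fix k s' assume k: "k < d" and b': "bounded L B s'" and j: "s' ''j'' 0 = k"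
      and J: "(\<forall>i<k. s' ''dg'' i = x div 5 ^ i mod 5) \<and> s' ''q'' 0 = x div 5 ^ k"
    have q: "x div 5 ^ k \<le> B" using bounded_leB[OF b', of "''q''" 0] J by simp
    have "x div 5 ^ k mod 5 \<le> B" "x div 5 ^ k div 5 \<le> B"
      using q by (auto intro: le_trans[OF mod_less_eq_dividend] le_trans[OF div_le_dividend])
    moreover have "x div 5 ^ k div 5 = x div (5 * 5 ^ k)" by (subst mult.commute) (rule div_mult2_eq[symmetric])
    ultimately show "RUN (\<lambda>s'. (\<forall>i<Suc k. s' ''dg'' i = x div 5 ^ i mod 5) \<and> s' ''q'' 0 = x div 5 ^ Suc k) 3 ?dg s'"
      using J k d_less_L by (intro run_Seq_Assign run_Assign) (simp_all add: b' j less_Suc_eq L_pos)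
  qed (use s d b L_pos dn B in \<open>simp_all\<close>)
  show "RUN (\<lambda>s'. dp_inv (Suc x) {} (s' ''S'')) (round_time - 2)
    (Seq (For ''j'' (Var ''d'') ?dg) (Seq (Assign ''p'' (Num 0) (Num 1)) (For ''j'' (Var ''d'') ?lv))) ?s"
  proof (rule run_Seq[OF digits])
    fix s1 assume b1: "bounded L B s1" and dg1: "\<forall>i<d. s1 ''dg'' i = x div 5 ^ i mod 5"
      and fr1: "\<And>y. y \<notin> mods (For ''j'' (Var ''d'') ?dg) \<Longrightarrow> s1 y = ?s y"
    show "RUN (\<lambda>s'. dp_inv (Suc x) {} (s' ''S'')) (n * (10 + n * (n * 18 + 25)) + 5)
      (Seq (Assign ''p'' (Num 0) (Num 1)) (For ''j'' (Var ''d'') ?lv)) s1"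
    proof (rule run_Seq_Assign[OF b1])
      let ?s1 = "store s1 ''p'' (aval (Num 0) s1) (aval (Num 1) s1)"
      assume b2: "bounded L B ?s1"
      have "s1 ''d'' 0 = d" "s1 ''S'' = s ''S''" by (simp_all add: fr1 d)
      then show "RUN (\<lambda>s'. dp_inv (Suc x) {} (s' ''S'')) (n * (10 + n * (n * 18 + 25)) + 5 - 2)
        (For ''j'' (Var ''d'') ?lv) ?s1"
      proof (intro run_For[where m = d and T = "n * (n * 18 + 25) + 6" and
          J = "\<lambda>k s'. dp_inv x {w. pos w < k} (s' ''S'') \<and> s' ''p'' 0 = 5 ^ k"], goal_cases)
        \<comment> \<open>Goals 9 and 10 are the premises \<open>body\<close> and
          \<open>post\<close> of \<open>run_For\<close>; the remaining goals are its side
          conditions.\<close>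
        case (9 k s')
        note k = 9(3) and b' = 9(4) and fr = 9(5) and j = 9(6) and J = 9(7)
        have env': "env s'" by (rule env_cong[OF s(2)]) (auto simp: fr fr1)
        have x': "s' ''x'' 0 = x" using s(3) by (simp add: fr fr1)
        have dg': "s' ''dg'' i = x div 5 ^ i mod 5" if "i < d" for i
          using dg1 that by (simp add: fr)
        show ?case
        proof (rule run_Seq[where R = "\<lambda>s'. dp_inv x {w. pos w < Suc k} (s' ''S'')"
              and ?t1.0 = "n * (n * 18 + 25) + 4" and ?t2.0 = 1])
          show "RUN (\<lambda>s'. dp_inv x {w. pos w < Suc k} (s' ''S'')) (n * (n * 18 + 25) + 4)
            (Cond (Eq (Mod (Plus (Var ''x'') (Num 1)) (Var ''p'')) (Num 0)) level_step SKIP) s'"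
          proof (rule run_Cond[OF b'])
            assume "bval (Eq (Mod (Plus (Var ''x'') (Num 1)) (Var ''p'')) (Num 0)) s'"
            then have "5 ^ k dvd Suc x" using x' J by (simp add: dvd_eq_mod_eq_0)
            then have "RUN (\<lambda>s'. dp_inv x {w. pos w < Suc k} (s' ''S'')) (n * (n * 18 + 25) + 3) level_step s'"
              using J by (intro run_level_step[OF b' env' j dg' x]) auto
            then show "RUN (\<lambda>s'. dp_inv x {w. pos w < Suc k} (s' ''S'')) (n * (n * 18 + 25) + 4 - 1) level_step s'"
              by (rule run_mono) auto
          next
            assume "\<not> bval (Eq (Mod (Plus (Var ''x'') (Num 1)) (Var ''p'')) (Num 0)) s'"
            then have "\<not> 5 ^ k dvd Suc x" using x' J by (simp add: dvd_eq_mod_eq_0)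
            then show "RUN (\<lambda>s'. dp_inv x {w. pos w < Suc k} (s' ''S'')) (n * (n * 18 + 25) + 4 - 1) SKIP s'"
              using b' J dp_inv_skip by (intro run_SKIP) auto
          qed simp
        next
          fix s2 assume b2: "bounded L B s2" and inv2: "dp_inv x {w. pos w < Suc k} (s2 ''S'')"
            and fr2: "\<And>y. y \<notin> mods (Cond (Eq (Mod (Plus (Var ''x'') (Num 1)) (Var ''p'')) (Num 0)) level_step SKIP) \<Longrightarrow> s2 y = s' y"
          have p: "s2 ''p'' 0 = 5 ^ k" using J by (simp add: fr2)
          have "5 ^ Suc k \<le> (5 :: nat) ^ d" using k by (intro power_increasing) auto
          then have "5 ^ k * 5 \<le> B" using B(3) by simp
          then show "RUN (\<lambda>s'. dp_inv x {w. pos w < Suc k} (s' ''S'') \<and> s' ''p'' 0 = 5 ^ Suc k) 1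
              (Assign ''p'' (Num 0) (Times (Var ''p'') (Num 5))) s2"
            using inv2 by (intro run_Assign) (simp_all add: b2 p L_pos)
        qed simp
      next
        case (10 s')
        then show ?case using dp_inv_round by blast
      qed (use b2 L_pos dn B inv tm in \<open>simp_all\<close>)
    qed (use L_pos B M in simp_all)
  qed (use tm in \<open>simp add: round_time_def algebra_simps\<close>)
qed (use L_pos bounded_leB[OF s(1)] in \<open>simp_all add: round_time_def\<close>)

lemma run_main_loop:
  assumes s: "bounded L B s" "env s" "s ''X'' 0 = 5 ^ d" and S: "\<And>v. v < n \<Longrightarrow> s ''S'' v = 0"
  shows "RUN (\<lambda>s'. dp_inv (5 ^ d) {} (s' ''S'')) (5 ^ d * (round_time + 4) + 3) main_loop s"
  unfolding main_loop_def
proof (rule run_For[where m = "5 ^ d" and T = round_time and J = "\<lambda>k s'. dp_inv k {} (s' ''S'')"])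
  fix k s' assume k: "k < 5 ^ d" and b: "bounded L B s'"
    and fr: "\<And>x. x \<noteq> ''x'' \<Longrightarrow> x \<notin> mods round_step \<Longrightarrow> s' x = s x" and x: "s' ''x'' 0 = k"
    and J: "dp_inv k {} (s' ''S'')"
  have env': "env s'" by (rule env_cong[OF s(2)]) (auto simp: fr)
  show "RUN (\<lambda>s'. dp_inv (Suc k) {} (s' ''S'')) round_time round_step s'"
    by (rule run_round_step[OF b env' x k J])
next
  show "dp_inv 0 {} (s ''S'')" using S by (simp add: dp_inv_def upper_def)
qed (use s B L_pos in simp_all)

lemma run_root_product:
  assumes s: "bounded L B s" "env s" and S: "\<And>v. v < n \<Longrightarrow> par v = 0 \<Longrightarrow> int (s ''S'' v) = val v 0 mod int M"
  shows "RUN (\<lambda>s'. int (s' ''Z'' 0) = partition5 {..<n} E Y T mod int M) (n * 6 + 5) root_product s"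
  unfolding root_product_def
proof (rule run_Seq_Assign[OF s(1)])
  let ?s = "store s ''Z'' (aval (Num 0) s) (aval (Num 1) s)"
  let ?body = "Cond (Eq (Read ''parent'' (Var ''v'')) (Num 0))
         (Assign ''Z'' (Num 0) (Mod (Times (Var ''Z'') (Read ''S'' (Var ''v''))) (Var ''M'')))
         SKIP"
  assume b: "bounded L B ?s"
  show "RUN (\<lambda>s'. int (s' ''Z'' 0) = partition5 {..<n} E Y T mod int M) (n * 6 + 5 - 2) (For ''v'' (Var ''n'') ?body) ?s"
  proof (rule run_For[where m = n and T = 2 and
        J = "\<lambda>k s'. int (s' ''Z'' 0) = (\<Prod>v\<in>{v. v < k \<and> par v = 0}. val v 0) mod int M"])
    fix k s' assume k: "k < n" and b': "bounded L B s'"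
      and fr: "\<And>x. x \<noteq> ''v'' \<Longrightarrow> x \<notin> mods ?body \<Longrightarrow> s' x = ?s x" and v: "s' ''v'' 0 = k"
      and J: "int (s' ''Z'' 0) = (\<Prod>v\<in>{v. v < k \<and> par v = 0}. val v 0) mod int M"
    have p: "s' ''parent'' k = par k" "s' ''M'' 0 = M" "s' ''S'' k = s ''S'' k"
      using s(2) k by (auto simp: fr env_def)
    have st: "{v. v < Suc k \<and> par v = 0} =
        (if par k = 0 then insert k {v. v < k \<and> par v = 0} else {v. v < k \<and> par v = 0})"
      by (auto simp: less_Suc_eq)
    have "int (s' ''Z'' 0 * s ''S'' k mod M) = ((\<Prod>v\<in>{v. v < k \<and> par v = 0}. val v 0) * val k 0) mod int M"
      if "par k = 0"
      by (simp only: of_nat_mod of_nat_mult J S[OF k that] mod_mult_eq)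
    then have "int (s' ''Z'' 0 * s ''S'' k mod M) = (val k 0 * (\<Prod>v\<in>{v. v < k \<and> par v = 0}. val v 0)) mod int M"
      if "par k = 0" using that by (simp only: mult.commute)
    then show "RUN (\<lambda>s'. int (s' ''Z'' 0) = (\<Prod>v\<in>{v. v < Suc k \<and> par v = 0}. val v 0) mod int M) 2 ?body s'"
      unfolding st by (intro run_Cond run_Assign run_SKIP) (simp_all add: b' v p L_pos mod_le_B J)
  next
    fix s' :: state assume "int (s' ''Z'' 0) = (\<Prod>v\<in>{v. v < n \<and> par v = 0}. val v 0) mod int M"
    then show "int (s' ''Z'' 0) = partition5 {..<n} E Y T mod int M" by (simp add: partition5_forest)
  qed (use s b B L_pos M in \<open>simp_all add: env_def\<close>)
qed (use L_pos B M in simp_all)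

end

section \<open>Setup and output phases\<close>

text \<open>The machine lacks exponentiation, and the loop takes as many rounds as the value of the
  exponent. The exponents therefore have to be polynomial in \<open>n\<close>, while the powers only
  need polynomially many bits.\<close>

definition Raise :: "string \<Rightarrow> aexp \<Rightarrow> aexp \<Rightarrow> com" where
  "Raise x b e = Seq (Assign x (Num 0) (Num 1)) (For ''i'' e (Assign x (Num 0) (Times (Var x) b)))"

lemma mods_Raise [simp]: "mods (Raise x b e) = {''i'', x}"
  by (auto simp: Raise_def)

lemma run_Raise:
  assumes s: "bounded L B s" "0 < L" and e: "aval e s = m" "m \<le> B" and b: "aval b s = \<beta>"
    and x: "x \<noteq> ''i''" "avars e \<inter> {''i'', x} = {}" "avars b \<inter> {''i'', x} = {}"
    and B: "\<And>j. j \<le> m \<Longrightarrow> \<beta> ^ j \<le> B" and t: "m * 5 + 5 \<le> t"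
  shows "run (bounded L B) (\<lambda>s'. s' x 0 = \<beta> ^ m) t (Raise x b e) s"
  unfolding Raise_def
proof (rule run_Seq_Assign[OF s(1)])
  let ?s = "store s x (aval (Num 0) s) (aval (Num 1) s)"
  assume b': "bounded L B ?s"
  show "run (bounded L B) (\<lambda>s'. s' x 0 = \<beta> ^ m) (t - 2) (For ''i'' e (Assign x (Num 0) (Times (Var x) b))) ?s"
  proof (rule run_For[where T = 1 and m = m and J = "\<lambda>k s'. s' x 0 = \<beta> ^ k"])
    have "aval e ?s = aval e s" using x by (intro aval_cong) auto
    then show "aval e ?s = m" using e by simp
  next
    fix k s' assume k: "k < m" and bd: "bounded L B s'"
      and fr: "\<And>y. y \<noteq> ''i'' \<Longrightarrow> y \<notin> mods (Assign x (Num 0) (Times (Var x) b)) \<Longrightarrow> s' y = ?s y"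
      and J: "s' x 0 = \<beta> ^ k"
    have "aval b s' = aval b s" using x(3) by (intro aval_cong, subst fr) auto
    moreover have "\<beta> ^ k * \<beta> \<le> B" using B[of "Suc k"] k by (simp add: mult.commute)
    ultimately show "run (bounded L B) (\<lambda>s'. s' x 0 = \<beta> ^ Suc k) 1 (Assign x (Num 0) (Times (Var x) b)) s'"
      using bd J s(2) b by (intro run_Assign) (simp_all add: mult.commute)
  qed (use b' s x e t in auto)
qed (use s B[of 0] t in simp_all)

text \<open>\<open>u\<close> is a vertex plus one, as in the parent pointers, and 0 beyond the root.
  The walk always takes \<open>n\<close> rounds and idles once \<open>u\<close> is 0.\<close>

definition depth_phase :: com where
  "depth_phase = For ''v'' (Var ''n'')
     (Seq (Assign ''u'' (Num 0) (Plus (Var ''v'') (Num 1)))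
       (Seq (For ''j'' (Var ''n'')
              (Cond (Less (Num 0) (Var ''u''))
                (Seq (Assign ''dep'' (Var ''v'') (Plus (Read ''dep'' (Var ''v'')) (Num 1)))
                     (Assign ''u'' (Num 0) (Read ''parent'' (Minus (Var ''u'') (Num 1)))))
                SKIP))
         (Cond (Less (Var ''d'') (Read ''dep'' (Var ''v'')))
           (Assign ''d'' (Num 0) (Read ''dep'' (Var ''v''))) SKIP)))"

definition max_depth :: "(nat \<Rightarrow> nat) \<Rightarrow> nat \<Rightarrow> nat" where
  "max_depth dep n = Max (insert 0 (dep ` {..<n}))"

lemma max_depth_Suc: "max_depth dep (Suc k) = max (dep k) (max_depth dep k)"
  unfolding max_depth_def lessThan_Suc image_insert insert_commute[of 0] by (rule Max_insert) auto

lemma run_depth_phase: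
  assumes par: "\<And>v. v < n \<Longrightarrow> par v \<le> n"
    and dep: "\<And>v. v < n \<Longrightarrow> dep v = (if par v = 0 then 1 else Suc (dep (par v - 1)))"
    and dep_n: "\<And>v. v < n \<Longrightarrow> dep v \<le> n"
    and s: "bounded L B s" "s ''n'' 0 = n" "\<And>v. v < n \<Longrightarrow> s ''parent'' v = par v"
      "\<And>v. v < n \<Longrightarrow> s ''dep'' v = 0" "s ''d'' 0 = 0"
    and LB: "n < L" "Suc n \<le> B"
  shows "run (bounded L B) (\<lambda>s'. (\<forall>v<n. s' ''dep'' v = dep v) \<and> s' ''d'' 0 = max_depth dep n)
     (n * (n * 8 + 12) + 3) depth_phase s"
  unfolding depth_phase_def
proof (rule run_For[where m = n and T = "n * 8 + 8" and J = "\<lambda>k s'. (\<forall>v<k. s' ''dep'' v = dep v) \<and>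
     (\<forall>v<n. k \<le> v \<longrightarrow> s' ''dep'' v = 0) \<and> s' ''d'' 0 = max_depth dep k"])
  let ?in = "Cond (Less (Num 0) (Var ''u''))
      (Seq (Assign ''dep'' (Var ''v'') (Plus (Read ''dep'' (Var ''v'')) (Num 1)))
           (Assign ''u'' (Num 0) (Read ''parent'' (Minus (Var ''u'') (Num 1))))) SKIP"
  let ?mx = "Cond (Less (Var ''d'') (Read ''dep'' (Var ''v''))) (Assign ''d'' (Num 0) (Read ''dep'' (Var ''v''))) SKIP"
  let ?body = "Seq (Assign ''u'' (Num 0) (Plus (Var ''v'') (Num 1))) (Seq (For ''j'' (Var ''n'') ?in) ?mx)"
  fix k s1 assume k: "k < n" and b1: "bounded L B s1" and v1: "s1 ''v'' 0 = k"
    and fr1: "\<And>x. x \<noteq> ''v'' \<Longrightarrow> x \<notin> mods ?body \<Longrightarrow> s1 x = s x"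
    and J1: "(\<forall>v<k. s1 ''dep'' v = dep v) \<and> (\<forall>v<n. k \<le> v \<longrightarrow> s1 ''dep'' v = 0) \<and> s1 ''d'' 0 = max_depth dep k"
  have n1: "s1 ''n'' 0 = n" and p1: "\<And>v. v < n \<Longrightarrow> s1 ''parent'' v = par v"
    using s by (simp_all add: fr1)
  show "run (bounded L B) (\<lambda>s'. (\<forall>v<Suc k. s' ''dep'' v = dep v) \<and>
     (\<forall>v<n. Suc k \<le> v \<longrightarrow> s' ''dep'' v = 0) \<and> s' ''d'' 0 = max_depth dep (Suc k)) (n * 8 + 8) ?body s1"
  proof (rule run_Seq_Assign[OF b1])
    let ?s = "store s1 ''u'' (aval (Num 0) s1) (aval (Plus (Var ''v'') (Num 1)) s1)"
    assume b: "bounded L B ?s"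
    \<comment> \<open>The vertices counted so far and those ahead add up to the depth. While the
      walk is under way exactly \<open>j\<close> are counted, so it has ended after \<open>n\<close>
      rounds, as no depth exceeds \<open>n\<close>.\<close>
    define I where "I = (\<lambda>j (s' :: state). s' ''dep'' k + (if s' ''u'' 0 = 0 then 0 else dep (s' ''u'' 0 - 1)) = dep k \<and>
      s' ''u'' 0 \<le> n \<and> (s' ''u'' 0 = 0 \<or> s' ''dep'' k = j) \<and> (\<forall>w. w \<noteq> k \<longrightarrow> s' ''dep'' w = s1 ''dep'' w))"
    have walk: "run (bounded L B) (\<lambda>s'. s' ''dep'' k = dep k \<and> (\<forall>w. w \<noteq> k \<longrightarrow> s' ''dep'' w = s1 ''dep'' w))
        (n * 8 + 3) (For ''j'' (Var ''n'') ?in) ?s"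
    proof (rule run_For[where m = n and T = 4 and J = I])
      show "I 0 ?s" using J1 k v1 by (simp add: I_def)
    next
      fix j s' assume j: "j < n" and b': "bounded L B s'" and I: "I j s'"
        and fr: "\<And>x. x \<noteq> ''j'' \<Longrightarrow> x \<notin> mods ?in \<Longrightarrow> s' x = ?s x"
      have v: "s' ''v'' 0 = k" "\<And>v. v < n \<Longrightarrow> s' ''parent'' v = par v" using v1 p1 by (simp_all add: fr)
      have le: "s' ''dep'' k \<le> dep k" using I by (simp add: I_def)
      show "run (bounded L B) (I (Suc j)) 4 ?in s'"
      proof (cases "s' ''u'' 0")
        case 0
        then show ?thesis using I by (intro run_Cond run_SKIP) (simp_all add: b' I_def)
      next
        case (Suc p)
        then have p: "p < n" using I by (simp add: I_def)
        have "Suc (s' ''dep'' k) \<le> B" using LB dep_n[OF k] le by simp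
        then show ?thesis using I Suc dep[OF p] par[OF p] k LB
          by (intro run_Cond run_Seq_Assign run_Assign)
            (auto simp: b' I_def v p intro: le_trans)
      qed
    next
      fix s' :: state assume "I n s'"
      moreover from this have "s' ''u'' 0 = 0 \<or> s' ''u'' 0 - 1 < n" by (auto simp: I_def)
      moreover have "0 < dep w" if "w < n" for w using dep[OF that] by simp
      ultimately show "s' ''dep'' k = dep k \<and> (\<forall>w. w \<noteq> k \<longrightarrow> s' ''dep'' w = s1 ''dep'' w)"
        using dep_n[OF k] by (fastforce simp: I_def split: if_splits)
    qed (use b LB n1 in \<open>auto simp: I_def split: if_splits\<close>)
    show "run (bounded L B) (\<lambda>s'. (\<forall>v<Suc k. s' ''dep'' v = dep v) \<and>
      (\<forall>v<n. Suc k \<le> v \<longrightarrow> s' ''dep'' v = 0) \<and> s' ''d'' 0 = max_depth dep (Suc k)) (n * 8 + 8 - 2)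
      (Seq (For ''j'' (Var ''n'') ?in) ?mx) ?s"
    proof (rule run_Seq[OF walk])
      fix s2 assume b2: "bounded L B s2"
        and d2: "s2 ''dep'' k = dep k \<and> (\<forall>w. w \<noteq> k \<longrightarrow> s2 ''dep'' w = s1 ''dep'' w)"
        and fr2: "\<And>x. x \<notin> mods (For ''j'' (Var ''n'') ?in) \<Longrightarrow> s2 x = ?s x"
      have v2: "s2 ''v'' 0 = k" "s2 ''d'' 0 = max_depth dep k" using v1 J1 by (simp_all add: fr2)
      have dB: "dep k \<le> B" using dep_n[OF k] LB by simp
      show "run (bounded L B) (\<lambda>s'. (\<forall>v<Suc k. s' ''dep'' v = dep v) \<and>
        (\<forall>v<n. Suc k \<le> v \<longrightarrow> s' ''dep'' v = 0) \<and> s' ''d'' 0 = max_depth dep (Suc k)) 2 ?mx s2"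
        using J1 d2 LB
        by (intro run_Cond run_Assign run_SKIP) (auto simp: b2 v2 max_depth_Suc less_Suc_eq dB)
    qed simp
  qed (use LB v1 k in simp_all)
next
  show "(\<forall>v<0. s ''dep'' v = dep v) \<and> (\<forall>v<n. 0 \<le> v \<longrightarrow> s ''dep'' v = 0) \<and> s ''d'' 0 = max_depth dep 0"
    using s by (simp add: max_depth_def)
qed (use s LB in auto)

text \<open>A weight range that is a power of two can be sampled exactly uniformly with fair bits.
  It has to be at least twice the number \<open>n * n\<close> of matrix positions for the isolation
  lemma to give error 1/2.\<close>

definition wbits :: "nat \<Rightarrow> nat" where
  "wbits n = (LEAST b. 2 * (n * n) \<le> 2 ^ b)"

definition wrange :: "nat \<Rightarrow> nat" where
  "wrange n = 2 ^ wbits n"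

lemma wbits_witness: "2 * (n * n) \<le> 2 ^ (2 * n + 1)"
proof -
  have "n < 2 ^ n" by (rule less_exp)
  then have "n * n \<le> 2 ^ n * 2 ^ n" by (intro mult_mono) auto
  then show ?thesis by (simp add: mult_2 power_add)
qed

lemma wbits_le: "wbits n \<le> 2 * n + 1"
  unfolding wbits_def using wbits_witness by (rule Least_le)

lemma wrange_ge: "2 * (n * n) \<le> wrange n"
  unfolding wrange_def wbits_def using wbits_witness by (rule LeastI)

lemma wbits_less: "b < wbits n \<Longrightarrow> 2 ^ b < 2 * (n * n)"
  unfolding wbits_def by (drule not_less_Least) simp

lemma wrange_pos: "0 < wrange n"
  by (simp add: wrange_def)

text \<open>Minimality of the exponent loses at most a factor 2; the summand 1 covers
  \<open>n = 0\<close>.\<close>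

lemma wrange_le: "wrange n \<le> 4 * (n * n) + 1"
proof (cases "wbits n")
  case (Suc b)
  then have "2 ^ b < 2 * (n * n)" by (intro wbits_less) simp
  then show ?thesis using Suc by (simp add: wrange_def)
qed (simp add: wrange_def)

definition range_phase :: com where
  "range_phase =
     Seq (Assign ''W'' (Num 0) (Num 1))
      (Seq (Assign ''b'' (Num 0) (Num 0))
        (For ''i'' (Plus (Times (Num 2) (Var ''n'')) (Num 1))
          (Cond (Less (Var ''W'') (Times (Num 2) (Times (Var ''n'') (Var ''n''))))
            (Seq (Assign ''W'' (Num 0) (Times (Num 2) (Var ''W'')))
                 (Assign ''b'' (Num 0) (Plus (Var ''b'') (Num 1))))
            SKIP)))"

lemma run_range_phase:
  assumes s: "bounded L B s" "s ''n'' 0 = n" and L: "0 < L" and B: "2 * n + 1 \<le> B" "wrange n \<le> B"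
  shows "run (bounded L B) (\<lambda>s'. s' ''W'' 0 = wrange n \<and> s' ''b'' 0 = wbits n)
    ((2 * n + 1) * 8 + 7) range_phase s"
  unfolding range_phase_def
proof (intro run_Seq_Assign run_For[where m = "2 * n + 1" and T = 4 and
    J = "\<lambda>k s'. s' ''b'' 0 = min k (wbits n) \<and> s' ''W'' 0 = 2 ^ s' ''b'' 0"], goal_cases)
  \<comment> \<open>The two assignments contribute four side conditions each, so goal 17 is the
    premise \<open>body\<close> of \<open>run_For\<close>.\<close>
  case (17 k s')
  note k = 17(3) and b = 17(4) and fr = 17(5) and J = 17(7)
  have n: "s' ''n'' 0 = n" using s by (simp add: fr)
  have W: "s' ''W'' 0 < 2 * (n * n) \<longleftrightarrow> k < wbits n"
  proof (cases "k < wbits n")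
    case True
    then show ?thesis using J wbits_less by (simp add: min_def)
  next
    case False
    then show ?thesis using J wrange_ge[of n] by (simp add: wrange_def min_def)
  qed
  have "2 * 2 ^ k \<le> B" if "k < wbits n"
  proof -
    have "2 ^ Suc k \<le> wrange n" unfolding wrange_def using that by (intro power_increasing) auto
    then show ?thesis using B(2) by simp
  qed
  then show ?case using J k B W
    by (intro run_Cond run_Seq_Assign run_Assign run_SKIP) (simp_all add: b n L W)
qed (use s L B wbits_le[of n] in \<open>auto simp: wrange_def\<close>)

text \<open>\<open>wA\<close>, \<open>wD\<close>, \<open>wt\<close> and \<open>wM\<close> are the
  constants \<open>A\<close>, \<open>A'\<close>, \<open>t\<close> and \<open>M\<close> of
  \<open>isolating\<close> as functions of \<open>n\<close>.\<close>

definition wA :: "nat \<Rightarrow> nat" where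
  "wA n = n * n * wrange n + 1"

definition wD :: "nat \<Rightarrow> nat" where
  "wD n = wA n * (n * n + 1)"

definition wt :: "nat \<Rightarrow> nat" where
  "wt n = 2 ^ ((n + 1) * (n + 1))"

definition wM :: "nat \<Rightarrow> nat" where
  "wM n = wt n ^ (wD n * (n + 1))"

definition draw_phase :: com where
  "draw_phase = Seq (Assign ''R'' (Num 0) (Num 0))
     (For ''i'' (Times (Times (Var ''n'') (Var ''n'')) (Var ''b''))
       (Seq (Flip ''r'' (Num 0))
            (Assign ''R'' (Num 0) (Plus (Times (Num 2) (Var ''R'')) (Var ''r'')))))"

text \<open>\<open>z\<close> is the residue of \<open>2 - 4 * y\<close>, written with
  \<open>4 * (M - 1)\<close> in place of -4 to avoid truncated subtraction.\<close>

definition const_phase :: com where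
  "const_phase =
     Seq (Raise ''t'' (Num 2) (Times (Plus (Var ''n'') (Num 1)) (Plus (Var ''n'') (Num 1))))
      (Seq (Assign ''A'' (Num 0) (Plus (Times (Times (Var ''n'') (Var ''n'')) (Var ''W'')) (Num 1)))
      (Seq (Assign ''D'' (Num 0) (Times (Var ''A'') (Plus (Times (Var ''n'') (Var ''n'')) (Num 1))))
      (Seq (Raise ''M'' (Var ''t'') (Times (Var ''D'') (Plus (Var ''n'') (Num 1))))
      (Seq (Raise ''y'' (Var ''t'') (Var ''D''))
        (Assign ''z'' (Num 0)
          (Mod (Plus (Num 2) (Times (Times (Num 4) (Minus (Var ''M'') (Num 1))) (Var ''y''))) (Var ''M'')))))))"

definition weight_phase :: com where
  "weight_phase = For ''v'' (Times (Var ''n'') (Var ''n''))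
     (Seq (Raise ''q'' (Var ''t'') (Plus (Mod (Var ''R'') (Var ''W'')) (Var ''A'')))
       (Seq (Assign ''T'' (Var ''v'') (Var ''q''))
            (Assign ''R'' (Num 0) (Div (Var ''R'') (Var ''W'')))))"

text \<open>For \<open>l > n\<close> the zero in \<open>result\<close> stands; this also keeps the
  number of divisions polynomial. Otherwise the divisions bring the digit for weight 0,
  \<open>l\<close> edges and \<open>l\<close> vertices to the front, and it is tested together with
  the following ones.\<close>

definition output_phase :: com where
  "output_phase =
     Seq (Cond (Less (Var ''k'') (Var ''n'')) (Assign ''m'' (Num 0) (Var ''k'')) (Assign ''m'' (Num 0) (Var ''n'')))
      (Seq (Raise ''Q'' (Num 2) (Plus (Plus (Var ''n'') (Var ''m'')) (Num 1)))
        (Cond (Less (Var ''n'') (Var ''l'')) SKIP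
          (Seq (For ''i'' (Times (Plus (Var ''A'') (Var ''D'')) (Var ''l''))
                 (Assign ''Z'' (Num 0) (Div (Var ''Z'') (Var ''t''))))
            (For ''i'' (Var ''A'')
              (Seq (Cond (Eq (Mod (Mod (Var ''Z'') (Var ''t'')) (Var ''Q'')) (Num 0)) SKIP
                      (Assign ''result'' (Num 0) (Num 1)))
                   (Assign ''Z'' (Num 0) (Div (Var ''Z'') (Var ''t''))))))))"

lemma mods_depth_phase [simp]: "mods depth_phase = {''v'', ''u'', ''j'', ''dep'', ''d''}"
  by (auto simp: depth_phase_def)
lemma mods_range_phase [simp]: "mods range_phase = {''W'', ''b'', ''i''}"
  by (auto simp: range_phase_def)
lemma mods_draw_phase [simp]: "mods draw_phase = {''R'', ''i'', ''r''}"
  by (auto simp: draw_phase_def)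
lemma mods_const_phase [simp]: "mods const_phase = {''t'', ''i'', ''A'', ''D'', ''M'', ''y'', ''z''}"
  by (auto simp: const_phase_def)
lemma mods_weight_phase [simp]: "mods weight_phase = {''v'', ''q'', ''i'', ''T'', ''R''}"
  by (auto simp: weight_phase_def)

locale bounds =
  fixes n L B :: nat
  assumes L: "n * n + n < L"
    and B: "wM n \<le> B" "wrange n ^ (n * n) \<le> B" "2 * n + 1 \<le> B" "wrange n \<le> B" "n * n * wbits n \<le> B"
      "(n + 1) * (n + 1) \<le> B" "wD n * (n + 1) \<le> B" "(wA n + wD n) * n \<le> B" "wrange n + wA n \<le> B"
      "2 ^ (2 * n + 1) \<le> B" "5 ^ n \<le> B"
begin

lemma L_pos: "0 < L"
  using L by simp

lemma wt_ge_2: "2 \<le> wt n"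
  by (simp add: wt_def self_le_power)

lemma wt_power_le: "j \<le> wD n * (n + 1) \<Longrightarrow> wt n ^ j \<le> B"
proof -
  assume "j \<le> wD n * (n + 1)"
  then have "wt n ^ j \<le> wM n" unfolding wM_def using wt_ge_2 by (intro power_increasing) auto
  then show ?thesis using B(1) by simp
qed

lemma wD_pos: "0 < wD n" by (simp add: wD_def wA_def)

lemma run_draw_phase:
  assumes s: "bounded L B s" "s ''n'' 0 = n" "s ''b'' 0 = wbits n"
  shows "run (bounded L B) (\<lambda>s'. s' ''R'' 0 < wrange n ^ (n * n)) (n * n * wbits n * 7 + 5) draw_phase s"
  unfolding draw_phase_def
proof (rule run_Seq_Assign[OF s(1)])
  let ?s = "store s ''R'' (aval (Num 0) s) (aval (Num 0) s)"
  let ?c = "Seq (Flip ''r'' (Num 0)) (Assign ''R'' (Num 0) (Plus (Times (Num 2) (Var ''R'')) (Var ''r'')))"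
  assume b: "bounded L B ?s"
  have B2: "2 ^ (n * n * wbits n) \<le> B" using B(2) by (simp add: wrange_def power_mult[symmetric] mult.commute)
  show "run (bounded L B) (\<lambda>s'. s' ''R'' 0 < wrange n ^ (n * n)) (n * n * wbits n * 7 + 5 - 2)
    (For ''i'' (Times (Times (Var ''n'') (Var ''n'')) (Var ''b'')) ?c) ?s"
  proof (rule run_For[where m = "n * n * wbits n" and T = 3 and J = "\<lambda>k s'. s' ''R'' 0 < 2 ^ k"])
    fix k s' assume k: "k < n * n * wbits n" and b': "bounded L B s'" and J: "s' ''R'' 0 < 2 ^ k"
    have *: "2 * s' ''R'' 0 + m < 2 ^ Suc k" if "m \<le> 1" for m using that J by simp
    have "2 ^ Suc k \<le> (2 :: nat) ^ (n * n * wbits n)" using k by (intro power_increasing) auto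
    then have **: "2 * s' ''R'' 0 + m \<le> B" if "m \<le> 1" for m using *[OF that] B2 by linarith
    show "run (bounded L B) (\<lambda>s'. s' ''R'' 0 < 2 ^ Suc k) 3 ?c s'"
      using * ** by (intro run_Seq_Flip run_Assign) (use B(3) in \<open>auto simp: b' L_pos\<close>)
  next
    fix s' :: state assume "s' ''R'' 0 < 2 ^ (n * n * wbits n)"
    then show "s' ''R'' 0 < wrange n ^ (n * n)" by (simp add: wrange_def power_mult[symmetric] mult.commute)
  qed (use b s B L_pos in auto)
qed (use L_pos in auto)

lemma run_const_phase:
  assumes s: "bounded L B s" "s ''n'' 0 = n" "s ''W'' 0 = wrange n"
  shows "run (bounded L B) (\<lambda>s'. s' ''t'' 0 = wt n \<and> s' ''A'' 0 = wA n \<and> s' ''D'' 0 = wD n \<and> s' ''M'' 0 = wM n \<and>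
      s' ''y'' 0 = wt n ^ wD n \<and> s' ''z'' 0 = (2 + 4 * (wM n - 1) * wt n ^ wD n) mod wM n)
    ((n + 1) * (n + 1) * 5 + wD n * (n + 1) * 5 + wD n * 5 + 30) const_phase s"
proof -
  have pow2: "2 ^ j \<le> B" if "j \<le> (n + 1) * (n + 1)" for j
  proof -
    have "(2 :: nat) ^ j \<le> wt n" unfolding wt_def using that by (intro power_increasing) auto
    also have "\<dots> \<le> B" using wt_power_le[of 1] wD_pos by simp
    finally show ?thesis .
  qed
  have A: "n * n * wrange n + 1 \<le> B" using B(9) by (simp add: wA_def)
  have D: "wA n * (n * n + 1) \<le> B" using B(7) by (simp add: wD_def)
  have mod: "x mod wM n \<le> B" for x
  proof -
    have "0 < wM n" using wt_ge_2 by (simp add: wM_def)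
    then have "x mod wM n < wM n" by (rule mod_less_divisor)
    then show ?thesis using B(1) by simp
  qed
  let ?e1 = "Times (Plus (Var ''n'') (Num 1)) (Plus (Var ''n'') (Num 1))"
  let ?eA = "Plus (Times (Times (Var ''n'') (Var ''n'')) (Var ''W'')) (Num 1)"
  let ?eD = "Times (Var ''A'') (Plus (Times (Var ''n'') (Var ''n'')) (Num 1))"
  let ?eM = "Times (Var ''D'') (Plus (Var ''n'') (Num 1))"
  let ?cz = "Assign ''z'' (Num 0)
     (Mod (Plus (Num 2) (Times (Times (Num 4) (Minus (Var ''M'') (Num 1))) (Var ''y''))) (Var ''M''))"
  let ?Q = "\<lambda>s' :: state. s' ''t'' 0 = wt n \<and> s' ''A'' 0 = wA n \<and> s' ''D'' 0 = wD n \<and> s' ''M'' 0 = wM n \<and>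
      s' ''y'' 0 = wt n ^ wD n \<and> s' ''z'' 0 = (2 + 4 * (wM n - 1) * wt n ^ wD n) mod wM n"
  have 1: "run (bounded L B) (\<lambda>s'. s' ''t'' 0 = wt n) ((n + 1) * (n + 1) * 5 + 5) (Raise ''t'' (Num 2) ?e1) s"
    unfolding wt_def by (rule run_Raise[OF s(1) L_pos]) (use s B(6) pow2 in simp_all)
  show ?thesis
    unfolding const_phase_def
  proof (rule run_Seq[OF 1])
    fix s1 assume b1: "bounded L B s1" and t1: "s1 ''t'' 0 = wt n"
      and fr1: "\<And>x. x \<notin> mods (Raise ''t'' (Num 2) ?e1) \<Longrightarrow> s1 x = s x"
    have v1: "s1 ''n'' 0 = n" "s1 ''W'' 0 = wrange n" using s by (simp_all add: fr1)
    let ?s2 = "store s1 ''A'' (aval (Num 0) s1) (aval ?eA s1)"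
    let ?s3 = "store ?s2 ''D'' (aval (Num 0) ?s2) (aval ?eD ?s2)"
    have 3: "run (bounded L B) ?Q (wD n * (n + 1) * 5 + wD n * 5 + 13)
        (Seq (Raise ''M'' (Var ''t'') ?eM) (Seq (Raise ''y'' (Var ''t'') (Var ''D'')) ?cz)) ?s3"
      if b3: "bounded L B ?s3"
    proof -
      have v3: "?s3 ''n'' 0 = n" "?s3 ''t'' 0 = wt n" "?s3 ''A'' 0 = wA n" "?s3 ''D'' 0 = wD n"
        using v1 t1 by (simp_all add: wA_def wD_def)
      have 4: "run (bounded L B) (\<lambda>s'. s' ''M'' 0 = wM n) (wD n * (n + 1) * 5 + 5) (Raise ''M'' (Var ''t'') ?eM) ?s3"
        unfolding wM_def by (rule run_Raise[OF b3 L_pos]) (use v3 wt_power_le B(7) in simp_all)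
      show ?thesis
      proof (rule run_Seq[OF 4])
        fix s4 assume b4: "bounded L B s4" and M4: "s4 ''M'' 0 = wM n"
          and fr4: "\<And>x. x \<notin> mods (Raise ''M'' (Var ''t'') ?eM) \<Longrightarrow> s4 x = ?s3 x"
        have v4: "s4 ''t'' 0 = wt n" "s4 ''A'' 0 = wA n" "s4 ''D'' 0 = wD n"
          using v3 by (simp_all add: fr4)
        have 5: "run (bounded L B) (\<lambda>s'. s' ''y'' 0 = wt n ^ wD n) (wD n * 5 + 5) (Raise ''y'' (Var ''t'') (Var ''D'')) s4"
          by (rule run_Raise[OF b4 L_pos]) (use v4 wt_power_le B(7) in simp_all)
        show "run (bounded L B) ?Q (wD n * 5 + 7) (Seq (Raise ''y'' (Var ''t'') (Var ''D'')) ?cz) s4"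
        proof (rule run_Seq[OF 5])
          fix s5 assume b5: "bounded L B s5" and y5: "s5 ''y'' 0 = wt n ^ wD n"
            and fr5: "\<And>x. x \<notin> mods (Raise ''y'' (Var ''t'') (Var ''D'')) \<Longrightarrow> s5 x = s4 x"
          show "run (bounded L B) ?Q 1 ?cz s5"
            using b5 y5 by (intro run_Assign) (simp_all add: v4 M4 fr5 L_pos mod)
        qed simp
      qed simp
    qed
    show "run (bounded L B) ?Q (wD n * (n + 1) * 5 + wD n * 5 + 17)
       (Seq (Assign ''A'' (Num 0) ?eA) (Seq (Assign ''D'' (Num 0) ?eD)
         (Seq (Raise ''M'' (Var ''t'') ?eM) (Seq (Raise ''y'' (Var ''t'') (Var ''D'')) ?cz)))) s1"
    proof (rule run_Seq_Assign[OF b1])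
      assume b2: "bounded L B ?s2"
      show "run (bounded L B) ?Q (wD n * (n + 1) * 5 + wD n * 5 + 17 - 2)
        (Seq (Assign ''D'' (Num 0) ?eD)
         (Seq (Raise ''M'' (Var ''t'') ?eM) (Seq (Raise ''y'' (Var ''t'') (Var ''D'')) ?cz))) ?s2"
      proof (rule run_Seq_Assign[OF b2])
        assume b3: "bounded L B ?s3"
        show "run (bounded L B) ?Q (wD n * (n + 1) * 5 + wD n * 5 + 17 - 2 - 2)
          (Seq (Raise ''M'' (Var ''t'') ?eM) (Seq (Raise ''y'' (Var ''t'') (Var ''D'')) ?cz)) ?s3"
          by (rule run_mono[OF 3[OF b3]]) auto
      qed (use v1 D L_pos in \<open>simp_all add: wA_def\<close>)
    qed (use v1 A L_pos in simp_all)
  qed simp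
qed

text \<open>Makes the powers of \<open>t\<close> stored as edge weights fit below \<open>M\<close>.
  The inequality fails for \<open>n = 0\<close>, where no weights are stored.\<close>

lemma weight_exponent_le: "0 < n \<Longrightarrow> wrange n + wA n \<le> wD n * (n + 1)"
proof -
  assume n: "0 < n"
  then have "1 \<le> n * n" by (cases n) auto
  from mult_le_mono1[OF this, of "wrange n"]
  have "wrange n \<le> wA n" unfolding wA_def by linarith
  then have "wrange n + wA n \<le> wA n * 2" by simp
  also have "\<dots> \<le> wD n" unfolding wD_def using n by (intro mult_left_mono) auto
  also have "\<dots> \<le> wD n * (n + 1)" by simp
  finally show ?thesis .
qed

lemma run_weight_phase:
  assumes s: "bounded L B s" "s ''n'' 0 = n" "s ''W'' 0 = wrange n" "s ''t'' 0 = wt n" "s ''A'' 0 = wA n" "s ''R'' 0 = r"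
  shows "run (bounded L B) (\<lambda>s'. \<forall>i<n * n. s' ''T'' i = wt n ^ (digit (wrange n) r i + wA n))
     (n * n * ((wrange n + wA n) * 5 + 14) + 3) weight_phase s"
  unfolding weight_phase_def
proof (rule run_For[where m = "n * n" and T = "(wrange n + wA n) * 5 + 10" and
    J = "\<lambda>k s'. s' ''R'' 0 = r div wrange n ^ k \<and> (\<forall>i<k. s' ''T'' i = wt n ^ (digit (wrange n) r i + wA n))"])
  let ?body = "Seq (Raise ''q'' (Var ''t'') (Plus (Mod (Var ''R'') (Var ''W'')) (Var ''A'')))
       (Seq (Assign ''T'' (Var ''v'') (Var ''q''))
            (Assign ''R'' (Num 0) (Div (Var ''R'') (Var ''W''))))"
  fix k s' assume k: "k < n * n" and b: "bounded L B s'" and v: "s' ''v'' 0 = k"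
    and fr: "\<And>x. x \<noteq> ''v'' \<Longrightarrow> x \<notin> mods ?body \<Longrightarrow> s' x = s x"
    and J: "s' ''R'' 0 = r div wrange n ^ k \<and> (\<forall>i<k. s' ''T'' i = wt n ^ (digit (wrange n) r i + wA n))"
  define w where "w = digit (wrange n) r k"
  have w: "w < wrange n" unfolding w_def digit_def using wrange_pos by simp
  have n0: "0 < n" using k by (cases n) auto
  have v': "s' ''W'' 0 = wrange n" "s' ''t'' 0 = wt n" "s' ''A'' 0 = wA n" using s by (simp_all add: fr)
  have pw: "wt n ^ j \<le> B" if "j \<le> w + wA n" for j
    using that w weight_exponent_le[OF n0] by (intro wt_power_le) simp
  have e: "r div wrange n ^ k mod wrange n = w" by (simp add: w_def digit_def)
  have q: "run (bounded L B) (\<lambda>s'. s' ''q'' 0 = wt n ^ (w + wA n)) ((wrange n + wA n) * 5 + 5)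
     (Raise ''q'' (Var ''t'') (Plus (Mod (Var ''R'') (Var ''W'')) (Var ''A''))) s'"
    by (rule run_Raise[OF b L_pos]) (use J v' e w pw B(9) in auto)
  show "run (bounded L B) (\<lambda>s'. s' ''R'' 0 = r div wrange n ^ Suc k \<and>
     (\<forall>i<Suc k. s' ''T'' i = wt n ^ (digit (wrange n) r i + wA n))) ((wrange n + wA n) * 5 + 10) ?body s'"
  proof (rule run_Seq[OF q])
    fix s2 assume b2: "bounded L B s2" and q2: "s2 ''q'' 0 = wt n ^ (w + wA n)"
      and fr2: "\<And>x. x \<notin> mods (Raise ''q'' (Var ''t'') (Plus (Mod (Var ''R'') (Var ''W'')) (Var ''A''))) \<Longrightarrow> s2 x = s' x"
    have v2: "s2 ''R'' 0 = r div wrange n ^ k" "s2 ''W'' 0 = wrange n" "s2 ''v'' 0 = k" "s2 ''T'' = s' ''T''"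
      using J v v' by (simp_all add: fr2)
    have "r div wrange n ^ k \<le> B" using b2 v2(1) by (metis bounded_def)
    then have "r div wrange n ^ k div wrange n \<le> B" by (rule le_trans[OF div_le_dividend])
    moreover have "r div wrange n ^ k div wrange n = r div (wrange n * wrange n ^ k)"
      by (subst mult.commute) (rule div_mult2_eq[symmetric])
    moreover have "k < L" using k L by linarith
    ultimately show "run (bounded L B) (\<lambda>s'. s' ''R'' 0 = r div wrange n ^ Suc k \<and>
      (\<forall>i<Suc k. s' ''T'' i = wt n ^ (digit (wrange n) r i + wA n))) 4
      (Seq (Assign ''T'' (Var ''v'') (Var ''q'')) (Assign ''R'' (Num 0) (Div (Var ''R'') (Var ''W'')))) s2"
      using J pw[of "w + wA n"] by (intro run_Seq_Assign run_Assign)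
        (simp_all add: b2 v2 q2 L_pos less_Suc_eq w_def)
  qed simp
qed (use s L B(6) L_pos in \<open>auto\<close>)

lemma run_output_phase:
  assumes s: "bounded L B s" "s ''n'' 0 = n" "s ''t'' 0 = wt n" "s ''A'' 0 = wA n" "s ''D'' 0 = wD n"
    "s ''Z'' 0 = z" "s ''k'' 0 = k" "s ''l'' 0 = l" "s ''result'' 0 = 0"
  shows "run (bounded L B) (\<lambda>s'. s' ''result'' 0 \<noteq> 0 \<longleftrightarrow> l \<le> n \<and>
       (\<exists>i<wA n. z div wt n ^ ((wA n + wD n) * l + i) mod wt n mod 2 ^ (n + min k n + 1) \<noteq> 0))
     ((wA n + wD n) * n * 5 + wA n * 8 + (2 * n + 1) * 5 + 20) output_phase s"
proof -
  define hit where "hit i \<longleftrightarrow> z div wt n ^ ((wA n + wD n) * l + i) mod wt n mod 2 ^ (n + min k n + 1) \<noteq> 0" for i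
  have zB: "z div x \<le> B" for x
    using s(1,6) by (metis bounded_def div_le_dividend le_trans)
  have nB: "n \<le> B" using B(3) by simp
  have kB: "k \<le> B" using s(1,7) by (metis bounded_def)
  define C1 where "C1 = Cond (Less (Var ''k'') (Var ''n'')) (Assign ''m'' (Num 0) (Var ''k'')) (Assign ''m'' (Num 0) (Var ''n''))"
  have c1: "run (bounded L B) (\<lambda>s'. s' ''m'' 0 = min k n) 2 C1 s"
    unfolding C1_def by (intro run_Cond run_Assign) (simp_all add: s L_pos nB kB)
  have m1: "mods C1 = {''m''}" by (simp add: C1_def)
  have pow: "2 ^ j \<le> B" if "j \<le> n + min k n + 1" for j
  proof -
    have "(2 :: nat) ^ j \<le> 2 ^ (2 * n + 1)" using that by (intro power_increasing) auto
    then show ?thesis using B(10) by simp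
  qed
  let ?div = "Assign ''Z'' (Num 0) (Div (Var ''Z'') (Var ''t''))"
  let ?test = "Cond (Eq (Mod (Mod (Var ''Z'') (Var ''t'')) (Var ''Q'')) (Num 0)) SKIP (Assign ''result'' (Num 0) (Num 1))"
  have dv: "z div wt n ^ k div wt n = z div (wt n * wt n ^ k)" for k
    by (subst mult.commute) (rule div_mult2_eq[symmetric])
  show ?thesis
    unfolding output_phase_def C1_def[symmetric] hit_def[symmetric]
  proof (rule run_Seq[OF c1])
    fix s1 assume b1: "bounded L B s1" and m: "s1 ''m'' 0 = min k n" and fr1: "\<And>x. x \<notin> mods C1 \<Longrightarrow> s1 x = s x"
    have q: "run (bounded L B) (\<lambda>s'. s' ''Q'' 0 = 2 ^ (n + min k n + 1)) ((2 * n + 1) * 5 + 5)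
        (Raise ''Q'' (Num 2) (Plus (Plus (Var ''n'') (Var ''m'')) (Num 1))) s1"
      by (rule run_Raise[OF b1 L_pos]) (use s m pow B(3) in \<open>auto simp: fr1 m1\<close>)
    show "run (bounded L B) (\<lambda>s'. s' ''result'' 0 \<noteq> 0 \<longleftrightarrow> l \<le> n \<and> (\<exists>i<wA n. hit i))
      ((wA n + wD n) * n * 5 + wA n * 8 + (2 * n + 1) * 5 + 17)
      (Seq (Raise ''Q'' (Num 2) (Plus (Plus (Var ''n'') (Var ''m'')) (Num 1)))
        (Cond (Less (Var ''n'') (Var ''l'')) SKIP
          (Seq (For ''i'' (Times (Plus (Var ''A'') (Var ''D'')) (Var ''l'')) ?div)
            (For ''i'' (Var ''A'') (Seq ?test ?div))))) s1"
    proof (rule run_Seq[OF q])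
      fix s2 assume b2: "bounded L B s2" and Q: "s2 ''Q'' 0 = 2 ^ (n + min k n + 1)"
        and fr2: "\<And>x. x \<notin> mods (Raise ''Q'' (Num 2) (Plus (Plus (Var ''n'') (Var ''m'')) (Num 1))) \<Longrightarrow> s2 x = s1 x"
      have v2: "s2 ''n'' 0 = n" "s2 ''t'' 0 = wt n" "s2 ''A'' 0 = wA n" "s2 ''D'' 0 = wD n" "s2 ''Z'' 0 = z"
        "s2 ''l'' 0 = l" "s2 ''result'' 0 = 0"
        using s by (simp_all add: fr2 fr1 m1)
      show "run (bounded L B) (\<lambda>s'. s' ''result'' 0 \<noteq> 0 \<longleftrightarrow> l \<le> n \<and> (\<exists>i<wA n. hit i))
        ((wA n + wD n) * n * 5 + wA n * 8 + 11)
        (Cond (Less (Var ''n'') (Var ''l'')) SKIP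
          (Seq (For ''i'' (Times (Plus (Var ''A'') (Var ''D'')) (Var ''l'')) ?div)
            (For ''i'' (Var ''A'') (Seq ?test ?div)))) s2"
      proof (rule run_Cond[OF b2])
        assume "\<not> bval (Less (Var ''n'') (Var ''l'')) s2"
        then have ln: "l \<le> n" using v2 by simp
        have "(wA n + wD n) * l \<le> (wA n + wD n) * n" using ln by simp
        then have mB: "(wA n + wD n) * l \<le> B" "(wA n + wD n) * l * 5 + 3 \<le> (wA n + wD n) * n * 5 + 3"
          using B(8) by linarith+
        have "run (bounded L B) (\<lambda>s'. s' ''Z'' 0 = z div wt n ^ ((wA n + wD n) * l)) ((wA n + wD n) * n * 5 + 3)
            (For ''i'' (Times (Plus (Var ''A'') (Var ''D'')) (Var ''l'')) ?div) s2"
        proof (rule run_For[where m = "(wA n + wD n) * l" and T = 1 and J = "\<lambda>k s'. s' ''Z'' 0 = z div wt n ^ k"])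
          fix k s' assume b': "bounded L B s'" and J: "s' ''Z'' 0 = z div wt n ^ k"
            and fr: "\<And>x. x \<noteq> ''i'' \<Longrightarrow> x \<notin> mods ?div \<Longrightarrow> s' x = s2 x"
          have "s' ''t'' 0 = wt n" using v2 by (simp add: fr)
          then show "run (bounded L B) (\<lambda>s'. s' ''Z'' 0 = z div wt n ^ Suc k) 1 ?div s'"
            by (intro run_Assign) (simp_all add: b' J L_pos dv zB)
        qed (use b2 L_pos v2 mB in auto)
        then show "run (bounded L B) (\<lambda>s'. s' ''result'' 0 \<noteq> 0 \<longleftrightarrow> l \<le> n \<and> (\<exists>i<wA n. hit i))
          ((wA n + wD n) * n * 5 + wA n * 8 + 11 - 1)
          (Seq (For ''i'' (Times (Plus (Var ''A'') (Var ''D'')) (Var ''l'')) ?div)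
            (For ''i'' (Var ''A'') (Seq ?test ?div))) s2"
        proof (rule run_Seq)
          fix s3 assume b3: "bounded L B s3" and Z3: "s3 ''Z'' 0 = z div wt n ^ ((wA n + wD n) * l)"
            and fr3: "\<And>x. x \<notin> mods (For ''i'' (Times (Plus (Var ''A'') (Var ''D'')) (Var ''l'')) ?div) \<Longrightarrow> s3 x = s2 x"
          have v3: "s3 ''t'' 0 = wt n" "s3 ''A'' 0 = wA n" "s3 ''Q'' 0 = 2 ^ (n + min k n + 1)" "s3 ''result'' 0 = 0"
            using v2 Q by (simp_all add: fr3)
          show "run (bounded L B) (\<lambda>s'. s' ''result'' 0 \<noteq> 0 \<longleftrightarrow> l \<le> n \<and> (\<exists>i<wA n. hit i))
            (wA n * 8 + 3) (For ''i'' (Var ''A'') (Seq ?test ?div)) s3"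
          proof (rule run_For[where m = "wA n" and T = 4 and
              J = "\<lambda>k s'. s' ''Z'' 0 = z div wt n ^ ((wA n + wD n) * l + k) \<and> (s' ''result'' 0 \<noteq> 0 \<longleftrightarrow> (\<exists>i<k. hit i))"])
            fix j s' assume b': "bounded L B s'"
              and fr: "\<And>x. x \<noteq> ''i'' \<Longrightarrow> x \<notin> mods (Seq ?test ?div) \<Longrightarrow> s' x = s3 x"
              and J: "s' ''Z'' 0 = z div wt n ^ ((wA n + wD n) * l + j) \<and> (s' ''result'' 0 \<noteq> 0 \<longleftrightarrow> (\<exists>i<j. hit i))"
            have v: "s' ''t'' 0 = wt n" "s' ''Q'' 0 = 2 ^ (n + min k n + 1)" using v3 by (simp_all add: fr)
            have ht: "bval (Eq (Mod (Mod (Var ''Z'') (Var ''t'')) (Var ''Q'')) (Num 0)) s' \<longleftrightarrow> \<not> hit j"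
              using v J by (simp add: hit_def)
            have ex: "(\<exists>i<Suc j. hit i) \<longleftrightarrow> (\<exists>i<j. hit i) \<or> hit j" by (auto simp: less_Suc_eq)
            have test: "run (bounded L B) (\<lambda>s1. s1 ''Z'' 0 = s' ''Z'' 0 \<and> (s1 ''result'' 0 \<noteq> 0 \<longleftrightarrow> (\<exists>i<Suc j. hit i))) 2 ?test s'"
            proof (rule run_Cond[OF b'])
              assume "bval (Eq (Mod (Mod (Var ''Z'') (Var ''t'')) (Var ''Q'')) (Num 0)) s'"
              then show "run (bounded L B) (\<lambda>s1. s1 ''Z'' 0 = s' ''Z'' 0 \<and> (s1 ''result'' 0 \<noteq> 0 \<longleftrightarrow> (\<exists>i<Suc j. hit i))) (2 - 1) SKIP s'"
                unfolding ht ex using J b' by (intro run_SKIP) auto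
            next
              assume "\<not> bval (Eq (Mod (Mod (Var ''Z'') (Var ''t'')) (Var ''Q'')) (Num 0)) s'"
              then show "run (bounded L B) (\<lambda>s1. s1 ''Z'' 0 = s' ''Z'' 0 \<and> (s1 ''result'' 0 \<noteq> 0 \<longleftrightarrow> (\<exists>i<Suc j. hit i))) (2 - 1)
                (Assign ''result'' (Num 0) (Num 1)) s'"
                unfolding ht ex using b' L_pos B(3) by (intro run_Assign) auto
            qed simp
            show "run (bounded L B) (\<lambda>s'. s' ''Z'' 0 = z div wt n ^ ((wA n + wD n) * l + Suc j) \<and>
                (s' ''result'' 0 \<noteq> 0 \<longleftrightarrow> (\<exists>i<Suc j. hit i))) 4 (Seq ?test ?div) s'"
            proof (rule run_Seq[OF test])
              fix s1 assume b1: "bounded L B s1"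
                and J1: "s1 ''Z'' 0 = s' ''Z'' 0 \<and> (s1 ''result'' 0 \<noteq> 0 \<longleftrightarrow> (\<exists>i<Suc j. hit i))"
                and fr1: "\<And>x. x \<notin> mods ?test \<Longrightarrow> s1 x = s' x"
              have "s1 ''t'' 0 = wt n" using v by (simp add: fr1)
              then show "run (bounded L B) (\<lambda>s'. s' ''Z'' 0 = z div wt n ^ ((wA n + wD n) * l + Suc j) \<and>
                (s' ''result'' 0 \<noteq> 0 \<longleftrightarrow> (\<exists>i<Suc j. hit i))) 1 ?div s1"
                using J J1 by (intro run_Assign) (simp_all add: b1 L_pos dv zB)
            qed simp
          qed (use b3 L_pos v3 Z3 B(9) ln in auto)
        qed simp
      qed (use b2 v2 in \<open>auto intro: run_SKIP\<close>)
    qed simp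
  qed simp
qed

end

section \<open>The random draw\<close>

lemma steps_stable: "run P Q t c s \<Longrightarrow> t \<le> t' \<Longrightarrow> steps t' c s = steps t c s"
proof (induction t arbitrary: c s t')
  case (Suc t)
  then obtain t'' where t'': "t' = Suc t''" "t \<le> t''" by (cases t') auto
  show ?case
  proof (cases "c = SKIP")
    case False
    have "steps t'' c' s' = steps t c' s'" if "(c', s') \<in> set_pmf (step c s)" for c' s'
      using Suc.prems(1) False that t''(2) by (intro Suc.IH) auto
    then show ?thesis unfolding t''(1) by (auto intro!: bind_pmf_cong)
  qed (simp add: t'')
qed (auto)

text \<open>Executions of \<open>c\<close> may halt at different times, but all have halted after
  \<open>t1\<close> steps. An early halt merely gives \<open>d\<close> more time than the
  \<open>t2\<close> steps after which its distribution no longer changes.\<close>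

lemma steps_Seq:
  "run P R t1 c s \<Longrightarrow> (\<And>s'. P s' \<Longrightarrow> R s' \<Longrightarrow> run P' Q t2 d s') \<Longrightarrow>
     steps (Suc (t1 + t2)) (Seq c d) s = bind_pmf (steps t1 c s) (\<lambda>(_, s'). steps t2 d s')"
proof (induction t1 arbitrary: c s)
  case 0
  then show ?case by (simp add: bind_return_pmf)
next
  case (Suc t1)
  show ?case
  proof (cases "c = SKIP")
    case True
    then have "run P' Q t2 d s" using Suc.prems by auto
    then have "steps (Suc (t1 + t2)) d s = steps t2 d s" by (rule steps_stable) simp
    then show ?thesis using True by (simp add: bind_return_pmf del: steps.simps(2)) (simp add: bind_return_pmf)
  next
    case False
    have IH: "steps (Suc (t1 + t2)) (Seq c' d) s' = bind_pmf (steps t1 c' s') (\<lambda>(_, s'). steps t2 d s')"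
      if "(c', s') \<in> set_pmf (step c s)" for c' s'
      using Suc.prems False that by (intro Suc.IH) auto
    have "steps (Suc (Suc t1 + t2)) (Seq c d) s =
        bind_pmf (step c s) (\<lambda>(c', s'). steps (Suc (t1 + t2)) (Seq c' d) s')"
      using False by (simp add: bind_map_pmf case_prod_unfold del: step.simps(4))
        (simp add: bind_map_pmf case_prod_unfold)
    also have "\<dots> = bind_pmf (step c s) (\<lambda>(c', s'). bind_pmf (steps t1 c' s') (\<lambda>(_, s'). steps t2 d s'))"
      by (intro bind_pmf_cong refl) (auto simp: IH simp del: steps.simps)
    also have "\<dots> = bind_pmf (steps (Suc t1) c s) (\<lambda>(_, s'). steps t2 d s')"
      by (simp add: bind_assoc_pmf case_prod_unfold)
    finally show ?thesis .
  qed
qed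

lemma prob_bind_le:
  assumes "\<And>x. x \<in> set_pmf p \<Longrightarrow> measure_pmf.prob (f x) A \<le> q" "0 \<le> q"
  shows "measure_pmf.prob (bind_pmf p f) A \<le> q"
proof -
  have "emeasure (bind_pmf p f) A \<le> (\<integral>\<^sup>+x. ennreal q \<partial>measure_pmf p)"
    unfolding emeasure_bind_pmf using assms
    by (intro nn_integral_mono_AE) (auto simp: AE_measure_pmf_iff measure_pmf.emeasure_eq_measure)
  also have "\<dots> = ennreal q" by simp
  finally show ?thesis using assms(2) by (simp add: measure_pmf.emeasure_eq_measure)
qed

text \<open>If the continuation never errs outside \<open>Bad\<close>, the whole error is charged to
  the draw.\<close>

lemma prob_bind_le_prob:
  assumes "\<And>x. x \<in> set_pmf p \<Longrightarrow> x \<notin> Bad \<Longrightarrow> measure_pmf.prob (f x) A = 0"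
  shows "measure_pmf.prob (bind_pmf p f) A \<le> measure_pmf.prob p Bad"
proof -
  have "emeasure (bind_pmf p f) A \<le> (\<integral>\<^sup>+x. indicator Bad x \<partial>measure_pmf p)"
    unfolding emeasure_bind_pmf using assms
    by (intro nn_integral_mono_AE)
      (auto simp: AE_measure_pmf_iff measure_pmf.emeasure_eq_measure measure_pmf.prob_le_1 split: split_indicator)
  also have "\<dots> = emeasure (measure_pmf p) Bad" by simp
  finally show ?thesis by (simp add: measure_pmf.emeasure_eq_measure)
qed

text \<open>One further leading bit selects a half of a dyadic interval, and a uniform point of a
  fair half is uniform on the whole.\<close>

lemma pmf_of_set_halves:
  fixes a j :: nat
  shows "bind_pmf (bernoulli_pmf (1/2))
     (\<lambda>b. pmf_of_set {(2 * a + of_bool b) * 2 ^ j..<Suc (2 * a + of_bool b) * 2 ^ j}) =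
   pmf_of_set {a * 2 ^ Suc j..<Suc a * 2 ^ Suc j}"
proof (rule pmf_eqI)
  fix x
  have ne: "{c * 2 ^ k..<Suc c * 2 ^ k} \<noteq> {}" for c k :: nat by simp
  have cd: "card {c * 2 ^ k..<Suc c * 2 ^ k} = 2 ^ k" for c k :: nat by simp
  have "indicat_real {Suc (2 * a) * 2 ^ j..<Suc (Suc (2 * a)) * 2 ^ j} x +
      indicat_real {2 * a * 2 ^ j..<Suc (2 * a) * 2 ^ j} x =
      indicat_real {a * 2 ^ Suc j..<Suc a * 2 ^ Suc j} x"
    by (auto simp: indicator_def algebra_simps)
  then show "pmf (bind_pmf (bernoulli_pmf (1/2))
     (\<lambda>b. pmf_of_set {(2 * a + of_bool b) * 2 ^ j..<Suc (2 * a + of_bool b) * 2 ^ j})) x =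
     pmf (pmf_of_set {a * 2 ^ Suc j..<Suc a * 2 ^ Suc j}) x"
    by (simp add: pmf_bind pmf_of_set[OF ne] cd del: mult_Suc power_Suc)
      (simp add: field_simps)
qed

text \<open>The bits drawn so far are the leading bits of the result, so \<open>j\<close> missing
  bits leave an interval of length \<open>2 ^ j\<close>. A round takes exactly 7 steps: the test,
  the flip, two assignments and three discarded \<open>SKIP\<close>s.\<close>

lemma draw_loop:
  defines "c \<equiv> While (Less (Var ''i'') (Times (Times (Var ''n'') (Var ''n'')) (Var ''b'')))
    (Seq (Seq (Flip ''r'' (Num 0)) (Assign ''R'' (Num 0) (Plus (Times (Num 2) (Var ''R'')) (Var ''r''))))
      (Assign ''i'' (Num 0) (Plus (Var ''i'') (Num 1))))"
  assumes "s ''i'' 0 + j = s ''n'' 0 * s ''n'' 0 * s ''b'' 0"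
  shows "map_pmf (\<lambda>(_, s'). s' ''R'' 0) (steps (7 * j + 1) c s) =
    pmf_of_set {s ''R'' 0 * 2 ^ j..<Suc (s ''R'' 0) * 2 ^ j}"
  using assms(2)
proof (induction j arbitrary: s)
  case 0
  have "{s ''R'' 0..<Suc (s ''R'' 0)} = {s ''R'' 0}" by auto
  then show ?case using 0 by (simp add: c_def bind_return_pmf pmf_of_set_singleton)
next
  case (Suc j)
  let ?s = "\<lambda>b. store (store (store s ''r'' 0 (of_bool b)) ''R'' 0 (2 * s ''R'' 0 + of_bool b)) ''i'' 0 (Suc (s ''i'' 0))"
  have "steps (Suc (Suc (Suc (Suc (Suc (Suc (Suc m))))))) c s =
      bind_pmf (bernoulli_pmf (1/2)) (\<lambda>b. steps m c (?s b))" for m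
    unfolding c_def using Suc.prems
    by (simp add: bind_return_pmf bind_map_pmf map_pmf_comp case_prod_unfold)
  from this[of "7 * j + 1"] have "steps (7 * Suc j + 1) c s =
      bind_pmf (bernoulli_pmf (1/2)) (\<lambda>b. steps (7 * j + 1) c (?s b))"
    by (simp add: numeral_eq_Suc del: steps.simps)
  then have "map_pmf (\<lambda>(_, s'). s' ''R'' 0) (steps (7 * Suc j + 1) c s) =
      bind_pmf (bernoulli_pmf (1/2)) (\<lambda>b. map_pmf (\<lambda>(_, s'). s' ''R'' 0) (steps (7 * j + 1) c (?s b)))"
    by (simp add: map_bind_pmf)
  also have "\<dots> = bind_pmf (bernoulli_pmf (1/2))
     (\<lambda>b. pmf_of_set {(2 * s ''R'' 0 + of_bool b) * 2 ^ j..<Suc (2 * s ''R'' 0 + of_bool b) * 2 ^ j})"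
    by (intro bind_pmf_cong refl, subst Suc.IH) (use Suc.prems in simp_all)
  also have "\<dots> = pmf_of_set {s ''R'' 0 * 2 ^ Suc j..<Suc (s ''R'' 0) * 2 ^ Suc j}"
    by (rule pmf_of_set_halves)
  finally show ?case .
qed

lemma draw_phase_uniform:
  assumes "s ''n'' 0 = n" "s ''b'' 0 = wbits n"
  shows "map_pmf (\<lambda>(_, s'). s' ''R'' 0) (steps (n * n * wbits n * 7 + 5) draw_phase s) =
    pmf_of_set {..<wrange n ^ (n * n)}"
proof -
  let ?m = "n * n * wbits n"
  let ?s = "store (store s ''R'' 0 0) ''i'' 0 0"
  let ?c = "While (Less (Var ''i'') (Times (Times (Var ''n'') (Var ''n'')) (Var ''b'')))
    (Seq (Seq (Flip ''r'' (Num 0)) (Assign ''R'' (Num 0) (Plus (Times (Num 2) (Var ''R'')) (Var ''r''))))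
      (Assign ''i'' (Num 0) (Plus (Var ''i'') (Num 1))))"
  have "steps (Suc (Suc (Suc (Suc m)))) draw_phase s = steps m ?c ?s" for m
    by (simp add: draw_phase_def For_def bind_return_pmf)
  from this[of "7 * ?m + 1"] have "steps (?m * 7 + 5) draw_phase s = steps (7 * ?m + 1) ?c ?s"
    by (simp add: numeral_eq_Suc mult.commute del: steps.simps)
  moreover have "map_pmf (\<lambda>(_, s'). s' ''R'' 0) (steps (7 * ?m + 1) ?c ?s) =
      pmf_of_set {?s ''R'' 0 * 2 ^ ?m..<Suc (?s ''R'' 0) * 2 ^ ?m}"
    by (rule draw_loop) (use assms in simp)
  ultimately show ?thesis
    by (simp add: wrange_def power_mult[symmetric] mult.commute lessThan_atLeast0)
qed

section \<open>Depths in a rooted forest\<close>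

definition forest_par :: "nat pair_pre_digraph \<Rightarrow> nat \<Rightarrow> nat" where
  "forest_par F v = (if \<exists>u. (v, u) \<in> parcs F then Suc (THE u. (v, u) \<in> parcs F) else 0)"

definition forest_dep :: "nat pair_pre_digraph \<Rightarrow> nat \<Rightarrow> nat" where
  "forest_dep F v = card {u. (v, u) \<in> (parcs F)\<^sup>*}"

locale forest_on =
  fixes F :: "nat pair_pre_digraph" and n :: nat
  assumes F: "rooted_forest F" and V: "pverts F = {..<n}"
begin

sublocale pair_fin_digraph F
  using F by (simp add: rooted_forest_def)

lemma arc_less: "(v, u) \<in> parcs F \<Longrightarrow> v < n \<and> u < n"
  using in_arcsD1 in_arcsD2 V by auto

lemma arc_unique: "(v, u) \<in> parcs F \<Longrightarrow> (v, u') \<in> parcs F \<Longrightarrow> u = u'"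
proof -
  assume a: "(v, u) \<in> parcs F" "(v, u') \<in> parcs F"
  have "card (out_arcs (with_proj F) v) \<le> 1"
    using F in_arcsD1[OF a(1)] by (auto simp: rooted_forest_def out_degree_def)
  moreover have "finite (out_arcs (with_proj F) v)"
    using pair_finite_arcs by (auto simp: out_arcs_def)
  ultimately have "\<forall>e\<in>out_arcs (with_proj F) v. \<forall>e'\<in>out_arcs (with_proj F) v. e = e'"
    using card_le_Suc0_iff_eq[of "out_arcs (with_proj F) v"] by simp
  moreover have "(v, u) \<in> out_arcs (with_proj F) v" "(v, u') \<in> out_arcs (with_proj F) v"
    using a by (simp_all add: out_arcs_def)
  ultimately have "(v, u) = (v, u')" by blast
  then show ?thesis by simp
qed

lemma par_Suc_iff: "forest_par F v = Suc u \<longleftrightarrow> (v, u) \<in> parcs F"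
proof -
  have "(THE u. (v, u) \<in> parcs F) = u'" if "(v, u') \<in> parcs F" for u'
    using that arc_unique by blast
  then show ?thesis unfolding forest_par_def using arc_unique by auto
qed

lemma par_0_iff: "forest_par F v = 0 \<longleftrightarrow> (\<forall>u. (v, u) \<notin> parcs F)"
  by (simp add: forest_par_def)

lemma par_le: "forest_par F v \<le> n"
  using par_Suc_iff[of v] arc_less by (cases "forest_par F v") (auto simp: Suc_le_eq)

lemma ancestors_less: "v < n \<Longrightarrow> {u. (v, u) \<in> (parcs F)\<^sup>*} \<subseteq> {..<n}"
proof (intro subsetI, elim CollectE)
  fix u assume "v < n" "(v, u) \<in> (parcs F)\<^sup>*"
  from this(2,1) show "u \<in> {..<n}" by (induction rule: rtrancl_induct) (auto dest: arc_less)
qed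

lemma finite_ancestors: "v < n \<Longrightarrow> finite {u. (v, u) \<in> (parcs F)\<^sup>*}"
  using ancestors_less finite_subset by blast

text \<open>Outdegree at most 1 sends every nontrivial path from \<open>v\<close> through
  \<open>p\<close>, and acyclicity keeps \<open>v\<close> from being reachable from
  \<open>p\<close>.\<close>

lemma ancestors_rec: "(v, p) \<in> parcs F \<Longrightarrow>
  {u. (v, u) \<in> (parcs F)\<^sup>*} = insert v {u. (p, u) \<in> (parcs F)\<^sup>*} \<and> v \<notin> {u. (p, u) \<in> (parcs F)\<^sup>*}"
proof -
  assume vp: "(v, p) \<in> parcs F"
  have "(v, u) \<in> (parcs F)\<^sup>* \<longleftrightarrow> u = v \<or> (p, u) \<in> (parcs F)\<^sup>*" for u
  proof
    assume "(v, u) \<in> (parcs F)\<^sup>*"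
    then show "u = v \<or> (p, u) \<in> (parcs F)\<^sup>*"
    proof (cases rule: converse_rtranclE)
      case (step y)
      then show ?thesis using arc_unique[OF vp step(1)] by simp
    qed simp
  next
    assume "u = v \<or> (p, u) \<in> (parcs F)\<^sup>*"
    then show "(v, u) \<in> (parcs F)\<^sup>*" using vp by (auto intro: converse_rtrancl_into_rtrancl)
  qed
  moreover have "(p, v) \<notin> (parcs F)\<^sup>*"
    using F vp unfolding rooted_forest_def acyclic_def by (auto dest: rtrancl_into_trancl2)
  ultimately show ?thesis by auto
qed

lemma dep_rec: "v < n \<Longrightarrow> forest_dep F v =
  (if forest_par F v = 0 then 1 else Suc (forest_dep F (forest_par F v - 1)))"
proof (cases "forest_par F v")
  case 0
  then have "(v, u) \<in> (parcs F)\<^sup>* \<longleftrightarrow> u = v" for u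
    unfolding par_0_iff by (auto elim: converse_rtranclE)
  then show ?thesis using 0 by (simp add: forest_dep_def)
next
  case (Suc p)
  then have vp: "(v, p) \<in> parcs F" by (simp add: par_Suc_iff)
  then show ?thesis
    using Suc ancestors_rec[OF vp] finite_ancestors[of p] arc_less[OF vp] by (simp add: forest_dep_def)
qed

lemma dep_le_n: "v < n \<Longrightarrow> forest_dep F v \<le> n"
  unfolding forest_dep_def using card_mono[OF _ ancestors_less[of v]] by simp

text \<open>Links the number of ancestors to \<open>forest_depth\<close>, which is defined by paths.
  Knowing \<open>set p\<close> lets the induction show that prepending \<open>v\<close> creates no
  repetition.\<close>

lemma root_path: "v < n \<Longrightarrow> \<exists>p. vpath p (with_proj F) \<and> hd p = v \<and> length p = forest_dep F v \<and>
  set p = {u. (v, u) \<in> (parcs F)\<^sup>*}"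
proof (induction "forest_dep F v" arbitrary: v rule: less_induct)
  case less
  show ?case
  proof (cases "forest_par F v")
    case 0
    then have "{u. (v, u) \<in> (parcs F)\<^sup>*} = {v}"
      unfolding par_0_iff by (auto elim: converse_rtranclE)
    moreover have "forest_dep F v = 1" using dep_rec[OF less.prems] 0 by simp
    moreover have "vpath [v] (with_proj F)" using less.prems V by (auto simp: vpath_def vwalk_def)
    ultimately show ?thesis by (intro exI[of _ "[v]"]) auto
  next
    case (Suc u)
    then have vu: "(v, u) \<in> parcs F" by (simp add: par_Suc_iff)
    have d: "forest_dep F v = Suc (forest_dep F u)" using dep_rec[OF less.prems] Suc by simp
    then obtain p where p: "vpath p (with_proj F)" "hd p = u" "length p = forest_dep F u"
      "set p = {w. (u, w) \<in> (parcs F)\<^sup>*}"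
      using less.hyps[of u] arc_less[OF vu] by auto
    have "vwalk (v # p) (with_proj F)"
      using p(1,2) vu by (intro vwalk_wf_digraph_consI) (auto simp: vpath_def)
    then have "vpath (v # p) (with_proj F)"
      using p(1,4) ancestors_rec[OF vu] by (simp add: vpath_def)
    then show ?thesis using p d ancestors_rec[OF vu] by (intro exI[of _ "v # p"]) auto
  qed
qed

lemma dep_le_forest_depth: "v < n \<Longrightarrow> forest_dep F v \<le> forest_depth F"
proof -
  assume "v < n"
  then obtain p where p: "vpath p (with_proj F)" "length p = forest_dep F v" using root_path by blast
  have "length q \<le> n" if "vpath q (with_proj F)" for q
  proof -
    have "set q \<subseteq> {..<n}" "distinct q" using that V by (auto simp: vpath_def vwalk_def)
    then show ?thesis using card_mono[of "{..<n}" "set q"] distinct_card[of q] by simp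
  qed
  \<comment> \<open>The supremum of naturals dominates its elements only for a bounded set; paths
    have distinct vertices, so \<open>n\<close> bounds their lengths.\<close>
  then have "bdd_above {length p |p. vpath p (with_proj F)}" by (intro bdd_aboveI[of _ n]) auto
  moreover have "forest_dep F v \<in> {length p |p. vpath p (with_proj F)}"
    using p(1) unfolding p(2)[symmetric] by blast
  ultimately show ?thesis unfolding forest_depth_def by (intro cSup_upper)
qed

lemma max_depth_le: "max_depth (forest_dep F) n \<le> forest_depth F"
  unfolding max_depth_def using dep_le_forest_depth by (subst Max_le_iff) auto

lemma trancl_dep: "(v, u) \<in> (parcs F)\<^sup>+ \<Longrightarrow> forest_dep F u < forest_dep F v"
proof (induction rule: trancl_induct)
  case (base u)
  then show ?case using dep_rec[of v] arc_less par_Suc_iff[of v u] by auto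
next
  case (step u w)
  then have "forest_dep F w < forest_dep F u" using dep_rec[of u] arc_less par_Suc_iff[of u w] by auto
  then show ?case using step.IH by simp
qed

end

section \<open>Polynomial bounds\<close>

definition poly_bounded :: "(nat \<Rightarrow> nat) \<Rightarrow> bool" where
  "poly_bounded f \<longleftrightarrow> (\<exists>p :: nat poly. \<forall>n. f n \<le> poly p n)"

named_theorems poly_bounded_intros

lemma poly_bounded_const [poly_bounded_intros]: "poly_bounded (\<lambda>_. c)"
  unfolding poly_bounded_def by (intro exI[of _ "[:c:]"]) simp

lemma poly_bounded_id [poly_bounded_intros]: "poly_bounded (\<lambda>n. n)"
  unfolding poly_bounded_def by (intro exI[of _ "[:0, 1:]"]) simp

lemma poly_bounded_add [poly_bounded_intros]:
  "poly_bounded f \<Longrightarrow> poly_bounded g \<Longrightarrow> poly_bounded (\<lambda>n. f n + g n)"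
proof -
  assume "poly_bounded f" "poly_bounded g"
  then obtain p q :: "nat poly" where "\<And>n. f n \<le> poly p n" "\<And>n. g n \<le> poly q n"
    by (auto simp: poly_bounded_def)
  then show ?thesis unfolding poly_bounded_def by (intro exI[of _ "p + q"]) (auto intro: add_mono)
qed

lemma poly_bounded_mult [poly_bounded_intros]:
  "poly_bounded f \<Longrightarrow> poly_bounded g \<Longrightarrow> poly_bounded (\<lambda>n. f n * g n)"
proof -
  assume "poly_bounded f" "poly_bounded g"
  then obtain p q :: "nat poly" where "\<And>n. f n \<le> poly p n" "\<And>n. g n \<le> poly q n"
    by (auto simp: poly_bounded_def)
  then show ?thesis unfolding poly_bounded_def by (intro exI[of _ "p * q"]) (auto intro: mult_mono)
qed

lemma poly_bounded_mono: "poly_bounded g \<Longrightarrow> (\<And>n. f n \<le> g n) \<Longrightarrow> poly_bounded f"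
  unfolding poly_bounded_def by (meson le_trans)

lemma poly_bounded_wrange [poly_bounded_intros]: "poly_bounded wrange"
  by (rule poly_bounded_mono[OF _ wrange_le]) (intro poly_bounded_intros)

lemma poly_bounded_wbits [poly_bounded_intros]: "poly_bounded wbits"
  by (rule poly_bounded_mono[OF _ wbits_le]) (intro poly_bounded_intros)

lemma poly_bounded_wA [poly_bounded_intros]: "poly_bounded wA"
  unfolding wA_def[abs_def] by (intro poly_bounded_intros)

lemma poly_bounded_wD [poly_bounded_intros]: "poly_bounded wD"
  unfolding wD_def[abs_def] by (intro poly_bounded_intros)

text \<open>These are the admissible cell contents: numbers with polynomially many bits.\<close>

definition exp_poly_bounded :: "(nat \<Rightarrow> nat) \<Rightarrow> bool" where
  "exp_poly_bounded f \<longleftrightarrow> (\<exists>g. poly_bounded g \<and> (\<forall>n. f n \<le> 2 ^ g n))"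

lemma exp_poly_bounded_poly: "poly_bounded f \<Longrightarrow> exp_poly_bounded f"
  unfolding exp_poly_bounded_def using less_imp_le[OF less_exp] by blast

lemma exp_poly_bounded_power: "poly_bounded f \<Longrightarrow> exp_poly_bounded (\<lambda>n. 2 ^ f n)"
  unfolding exp_poly_bounded_def by blast

lemma exp_poly_bounded_add:
  "exp_poly_bounded f \<Longrightarrow> exp_poly_bounded g \<Longrightarrow> exp_poly_bounded (\<lambda>n. f n + g n)"
proof -
  assume "exp_poly_bounded f" "exp_poly_bounded g"
  then obtain p q where pq: "poly_bounded p" "poly_bounded q" "\<And>n. f n \<le> 2 ^ p n" "\<And>n. g n \<le> 2 ^ q n"
    by (auto simp: exp_poly_bounded_def)
  have "f n + g n \<le> 2 ^ (p n + q n + 1)" for n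
  proof -
    have "f n \<le> 2 ^ (p n + q n)" "g n \<le> 2 ^ (p n + q n)"
      by (rule le_trans[OF pq(3)] le_trans[OF pq(4)], intro power_increasing, simp, simp)+
    then show ?thesis by simp
  qed
  moreover have "poly_bounded (\<lambda>n. p n + q n + 1)" using pq by (intro poly_bounded_intros)
  ultimately show ?thesis unfolding exp_poly_bounded_def by blast
qed

lemma exp_poly_bounded_pow:
  assumes "exp_poly_bounded f" "poly_bounded g"
  shows "exp_poly_bounded (\<lambda>n. f n ^ g n)"
proof -
  obtain p where p: "poly_bounded p" "\<And>n. f n \<le> 2 ^ p n" using assms(1) by (auto simp: exp_poly_bounded_def)
  have "f n ^ g n \<le> 2 ^ (p n * g n)" for n
    using power_mono[OF p(2)[of n], of "g n"] by (simp add: power_mult)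
  moreover have "poly_bounded (\<lambda>n. p n * g n)" using p assms(2) by (intro poly_bounded_intros)
  ultimately show ?thesis unfolding exp_poly_bounded_def by blast
qed

text \<open>The sum of all quantities that \<open>bounds\<close> requires to fit into a cell, so
  each requirement holds because its quantity is a summand.\<close>

definition cell_bound :: "nat \<Rightarrow> nat" where
  "cell_bound n = wM n + wrange n ^ (n * n) + (2 * n + 1 + wrange n + n * n * wbits n + (n + 1) * (n + 1) +
     wD n * (n + 1) + (wA n + wD n) * n + (wrange n + wA n)) + 2 ^ (2 * n + 1) + 5 ^ n"

lemma exp_poly_bounded_cell_bound: "exp_poly_bounded cell_bound"
proof -
  have 1: "exp_poly_bounded (\<lambda>n. wM n)"
    unfolding wM_def wt_def
    by (rule exp_poly_bounded_pow[OF exp_poly_bounded_power]) (intro poly_bounded_intros)+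
  have 2: "exp_poly_bounded (\<lambda>n. wrange n ^ (n * n))"
    by (rule exp_poly_bounded_pow[OF exp_poly_bounded_poly]) (intro poly_bounded_intros)+
  have 3: "exp_poly_bounded (\<lambda>n. 2 * n + 1 + wrange n + n * n * wbits n + (n + 1) * (n + 1) +
     wD n * (n + 1) + (wA n + wD n) * n + (wrange n + wA n))"
    by (rule exp_poly_bounded_poly) (intro poly_bounded_intros)
  have 4: "exp_poly_bounded (\<lambda>n. 2 ^ (2 * n + 1))"
    by (rule exp_poly_bounded_power) (intro poly_bounded_intros)
  have 5: "exp_poly_bounded (\<lambda>n. 5 ^ n)"
    by (rule exp_poly_bounded_pow[OF exp_poly_bounded_poly]) (intro poly_bounded_intros)+
  show ?thesis unfolding cell_bound_def[abs_def]
    by (rule exp_poly_bounded_add[OF exp_poly_bounded_add[OF exp_poly_bounded_add[OF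
        exp_poly_bounded_add[OF 1 2] 3] 4] 5])
qed

section \<open>The algorithm\<close>

definition init_phase :: com where
  "init_phase = Seq depth_phase range_phase"

definition eval_phase :: com where
  "eval_phase = Seq const_phase (Seq weight_phase (Seq (Raise ''X'' (Num 5) (Var ''d''))
     (Seq main_loop (Seq root_product output_phase))))"

text \<open>All coins are flipped in the middle phase, so that the error analysis can condition on
  the drawn number and treat the evaluation as deterministic.\<close>

definition algorithm :: com where
  "algorithm = Seq init_phase (Seq draw_phase eval_phase)"

definition init_time :: "nat \<Rightarrow> nat" where
  "init_time n = n * (n * 8 + 12) + 3 + ((2 * n + 1) * 8 + 7) + 1"

definition draw_time :: "nat \<Rightarrow> nat" where
  "draw_time n = n * n * wbits n * 7 + 5"

definition round_bound :: "nat \<Rightarrow> nat" where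
  "round_bound n = n * (n * (n * 18 + 25) + 17) + 11 + 4"

definition other_time :: "nat \<Rightarrow> nat" where
  "other_time n = ((n + 1) * (n + 1) * 5 + wD n * (n + 1) * 5 + wD n * 5 + 30) +
     (n * n * ((wrange n + wA n) * 5 + 14) + 3) + (n * 5 + 5) + (n * 6 + 5) +
     ((wA n + wD n) * n * 5 + wA n * 8 + (2 * n + 1) * 5 + 20) + 8"

definition eval_time :: "nat \<Rightarrow> nat \<Rightarrow> nat" where
  "eval_time n d = 5 ^ d * round_bound n + other_time n"

definition total_time :: "nat \<Rightarrow> nat \<Rightarrow> nat" where
  "total_time n d = Suc (init_time n + Suc (draw_time n + eval_time n d))"

locale instance_of =
  fixes G F :: "nat pair_pre_digraph" and n k l :: nat
  assumes G: "pair_graph G" "pverts G = {..<n}" and EF: "elimination_forest F G"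
begin

sublocale forest_on F n
  using EF G by unfold_locales (auto simp: elimination_forest_def)

abbreviation "par \<equiv> forest_par F"
abbreviation "dep \<equiv> forest_dep F"
abbreviation "dd \<equiv> max_depth dep n"
abbreviation "LL \<equiv> n * n + n + 1"
abbreviation "BB \<equiv> cell_bound n + k + l"

text \<open>Adjacent vertices are related in the forest, so comparing depths directs each edge from
  the ancestor to the descendant.\<close>

definition E :: "(nat \<times> nat) set" where
  "E = {(u, v) \<in> parcs G. dep u < dep v}"

sublocale bounds n LL BB
  by unfold_locales (simp_all add: cell_bound_def)

lemma E_subset: "E \<subseteq> parcs G"
  by (auto simp: E_def)

lemma oriented_E: "oriented E"
  by (auto simp: E_def oriented_def)

lemma G_less: "(u, v) \<in> parcs G \<Longrightarrow> u < n \<and> v < n"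
  using pair_wf_digraph.in_arcsD1[of G u v] pair_wf_digraph.in_arcsD2[of G u v] G
  by (auto simp: pair_graph_def pair_digraph_def pair_fin_digraph_def)

lemma dep_le_dd: "v < n \<Longrightarrow> dep v \<le> dd"
  unfolding max_depth_def by (intro Max_ge) auto

lemma dd_le_n: "dd \<le> n"
  unfolding max_depth_def using dep_le_n by (subst Max_le_iff) auto

lemma ancestor_related:
  assumes "(u, v) \<in> parcs G"
  shows "(u, v) \<in> (parcs F)\<^sup>+ \<or> (v, u) \<in> (parcs F)\<^sup>+"
proof -
  have "u \<noteq> v" using assms G(1) pair_loopfree_digraph.pair_no_loops[of G "(u, v)"]
    by (auto simp: pair_graph_def pair_digraph_def)
  moreover have "(v, u) \<in> (parcs F)\<^sup>* \<or> (u, v) \<in> (parcs F)\<^sup>*"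
    using EF assms reachable_rtranclI[of "with_proj F"]
    by (fastforce simp: elimination_forest_def ancestor_def)
  ultimately show ?thesis by (auto dest: rtranclD)
qed

lemma E_covers: "(u, v) \<in> parcs G \<Longrightarrow> (u, v) \<in> E \<or> (v, u) \<in> E"
proof -
  assume a: "(u, v) \<in> parcs G"
  interpret g: pair_graph G by (rule G(1))
  have "(v, u) \<in> parcs G" using a g.sym_arcs by (auto simp: symmetric_def sym_def)
  then show ?thesis using a ancestor_related[OF a] trancl_dep by (auto simp: E_def)
qed

lemma R_eq: "{(v, u). v < n \<and> par v = Suc u} = parcs F"
  using arc_less by (auto simp: par_Suc_iff)

lemma elim_forest: "elim_forest n dd par dep E"
proof
  fix u v assume uv: "(u, v) \<in> E"
  then have "(u, v) \<in> parcs G" "dep u < dep v" by (auto simp: E_def)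
  then show "u < n \<and> v < n \<and> (v, u) \<in> {(v, u). v < n \<and> par v = Suc u}\<^sup>+"
    using ancestor_related[of u v] trancl_dep[of u v] G_less unfolding R_eq by auto
qed (use par_le dep_rec dep_le_dd in auto)

definition w :: "nat \<Rightarrow> nat \<times> nat \<Rightarrow> nat" where
  "w r e = digit (wrange n) r (fst e * n + snd e)"

definition ZZ :: "nat \<Rightarrow> int" where
  "ZZ r = partition5 {..<n} E (int (wt n) ^ wD n) (\<lambda>e. int (wt n) ^ (w r e + wA n))"

text \<open>The answer of the program as a function of the drawn number \<open>r\<close>.\<close>

definition acc :: "nat \<Rightarrow> bool" where
  "acc r \<longleftrightarrow> l \<le> n \<and> (\<exists>i<wA n. nat (ZZ r mod int (wM n)) div wt n ^ ((wA n + wD n) * l + i)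
      mod wt n mod 2 ^ (n + min k n + 1) \<noteq> 0)"

lemma isolating: "l \<le> n \<Longrightarrow> isolating n l (wrange n) (n * n) (wA n) (wD n) (wt n) (wM n) E (w r)"
proof
  show "E \<subseteq> {..<n} \<times> {..<n}" using G_less by (auto simp: E_def)
  show "w r e < wrange n" for e unfolding w_def digit_def using wrange_pos by simp
qed (auto simp: wA_def wD_def wt_def wM_def power2_eq_square)

lemma wM_gt_1: "1 < wM n"
proof -
  have "0 < wD n * (n + 1)" using wD_pos by simp
  then have "wt n \<le> wM n" unfolding wM_def using wt_ge_2 by (intro self_le_power) auto
  then show ?thesis using wt_ge_2 by simp
qed

lemma int_nat_ZZ: "int (nat (ZZ r mod int (wM n))) = ZZ r mod int (wM n)"
  using wM_gt_1 by simp

lemma acc_sound: "acc r \<Longrightarrow> partial_cycle_cover G k l"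
proof -
  assume a: "acc r"
  then interpret isolating n "min k n" l "wrange n" "n * n" "wA n" "wD n" "wt n" "wM n" E "w r"
    by (intro isolating) (simp add: acc_def)
  have "cover_sets n E (min k n) l \<noteq> {}"
    by (rule accept_sound) (use a int_nat_ZZ in \<open>auto simp: acc_def accept_def Z_def ZZ_def\<close>)
  then show ?thesis using partial_cycle_cover_iff[OF G E_subset oriented_E E_covers] by blast
qed

lemma acc_complete:
  "l \<le> n \<Longrightarrow> min_weight_unique (\<lambda>S. \<Sum>e\<in>S. w r e) (cover_sets n E (min k n) l) \<Longrightarrow> acc r"
proof -
  assume l: "l \<le> n" and u: "min_weight_unique (\<lambda>S. \<Sum>e\<in>S. w r e) (cover_sets n E (min k n) l)"
  from l interpret isolating n "min k n" l "wrange n" "n * n" "wA n" "wD n" "wt n" "wM n" E "w r"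
    by (rule isolating)
  have "accept (nat (ZZ r mod int (wM n)))"
    by (rule accept_complete) (use u int_nat_ZZ in \<open>auto simp: Z_def ZZ_def\<close>)
  then show ?thesis using l by (simp add: acc_def accept_def)
qed

text \<open>The isolation lemma is applied with all \<open>n * n\<close> positions of the adjacency
  matrix as indices, whether or not they hold an edge of \<open>E\<close>.\<close>

lemma card_not_acc:
  assumes "partial_cycle_cover G k l"
  shows "2 * card {r. r < wrange n ^ (n * n) \<and> \<not> acc r} \<le> wrange n ^ (n * n)"
proof -
  have ne: "cover_sets n E (min k n) l \<noteq> {}"
    using assms partial_cycle_cover_iff[OF G E_subset oriented_E E_covers] by blast
  have EV: "E \<subseteq> {..<n} \<times> {..<n}" using G_less by (auto simp: E_def)
  \<comment> \<open>Since the program rejects every \<open>l > n\<close>, \<open>l \<le> n\<close>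
    has to be derived from the existence of a solution.\<close>
  obtain S where "S \<in> cover_sets n E (min k n) l" using ne by blast
  then have "everts S \<subseteq> {..<n}" "card (everts S) = l"
    using EV by (auto simp: cover_sets_def even_sets_def everts_def)
  then have l: "l \<le> n" using card_mono[of "{..<n}" "everts S"] by simp
  define idx where "idx e = fst e * n + snd e" for e :: "nat \<times> nat"
  have "inj_on idx E"
  proof (rule inj_onI)
    fix e e' assume e: "e \<in> E" "e' \<in> E" and eq: "idx e = idx e'"
    then have "snd e < n" "snd e' < n" using EV by auto
    then have "fst e = idx e div n" "snd e = idx e mod n" "fst e' = idx e' div n" "snd e' = idx e' mod n"
      by (auto simp: idx_def)
    then show "e = e'" using eq by (simp add: prod_eq_iff)
  qed
  moreover have "idx ` E \<subseteq> {..<n * n}"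
  proof (rule image_subsetI)
    fix e assume "e \<in> E"
    then have e: "fst e < n" "snd e < n" using EV by auto
    then have "idx e < Suc (fst e) * n" by (simp add: idx_def)
    also have "\<dots> \<le> n * n" using e by (intro mult_right_mono) auto
    finally show "idx e \<in> {..<n * n}" by simp
  qed
  moreover have "cover_sets n E (min k n) l \<subseteq> Pow E" by (auto simp: cover_sets_def even_sets_def)
  moreover have "finite E" using EV by (rule finite_subset) simp
  ultimately have iso: "2 * card {r. r < wrange n ^ (n * n) \<and>
      \<not> min_weight_unique (\<lambda>S. \<Sum>e\<in>S. digit (wrange n) r (idx e)) (cover_sets n E (min k n) l)} \<le> wrange n ^ (n * n)"
    using ne wrange_ge[of n] wrange_pos[of n] by (intro isolation[where E = E]) auto
  have "card {r. r < wrange n ^ (n * n) \<and> \<not> acc r} \<le> card {r. r < wrange n ^ (n * n) \<and>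
      \<not> min_weight_unique (\<lambda>S. \<Sum>e\<in>S. digit (wrange n) r (idx e)) (cover_sets n E (min k n) l)}"
    by (rule card_mono) (use acc_complete[OF l] in \<open>auto simp: w_def idx_def\<close>)
  then show ?thesis using iso by linarith
qed

section \<open>The phases of the program on an encoded instance\<close>

definition ready :: "state \<Rightarrow> bool" where
  "ready s \<longleftrightarrow> s ''n'' 0 = n \<and> s ''k'' 0 = k \<and> s ''l'' 0 = l \<and> s ''result'' 0 = 0 \<and>
     (\<forall>i. s ''adj'' i = of_bool (i < n * n \<and> (i div n, i mod n) \<in> parcs G)) \<and>
     (\<forall>v<n. s ''parent'' v = par v \<and> s ''dep'' v = dep v \<and> s ''S'' v = 0) \<and>
     s ''d'' 0 = dd \<and> s ''W'' 0 = wrange n \<and> s ''b'' 0 = wbits n"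

abbreviation "s0 \<equiv> input_state n G F k l"

lemma s0_simps:
  "s0 ''n'' = (\<lambda>_. 0)(0 := n)" "s0 ''k'' = (\<lambda>_. 0)(0 := k)" "s0 ''l'' = (\<lambda>_. 0)(0 := l)"
  "s0 ''adj'' = (\<lambda>i. of_bool (i < n * n \<and> (i div n, i mod n) \<in> parcs G))" "s0 ''parent'' = par"
  "x \<notin> {''n'', ''k'', ''l'', ''adj'', ''parent''} \<Longrightarrow> s0 x = (\<lambda>_. 0)"
  by (simp_all add: input_state_def forest_par_def fun_eq_iff)

lemma bounded_s0: "bounded LL BB s0"
  unfolding bounded_def
proof (intro allI)
  fix x i
  have par0: "par v = 0" if "n \<le> v" for v
    using that arc_less by (fastforce simp: par_0_iff)
  have nB: "n \<le> BB" "1 \<le> BB" using B(3) by auto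
  consider "x = ''n''" | "x = ''k''" | "x = ''l''" | "x = ''adj''" | "x = ''parent''"
    | "x \<notin> {''n'', ''k'', ''l'', ''adj'', ''parent''}" by blast
  then show "s0 x i \<le> BB \<and> (LL \<le> i \<longrightarrow> s0 x i = 0)"
  proof cases
    case 5
    then show ?thesis using par_le[of i] par0[of i] nB by (simp add: s0_simps)
  qed (use nB in \<open>auto simp: s0_simps\<close>)
qed

lemma run_init: "run (bounded LL BB) ready (init_time n) init_phase s0"
  unfolding init_phase_def
proof (rule run_Seq[OF run_depth_phase[where n = n and par = par and dep = dep]])
  fix s assume b: "bounded LL BB s" and d: "(\<forall>v<n. s ''dep'' v = dep v) \<and> s ''d'' 0 = dd"
    and fr: "\<And>x. x \<notin> mods depth_phase \<Longrightarrow> s x = s0 x"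
  have "run (bounded LL BB) (\<lambda>s'. (s' ''W'' 0 = wrange n \<and> s' ''b'' 0 = wbits n) \<and>
      (\<forall>x. x \<notin> mods range_phase \<longrightarrow> s' x = s x)) ((2 * n + 1) * 8 + 7) range_phase s"
    by (rule run_frame[OF run_range_phase]) (use b B in \<open>simp_all add: fr s0_simps\<close>)
  then show "run (bounded LL BB) ready ((2 * n + 1) * 8 + 7) range_phase s"
    by (rule run_mono) (use d in \<open>auto simp: ready_def fr s0_simps\<close>)
qed (use bounded_s0 par_le dep_rec dep_le_n B in \<open>auto simp: s0_simps init_time_def\<close>)

lemma run_draw:
  "bounded LL BB s \<Longrightarrow> ready s \<Longrightarrow>
     run (bounded LL BB) (\<lambda>s'. ready s' \<and> s' ''R'' 0 < wrange n ^ (n * n)) (draw_time n) draw_phase s"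
  unfolding draw_time_def
  by (rule run_mono[OF run_frame[OF run_draw_phase]]) (auto simp: ready_def)

lemma run_eval:
  assumes b: "bounded LL BB s" and r: "ready s" "s ''R'' 0 = r"
  shows "run (bounded LL BB) (\<lambda>s'. s' ''result'' 0 \<noteq> 0 \<longleftrightarrow> acc r) (eval_time n dd) eval_phase s"
proof -
  define Y where "Y = int (wt n) ^ wD n"
  define T where "T = (\<lambda>e. int (wt n) ^ (w r e + wA n))"
  interpret ef: elim_forest n dd par dep E Y T "wM n" by (rule elim_forest)
  have "(5 :: nat) ^ dd \<le> 5 ^ n" using dd_le_n by (intro power_increasing) auto
  then have B5: "5 ^ dd \<le> BB" using B(11) by (rule le_trans)
  interpret m: machine n dd par dep E Y T "wM n" LL BB
    by unfold_locales (use dd_le_n B B5 wM_gt_1 in simp_all)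
  have rt: "m.round_time + 4 = round_bound n" by (simp add: m.round_time_def round_bound_def)
  have s: "s ''n'' 0 = n" "s ''k'' 0 = k" "s ''l'' 0 = l" "s ''result'' 0 = 0" "s ''d'' 0 = dd"
    "s ''W'' 0 = wrange n" "\<And>v. v < n \<Longrightarrow> s ''parent'' v = par v \<and> s ''dep'' v = dep v \<and> s ''S'' v = 0"
    "\<And>i. s ''adj'' i = of_bool (i < n * n \<and> (i div n, i mod n) \<in> parcs G)"
    using r(1) by (auto simp: ready_def)
  let ?Q = "\<lambda>s' :: state. s' ''result'' 0 \<noteq> 0 \<longleftrightarrow> acc r"
  let ?t6 = "(wA n + wD n) * n * 5 + wA n * 8 + (2 * n + 1) * 5 + 20"
  let ?t5 = "n * 6 + 5 + ?t6 + 1"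
  let ?t4 = "5 ^ dd * round_bound n + 3 + ?t5 + 1"
  let ?t3 = "n * 5 + 5 + ?t4 + 1"
  let ?t2 = "n * n * ((wrange n + wA n) * 5 + 14) + 3 + ?t3 + 1"
  show ?thesis
    unfolding eval_phase_def
  proof (rule run_Seq[OF run_const_phase[OF b s(1,6)], where ?t2.0 = ?t2])
    fix s1 assume b1: "bounded LL BB s1"
      and c1: "s1 ''t'' 0 = wt n \<and> s1 ''A'' 0 = wA n \<and> s1 ''D'' 0 = wD n \<and> s1 ''M'' 0 = wM n \<and>
        s1 ''y'' 0 = wt n ^ wD n \<and> s1 ''z'' 0 = (2 + 4 * (wM n - 1) * wt n ^ wD n) mod wM n"
      and fr1: "\<And>x. x \<notin> mods const_phase \<Longrightarrow> s1 x = s x"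
    show "run (bounded LL BB) ?Q ?t2 (Seq weight_phase (Seq (Raise ''X'' (Num 5) (Var ''d''))
       (Seq main_loop (Seq root_product output_phase)))) s1"
    proof (rule run_Seq[OF run_weight_phase[where r = r], where ?t2.0 = ?t3])
      fix s2 assume b2: "bounded LL BB s2"
        and T2: "\<forall>i<n * n. s2 ''T'' i = wt n ^ (digit (wrange n) r i + wA n)"
        and fr2: "\<And>x. x \<notin> mods weight_phase \<Longrightarrow> s2 x = s1 x"
      have X: "run (bounded LL BB) (\<lambda>s'. s' ''X'' 0 = 5 ^ dd) (n * 5 + 5) (Raise ''X'' (Num 5) (Var ''d'')) s2"
      proof (rule run_Raise[OF b2])
        fix j assume "j \<le> dd"
        then have "(5 :: nat) ^ j \<le> 5 ^ dd" by (intro power_increasing) auto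
        then show "5 ^ j \<le> BB" using B5 by (rule le_trans)
      qed (use s dd_le_n B(3) in \<open>simp_all add: fr2 fr1\<close>)
      show "run (bounded LL BB) ?Q ?t3 (Seq (Raise ''X'' (Num 5) (Var ''d''))
         (Seq main_loop (Seq root_product output_phase))) s2"
      proof (rule run_Seq[OF X, where ?t2.0 = ?t4])
        fix s3 assume b3: "bounded LL BB s3" and X3: "s3 ''X'' 0 = 5 ^ dd"
          and fr3: "\<And>x. x \<notin> mods (Raise ''X'' (Num 5) (Var ''d'')) \<Longrightarrow> s3 x = s2 x"
        have v3: "s3 ''n'' 0 = n" "s3 ''d'' 0 = dd" "s3 ''M'' 0 = wM n" "s3 ''y'' 0 = wt n ^ wD n"
          "s3 ''z'' 0 = (2 + 4 * (wM n - 1) * wt n ^ wD n) mod wM n" "s3 ''T'' = s2 ''T''" "s3 ''adj'' = s ''adj''"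
          "s3 ''dep'' = s ''dep''" "s3 ''parent'' = s ''parent''" "s3 ''S'' = s ''S''"
          using s c1 by (simp_all add: fr3 fr2 fr1)
        have env3: "m.env s3"
          unfolding m.env_def
        proof (intro conjI allI impI)
          fix u v assume uv: "u < n" "v < n"
          have i: "(u * n + v) div n = u" "(u * n + v) mod n = v" using uv by auto
          have "u * n + v < Suc u * n" using uv by simp
          also have "\<dots> \<le> n * n" using uv by (intro mult_right_mono) auto
          finally show "(0 < s3 ''adj'' (u * n + v) \<and> dep u < dep v) \<longleftrightarrow> (u, v) \<in> E"
            using i by (simp add: v3 s E_def)
        next
          fix u v assume uv: "(u, v) \<in> E"
          then have uv': "u < n" "v < n" using G_less by (auto simp: E_def)
          then have "u * n + v < Suc u * n" by simp
          also have "\<dots> \<le> n * n" using uv' by (intro mult_right_mono) auto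
          finally show "int (s3 ''T'' (u * n + v)) = T (u, v)"
            using T2 by (simp add: v3 T_def w_def)
        next
          assume "0 < n"
          then show "s3 ''y'' 0 < wM n"
            unfolding v3 wM_def using wt_ge_2 wD_pos by (intro power_strict_increasing) auto
        next
          \<comment> \<open>The expression stored in \<open>z\<close> differs from the weight of
            state 0 by a multiple of the modulus.\<close>
          have "2 + 4 * (int (wM n) - 1) * Y = 2 - 4 * Y + 4 * Y * int (wM n)" by (simp add: algebra_simps)
          then have "(2 + 4 * (int (wM n) - 1) * Y) mod int (wM n) = (2 - 4 * Y) mod int (wM n)"
            by (simp only: mod_mult_self1)
          moreover have "int (s3 ''z'' 0) = (2 + 4 * (int (wM n) - 1) * Y) mod int (wM n)"
            unfolding v3 using wM_gt_1 by (simp add: of_nat_mod Y_def of_nat_diff)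
          ultimately show "int (s3 ''z'' 0) = (2 - 4 * Y) mod int (wM n)" by simp
        qed (use s in \<open>simp_all add: v3 Y_def\<close>)
        show "run (bounded LL BB) ?Q ?t4 (Seq main_loop (Seq root_product output_phase)) s3"
        proof (rule run_Seq[OF m.run_main_loop[OF b3 env3 X3], where ?t2.0 = ?t5])
          fix s4 assume b4: "bounded LL BB s4" and S4: "ef.dp_inv (5 ^ dd) {} (s4 ''S'')"
            and fr4: "\<And>x. x \<notin> mods main_loop \<Longrightarrow> s4 x = s3 x"
          have env4: "m.env s4" by (rule m.env_cong[OF env3]) (auto simp: fr4)
          show "run (bounded LL BB) ?Q ?t5 (Seq root_product output_phase) s4"
          proof (rule run_Seq[OF m.run_root_product[OF b4 env4], where ?t2.0 = ?t6])
            fix v assume "v < n" "par v = 0"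
            then show "int (s4 ''S'' v) = ef.val v 0 mod int (wM n)" using ef.dp_inv_final[OF S4] by blast
          next
            fix s5 assume b5: "bounded LL BB s5"
              and Z5: "int (s5 ''Z'' 0) = partition5 {..<n} E Y T mod int (wM n)"
              and fr5: "\<And>x. x \<notin> mods root_product \<Longrightarrow> s5 x = s4 x"
            have z: "s5 ''Z'' 0 = nat (ZZ r mod int (wM n))"
              using Z5 unfolding ZZ_def Y_def T_def by (metis nat_int)
            have v5: "s5 ''n'' 0 = n" "s5 ''t'' 0 = wt n" "s5 ''A'' 0 = wA n" "s5 ''D'' 0 = wD n"
              "s5 ''k'' 0 = k" "s5 ''l'' 0 = l" "s5 ''result'' 0 = 0"
              using s c1 by (simp_all add: fr5 fr4 fr3 fr2 fr1)
            show "run (bounded LL BB) ?Q ?t6 output_phase s5"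
              unfolding acc_def by (rule run_output_phase[OF b5 v5(1-4) z v5(5-7)])
          qed simp
        qed (use s rt in \<open>simp_all add: v3\<close>)
      qed simp
    qed (use b1 c1 s r in \<open>simp_all add: fr1\<close>)
  qed (simp add: eval_time_def other_time_def)
qed

lemma run_draw_eval:
  "bounded LL BB s \<Longrightarrow> ready s \<Longrightarrow>
     run (bounded LL BB) (\<lambda>s'. s' ''result'' 0 \<noteq> 0 \<longrightarrow> partial_cycle_cover G k l)
       (Suc (draw_time n + eval_time n dd)) (Seq draw_phase eval_phase) s"
proof (rule run_Seq[OF run_draw])
  fix s' assume "bounded LL BB s'" "ready s' \<and> s' ''R'' 0 < wrange n ^ (n * n)"
  then show "run (bounded LL BB) (\<lambda>s'. s' ''result'' 0 \<noteq> 0 \<longrightarrow> partial_cycle_cover G k l)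
      (eval_time n dd) eval_phase s'"
    using acc_sound by (intro run_mono[OF run_eval[OF _ _ refl]]) auto
qed auto

lemma run_algorithm:
  "run (bounded LL BB) (\<lambda>s'. s' ''result'' 0 \<noteq> 0 \<longrightarrow> partial_cycle_cover G k l)
     (total_time n dd) algorithm s0"
  unfolding algorithm_def by (rule run_Seq[OF run_init run_draw_eval]) (auto simp: total_time_def)

text \<open>After conditioning on the state left by the initial phase, a wrong rejection requires a
  drawn number outside \<open>acc\<close>. That number is uniform, and by
  \<open>card_not_acc\<close> at most half of the values are bad.\<close>

lemma prob_reject:
  assumes "partial_cycle_cover G k l"
  shows "measure_pmf.prob (steps (total_time n dd) algorithm s0)
     {(c', s'). c' = SKIP \<and> (s' ''result'' 0 \<noteq> 0) = False} \<le> 1 / 2" (is "measure_pmf.prob _ ?A \<le> _")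
proof -
  let ?N = "wrange n ^ (n * n)"
  have eq: "steps (total_time n dd) algorithm s0 = bind_pmf (steps (init_time n) init_phase s0)
      (\<lambda>(_, s'). steps (Suc (draw_time n + eval_time n dd)) (Seq draw_phase eval_phase) s')"
    unfolding total_time_def algorithm_def by (rule steps_Seq[OF run_init run_draw_eval])
  have half: "measure_pmf.prob (steps (Suc (draw_time n + eval_time n dd)) (Seq draw_phase eval_phase) s) ?A \<le> 1 / 2"
    if "(c, s) \<in> set_pmf (steps (init_time n) init_phase s0)" for c s
  proof -
    have s: "ready s" using run_steps[OF run_init that] by simp
    have b: "bounded LL BB s" by (rule run_steps_inv[OF run_init that])
    let ?D = "steps (draw_time n) draw_phase s"
    let ?Bad = "(\<lambda>(_, s'). s' ''R'' 0) -` {r. \<not> acc r}"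
    have 1: "steps (Suc (draw_time n + eval_time n dd)) (Seq draw_phase eval_phase) s =
        bind_pmf ?D (\<lambda>(_, s'). steps (eval_time n dd) eval_phase s')"
      by (rule steps_Seq[OF run_draw[OF b s], where Q = "\<lambda>_. True"])
        (rule run_mono[OF run_eval[OF _ _ refl]], auto)
    have 2: "measure_pmf.prob (bind_pmf ?D (\<lambda>(_, s'). steps (eval_time n dd) eval_phase s')) ?A \<le>
        measure_pmf.prob ?D ?Bad"
    proof (rule prob_bind_le_prob)
      fix x assume x: "x \<in> set_pmf ?D" "x \<notin> ?Bad"
      obtain c' s' where cs: "x = (c', s')" by (cases x)
      have "bounded LL BB s'" "ready s'"
        using run_steps_inv[OF run_draw[OF b s]] run_steps[OF run_draw[OF b s]] x(1) cs by blast+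
      note ev = run_steps[OF run_eval[OF this refl]]
      have a: "acc (s' ''R'' 0)" using x(2) cs by simp
      have "y \<notin> ?A" if y: "y \<in> set_pmf (steps (eval_time n dd) eval_phase s')" for y
      proof -
        obtain c1 s1 where y1: "y = (c1, s1)" by (cases y)
        from ev[OF y[unfolded y1]] a have "s1 ''result'' 0 \<noteq> 0" by simp
        then show ?thesis using y1 by simp
      qed
      then have "set_pmf (steps (eval_time n dd) eval_phase s') \<inter> ?A = {}"
        by (intro equals0I) (elim IntE, rule notE)
      then show "measure_pmf.prob (case x of (_, s') \<Rightarrow> steps (eval_time n dd) eval_phase s') ?A = 0"
        unfolding cs prod.case by (subst measure_pmf_zero_iff)
    qed
    have 3: "measure_pmf.prob ?D ?Bad = measure_pmf.prob (pmf_of_set {..<?N}) {r. \<not> acc r}"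
      using draw_phase_uniform[of s n] s unfolding draw_time_def ready_def measure_map_pmf[symmetric] by simp
    have 4: "measure_pmf.prob (pmf_of_set {..<?N}) {r. \<not> acc r} = card ({..<?N} \<inter> {r. \<not> acc r}) / ?N"
      using wrange_pos[of n] by (subst measure_pmf_of_set) (auto simp: lessThan_empty_iff)
    have 5: "{..<?N} \<inter> {r. \<not> acc r} = {r. r < ?N \<and> \<not> acc r}" by auto
    have 6: "real (card {r. r < ?N \<and> \<not> acc r}) / real ?N \<le> 1 / 2"
    proof -
      have "real (2 * card {r. r < ?N \<and> \<not> acc r}) \<le> real ?N"
        using card_not_acc[OF assms] by (simp only: of_nat_le_iff)
      moreover have "0 < real ?N" using wrange_pos[of n] by simp
      ultimately show ?thesis by (simp add: divide_le_eq del: of_nat_power)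
    qed
    show ?thesis unfolding 1 by (rule order_trans[OF 2]) (use 3 4 6 in \<open>simp only: 5\<close>)
  qed
  show ?thesis unfolding eq
  proof (rule prob_bind_le)
    fix x assume x: "x \<in> set_pmf (steps (init_time n) init_phase s0)"
    obtain c s where "x = (c, s)" by (cases x)
    with x half show "measure_pmf.prob (case x of (_, s') \<Rightarrow>
        steps (Suc (draw_time n + eval_time n dd)) (Seq draw_phase eval_phase) s') ?A \<le> 1 / 2"
      by (simp only: prod.case)
  qed simp
qed

end

section \<open>Time and space of the whole program\<close>

lemma total_time_le: "d \<le> d' \<Longrightarrow>
  total_time n d \<le> 5 ^ d' * (round_bound n + other_time n + init_time n + draw_time n + 2)"
proof -
  assume d: "d \<le> d'"
  have p: "(5 :: nat) ^ d \<le> 5 ^ d'" using d by (intro power_increasing) auto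
  have one: "x \<le> 5 ^ d' * x" for x :: nat by simp
  have "5 ^ d * round_bound n \<le> 5 ^ d' * round_bound n" using p by (rule mult_le_mono1)
  then show ?thesis
    unfolding total_time_def eval_time_def distrib_left
    using one[of "other_time n"] one[of "init_time n"] one[of "draw_time n"] one[of 2] by linarith
qed

lemma poly_bounded_time:
  "poly_bounded (\<lambda>n. round_bound n + other_time n + init_time n + draw_time n + 2)"
  unfolding round_bound_def other_time_def init_time_def draw_time_def
  by (intro poly_bounded_intros)

lemma poly_nat_mono: "m \<le> n \<Longrightarrow> poly p m \<le> poly p n" for p :: "nat poly" and m n :: nat
  by (induction p) (auto intro: add_mono mult_mono)

definition variables :: "string set" where
  "variables = mods algorithm \<union> {''n'', ''k'', ''l'', ''adj'', ''parent''}"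

text \<open>Each of the three summands is at most \<open>2 ^ e\<close>, where \<open>e\<close> is
  the sum of the three lengths; their sum is below \<open>4 * 2 ^ e\<close>, hence the two extra
  bits.\<close>

lemma floorlog_sum_le:
  assumes "a \<le> 2 ^ p"
  shows "floorlog 2 (a + k + l) \<le> p + floorlog 2 k + floorlog 2 l + 2"
proof (rule floorlog_leI)
  let ?e = "p + floorlog 2 k + floorlog 2 l"
  have lt: "x < 2 ^ floorlog 2 x" for x :: nat by (rule floorlog_leD) auto
  have up: "x \<le> 2 ^ ?e" if "x \<le> 2 ^ i" "i \<le> ?e" for x i :: nat
    using that(1) by (rule le_trans) (intro power_increasing that(2), simp)
  have "a \<le> 2 ^ ?e" "k \<le> 2 ^ ?e" "l \<le> 2 ^ ?e"
    using assms less_imp_le[OF lt[of k]] less_imp_le[OF lt[of l]] by (auto intro: up)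
  moreover have "0 < (2 :: nat) ^ ?e" by simp
  ultimately have "a + k + l < 2 ^ ?e + 2 ^ ?e + 2 ^ ?e + 2 ^ ?e" by linarith
  also have "\<dots> = 2 ^ (?e + 2)" by simp
  finally show "a + k + l < 2 ^ (?e + 2)" .
qed auto

lemma bit_size_le:
  assumes b: "bounded L B s" and V: "finite V" "\<And>x. x \<notin> V \<Longrightarrow> s x = (\<lambda>_. 0)"
  shows "finite {(x, i). s x i \<noteq> 0} \<and> bit_size s \<le> card V * L * (L + floorlog 2 B)"
proof -
  have sub: "{(x, i). s x i \<noteq> 0} \<subseteq> V \<times> {..<L}"
  proof (rule subrelI, elim CollectE case_prodE Pair_inject, hypsubst)
    fix x i assume nz: "s x i \<noteq> 0"
    then have "x \<in> V" using V(2)[of x] by (cases "x \<in> V") auto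
    moreover have "i < L" using b nz unfolding bounded_def by (meson not_le)
    ultimately show "(x, i) \<in> V \<times> {..<L}" by simp
  qed
  have fin: "finite (V \<times> {..<L})" using V(1) by simp
  have le: "floorlog 2 i + floorlog 2 (s x i) \<le> L + floorlog 2 B" if "s x i \<noteq> 0" for x i
  proof -
    have "i < L" using b that unfolding bounded_def by (meson not_le)
    \<comment> \<open>The crude bound of \<open>L\<close> bits per address is good enough because
      \<open>L\<close> will be polynomial in \<open>n\<close>.\<close>
    then have "i < 2 ^ L" using less_exp[of L] by linarith
    then have "floorlog 2 i \<le> L" by (intro floorlog_leI) auto
    moreover have "floorlog 2 (s x i) \<le> floorlog 2 B"
      using b by (intro floorlog_mono) (simp add: bounded_def)
    ultimately show ?thesis by simp
  qed
  have "bit_size s \<le> (\<Sum>(x, i) | s x i \<noteq> 0. L + floorlog 2 B)"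
    unfolding bit_size_def using le by (intro sum_mono) auto
  also have "\<dots> = card {(x, i). s x i \<noteq> 0} * (L + floorlog 2 B)" by (simp add: case_prod_unfold)
  also have "\<dots> \<le> card (V \<times> {..<L}) * (L + floorlog 2 B)"
    using card_mono[OF fin sub] by (rule mult_le_mono1)
  finally show ?thesis using finite_subset[OF sub fin] by (simp add: card_cartesian_product)
qed

text \<open>The invariant part of \<open>run_algorithm\<close> bounds every reachable state, not
  only the final one; arrays outside \<open>variables\<close> are 0 in the input and never
  written.\<close>

lemma (in instance_of) space_algorithm:
  assumes g: "cell_bound n \<le> 2 ^ g"
  shows "space_within algorithm s0
    (card variables * (n * n + n + 1) * (n * n + n + 1 + (g + floorlog 2 k + floorlog 2 l + 2)))"
  unfolding space_within_def
proof (intro allI ballI, clarify)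
  fix t c' s' assume s': "(c', s') \<in> set_pmf (steps t algorithm s0)"
  have b: "bounded LL BB s'" by (rule run_steps_inv[OF run_algorithm s'])
  have "s' x = (\<lambda>_. 0)" if "x \<notin> variables" for x
    using steps_mods[OF s', of x] that by (simp add: variables_def s0_simps)
  then have "finite {(x, i). s' x i \<noteq> 0} \<and> bit_size s' \<le> card variables * LL * (LL + floorlog 2 BB)"
    by (intro bit_size_le b) (auto simp: variables_def)
  moreover have "card variables * LL * (LL + floorlog 2 BB) \<le>
      card variables * LL * (LL + (g + floorlog 2 k + floorlog 2 l + 2))"
    using floorlog_sum_le[OF g, of k l] by (intro mult_le_mono2 add_left_mono)
  ultimately show "finite {(x, i). s' x i \<noteq> 0} \<and> bit_size s' \<le> card variables * (n * n + n + 1) *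
      (n * n + n + 1 + (g + floorlog 2 k + floorlog 2 l + 2))" by (meson le_trans)
qed

lemma space_poly:
  "\<exists>q :: nat poly. \<forall>G F n k l. instance_of G F n \<longrightarrow>
    space_within algorithm (input_state n G F k l) (poly q (input_size n k l))"
proof -
  obtain g where g: "poly_bounded g" "\<And>n. cell_bound n \<le> 2 ^ g n"
    using exp_poly_bounded_cell_bound by (auto simp: exp_poly_bounded_def)
  obtain p :: "nat poly" where p: "\<And>n. g n \<le> poly p n" using g(1) by (auto simp: poly_bounded_def)
  have "poly_bounded (\<lambda>m. card variables * (m * m + m + 1) * (m * m + m + 1 + (poly p m + m + m + 2)))"
    by (intro poly_bounded_intros) (auto simp: poly_bounded_def)
  then obtain q :: "nat poly" where
    q: "\<And>m. card variables * (m * m + m + 1) * (m * m + m + 1 + (poly p m + m + m + 2)) \<le> poly q m"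
    by (auto simp: poly_bounded_def)
  show ?thesis
  proof (intro exI[of _ q] allI impI)
    fix G F n k l assume "instance_of G F n"
    then interpret instance_of G F n k l .
    let ?m = "input_size n k l"
    have m: "n \<le> ?m" "floorlog 2 k \<le> ?m" "floorlog 2 l \<le> ?m" by (auto simp: input_size_def)
    have nn: "n * n + n + 1 \<le> ?m * ?m + ?m + 1" using m(1) by (intro add_mono mult_mono) auto
    have "card variables * (n * n + n + 1) * (n * n + n + 1 + (poly p n + floorlog 2 k + floorlog 2 l + 2)) \<le>
        card variables * (?m * ?m + ?m + 1) * (?m * ?m + ?m + 1 + (poly p ?m + ?m + ?m + 2))"
      using nn m poly_nat_mono[OF m(1), of p] by (intro mult_mono add_mono) auto
    also have "\<dots> \<le> poly q ?m" by (rule q)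
    finally have le: "card variables * (n * n + n + 1) *
      (n * n + n + 1 + (poly p n + floorlog 2 k + floorlog 2 l + 2)) \<le> poly q ?m" .
    have "cell_bound n \<le> 2 ^ poly p n"
      by (rule le_trans[OF g(2)]) (intro power_increasing p, simp)
    from space_algorithm[OF this] le show "space_within algorithm (input_state n G F k l) (poly q ?m)"
      unfolding space_within_def by (fastforce intro: le_trans)
  qed
qed

theorem theorem2:
  shows "\<exists>(alg :: com) (p :: nat poly) (q :: nat poly).
    \<forall>(n :: nat) (d :: nat) (k :: nat) (l :: nat)
      (G :: nat pair_pre_digraph) (F :: nat pair_pre_digraph).
      pair_graph G \<and> pverts G = {..<n} \<and> elimination_forest F G \<and> forest_depth F = d \<longrightarrow>
        halts_within alg (input_state n G F k l) (5 ^ d * poly p n) \<and>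
        space_within alg (input_state n G F k l) (poly q (input_size n k l)) \<and>
        (partial_cycle_cover G k l \<longrightarrow>
           answer_prob alg (input_state n G F k l) (5 ^ d * poly p n) False \<le> 1 / 2) \<and>
        (\<not> partial_cycle_cover G k l \<longrightarrow>
           answer_prob alg (input_state n G F k l) (5 ^ d * poly p n) True = 0)"
proof -
  obtain p :: "nat poly" where
    p: "\<And>n. round_bound n + other_time n + init_time n + draw_time n + 2 \<le> poly p n"
    using poly_bounded_time by (auto simp: poly_bounded_def)
  obtain q :: "nat poly" where q: "\<And>G F n k l. instance_of G F n \<Longrightarrow>
      space_within algorithm (input_state n G F k l) (poly q (input_size n k l))"
    using space_poly by blast
  show ?thesis
  proof (rule exI[of _ algorithm], rule exI[of _ p], rule exI[of _ q], intro allI impI, elim conjE)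
    fix n d k l and G F :: "nat pair_pre_digraph"
    assume H: "pair_graph G" "pverts G = {..<n}" "elimination_forest F G" "forest_depth F = d"
    then have inst: "instance_of G F n" by (simp add: instance_of_def)
    interpret instance_of G F n k l by (rule inst)
    let ?T = "5 ^ d * poly p n"
    \<comment> \<open>The program works with \<open>dd\<close>, the largest depth of a vertex that
      it computes itself; the time bound follows from
      \<open>dd \<le> forest_depth F\<close>.\<close>
    have "total_time n dd \<le> 5 ^ d * (round_bound n + other_time n + init_time n + draw_time n + 2)"
      using max_depth_le H(4) by (intro total_time_le) simp
    also have "\<dots> \<le> ?T" using p by (rule mult_le_mono2)
    finally have T: "total_time n dd \<le> ?T" .
    have run: "run (bounded LL BB) (\<lambda>s'. s' ''result'' 0 \<noteq> 0 \<longrightarrow> partial_cycle_cover G k l) ?T algorithm s0"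
      by (rule run_mono[OF run_algorithm T])
    have "halts_within algorithm s0 ?T"
      unfolding halts_within_def using run_steps[OF run] by blast
    moreover have "answer_prob algorithm s0 ?T False \<le> 1 / 2" if "partial_cycle_cover G k l"
      unfolding answer_prob_def steps_stable[OF run_algorithm T] by (rule prob_reject[OF that])
    moreover have "answer_prob algorithm s0 ?T True = 0" if "\<not> partial_cycle_cover G k l"
    proof -
      have "set_pmf (steps ?T algorithm s0) \<inter> {(c', s'). c' = SKIP \<and> (s' ''result'' 0 \<noteq> 0) = True} = {}"
        using run_steps[OF run] that by blast
      then show ?thesis unfolding answer_prob_def by (subst measure_pmf_zero_iff)
    qed
    ultimately show "halts_within algorithm s0 ?T \<and>
        space_within algorithm s0 (poly q (input_size n k l)) \<and>
        (partial_cycle_cover G k l \<longrightarrow> answer_prob algorithm s0 ?T False \<le> 1 / 2) \<and>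
        (\<not> partial_cycle_cover G k l \<longrightarrow> answer_prob algorithm s0 ?T True = 0)"
      using q[OF inst] by blast
  qed
qed

end
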